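(* Let $K\subset\mathbb{R}^n$ be a convex body and suppose that $\partial K\in C^k$ for some integer $k\ge 0$. Then for any $0<\delta<|K|$, $\partial M_\delta(K)\in C^{k+1}$.
   Context: A convex body in $\mathbb{R}^n$ is a compact convex set with non-empty interior; $|K|$ is its Lebesgue volume and $\partial K$ its boundary. For $0<\delta<|K|$, the Ulam floating body of $K$ is $$M_\delta(K)=\left\{\frac1\delta\int_K y f(y)\,dy\;:\; f:K\to[0,1]\text{ measurable},\ \frac1\delta\int_K f(y)\,dy=1\right\}.$$ For a convex body $L$, $\partial L\in C^k$ means that the boundary of $L$ is of class $C^k$; equivalently, for some interior point $v$ of $L$, the radial function $\theta\mapsto\rho_v(\theta)=\max\{r\ge 0: v+r\theta\in L\}$ is $C^k$ on $\mathbb{S}^{n-1}$. *)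

theory Defs
  imports "HOL-Analysis.Analysis"
begin

definition convex_body :: "'a::euclidean_space set \<Rightarrow> bool" where
  "convex_body K \<longleftrightarrow> compact K \<and> convex K \<and> interior K \<noteq> {}"

definition ulam_floating_body :: "real \<Rightarrow> 'a::euclidean_space set \<Rightarrow> 'a set" where
  "ulam_floating_body \<delta> K =
     {(1 / \<delta>) *\<^sub>R (LINT y|lebesgue_on K. f y *\<^sub>R y) | f :: 'a \<Rightarrow> real.
        f \<in> borel_measurable (lebesgue_on K) \<and> f \<in> K \<rightarrow> {0..1} \<and>
        (1 / \<delta>) * (LINT y|lebesgue_on K. f y) = 1}"

(* The intended domain is an open set U, where the two-sided derivative at each point
   makes sense; in finite dimension, continuity of all iterated directional derivatives
   is then the usual notion of a C^k map. *)
primrec Ck_on_open :: "nat \<Rightarrow> ('a::euclidean_space \<Rightarrow> 'b::euclidean_space) \<Rightarrow> 'a set \<Rightarrow> bool" where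
  "Ck_on_open 0 f U \<longleftrightarrow> continuous_on U f"
| "Ck_on_open (Suc k) f U \<longleftrightarrow>
     (\<forall>x\<in>U. f differentiable (at x)) \<and>
     (\<forall>v. Ck_on_open k (\<lambda>x. frechet_derivative f (at x) v) U)"

(* C^k on an arbitrary subset of Euclidean space: local extendability to C^k maps on open
   sets. For an embedded smooth submanifold such as the sphere this is the same as being
   C^k in charts. *)
definition Ck_on :: "nat \<Rightarrow> ('a::euclidean_space \<Rightarrow> 'b::euclidean_space) \<Rightarrow> 'a set \<Rightarrow> bool" where
  "Ck_on k f S \<longleftrightarrow>
     (\<forall>x\<in>S. \<exists>U g. open U \<and> x \<in> U \<and> Ck_on_open k g U \<and> (\<forall>y\<in>S \<inter> U. g y = f y))"

definition radial_function :: "'a::euclidean_space set \<Rightarrow> 'a \<Rightarrow> 'a \<Rightarrow> real" where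
  "radial_function L v \<theta> = (GREATEST r. 0 \<le> r \<and> v + r *\<^sub>R \<theta> \<in> L)"

(* For convex bodies L; the radial description also covers k = 0. *)
definition Ck_boundary :: "nat \<Rightarrow> 'a::euclidean_space set \<Rightarrow> bool" where
  "Ck_boundary k L \<longleftrightarrow> (\<exists>v\<in>interior L. Ck_on k (radial_function L v) (sphere 0 1))"

end

theory Submission
  imports Defs
begin

text \<open>
  The support function of \<open>M = M\<^sub>\<delta>(K)\<close> in direction \<open>u\<close> is attained exactly at the
  centroid of the cap of volume \<open>\<delta>\<close> that a hyperplane orthogonal to \<open>u\<close> cuts off from \<open>K\<close>
  (bathtub principle), and a cap determines its hyperplane. Hence every boundary point of \<open>M\<close> has
  a unique outer normal; by compactness the normal depends continuously on the point, so the boundary is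
  \<open>C\<^sup>1\<close>. In general the derivative of the gauge of \<open>M\<close> is the polar normal \<open>\<nu>\<close>, so it suffices that
  \<open>\<nu>\<close> is \<open>C\<^sup>k\<close>. For \<open>k \<ge> 1\<close>, volume and moment of the cap \<open>{y \<in> K. t \<le> u \<bullet> y}\<close> are \<open>C\<^sup>k\<close>
  functions of \<open>(u, t)\<close>: in polar form around an interior point of \<open>K\<close> on the hyperplane they are
  integrals of powers of a \<open>C\<^sup>k\<close> radial function over a half annulus, which a smooth family of
  reflections makes independent of \<open>(u, t)\<close>. The map from \<open>(u, t)\<close> to volume and (rescaled) moment
  has an injective derivative, because tilting or moving the hyperplane changes the cap to first order;
  inverting it yields \<open>\<nu>\<close>.
\<close>

subsection \<open>Calculus of \<open>C\<^sup>k\<close> maps\<close>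

text \<open>The extra derivative comes from an envelope argument: the gauge of M is x . \<nu>(x),
  where \<nu>(x) maximizes x . w over the polar body, and its derivative in direction h is h .
  \<nu>(x), with no derivative of \<nu> in it. For k >= 1 the obstacle is the edge where the
  hyperplane meets the boundary of K, which moves with (u, t). In polar form around a point of the
  hyperplane the flat face becomes the condition 0 <= u . z on directions alone, so that hyperplane
  and boundary no longer interact. Volume V and moment Y depend only on the cap, hence are constant
  along (c u, c t), c > 0, and their joint derivative kills (u, t). By extremality of the cap its
  range also obeys u . dY = (t - u . v) dV. One dimension is thus lost on either side; the scalar
  factor u . u1 on the moment restores both at once, so that the inverse function theorem applies
  between spaces of dimension n + 1.\<close>

lemma Ck_on_open_cong:
  assumes "open U" "\<And>x. x \<in> U \<Longrightarrow> f x = g x"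
  shows "Ck_on_open k f U \<longleftrightarrow> Ck_on_open k g U"
  using assms(2)
proof (induction k arbitrary: f g)
  case 0
  then show ?case by (simp cong: continuous_on_cong)
next
  case (Suc k)
  have imp: "Ck_on_open (Suc k) g U"
    if f: "Ck_on_open (Suc k) f U" and eq: "\<And>x. x \<in> U \<Longrightarrow> f x = g x"
    for f g :: "'a \<Rightarrow> 'b"
  proof -
    have d: "frechet_derivative f (at x) = frechet_derivative g (at x)" if "x \<in> U" for x
      using f that assms(1) eq by (auto intro!: frechet_derivative_transform_within_open)
    have "g differentiable at x" if "x \<in> U" for x
      using f that assms(1) eq
      by (meson Ck_on_open.simps(2) differentiable_def has_derivative_transform_within_open)
    moreover have "Ck_on_open k (\<lambda>x. frechet_derivative g (at x) v) U" for v
      using f Suc.IH[of "\<lambda>x. frechet_derivative f (at x) v" "\<lambda>x. frechet_derivative g (at x) v"] d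
      by simp
    ultimately show ?thesis by simp
  qed
  show ?case using imp[of f g] imp[of g f] Suc.prems by metis
qed

lemma Ck_on_open_Suc_derivative:
  assumes "Ck_on_open (Suc k) f U" "x \<in> U"
  shows "(f has_derivative frechet_derivative f (at x)) (at x)"
  using assms by (simp add: frechet_derivative_works)

lemma Ck_on_open_Suc_directional:
  "Ck_on_open (Suc k) f U \<Longrightarrow> Ck_on_open k (\<lambda>x. frechet_derivative f (at x) v) U"
  by simp

text \<open>Derivatives at a point are unique, so an explicit formula \<open>f'\<close> may stand
  for \<open>frechet_derivative\<close>. Most closure rules below are inductions on the order
  through this rule.\<close>

lemma Ck_on_open_SucI:
  assumes "open U" "\<And>x. x \<in> U \<Longrightarrow> (f has_derivative f' x) (at x)"
    and "\<And>v. Ck_on_open k (\<lambda>x. f' x v) U"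
  shows "Ck_on_open (Suc k) f U"
proof -
  have "Ck_on_open k (\<lambda>x. frechet_derivative f (at x) v) U" for v
    using assms(3)[of v] assms(2)
    by (subst Ck_on_open_cong[OF assms(1), of _ "\<lambda>x. f' x v"])
       (metis frechet_derivative_at)+
  with assms(2) show ?thesis by (auto simp: differentiable_def)
qed

lemma Ck_on_open_subset: "Ck_on_open k f U \<Longrightarrow> V \<subseteq> U \<Longrightarrow> Ck_on_open k f V"
  by (induction k arbitrary: f) (auto intro: continuous_on_subset)

lemma Ck_on_open_local:
  assumes "\<And>x. x \<in> U \<Longrightarrow> \<exists>V. open V \<and> x \<in> V \<and> Ck_on_open k f V"
  shows "Ck_on_open k f U"
  using assms
proof (induction k arbitrary: f)
  case 0
  have "isCont f x" if "x \<in> U" for x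
    using "0.prems"[OF that] by (auto simp: continuous_on_eq_continuous_at)
  then show ?case by (simp add: continuous_at_imp_continuous_on)
next
  case (Suc k)
  have "f differentiable at x" if "x \<in> U" for x
    using Suc.prems[OF that] by auto
  moreover have "Ck_on_open k (\<lambda>x. frechet_derivative f (at x) v) U" for v
    using Suc.prems by (intro Suc.IH) fastforce
  ultimately show ?case by simp
qed

lemma Ck_on_open_imp_continuous_on: "Ck_on_open k f U \<Longrightarrow> continuous_on U f"
  by (cases k) (auto simp: continuous_at_imp_continuous_on differentiable_imp_continuous_within)

lemma Ck_on_open_SucD: "Ck_on_open (Suc k) f U \<Longrightarrow> Ck_on_open k f U"
proof (induction k arbitrary: f)
  case 0
  then show ?case using Ck_on_open_imp_continuous_on by (metis Ck_on_open.simps(1))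
qed auto

declare Ck_on_open.simps(2) [simp del]

lemma Ck_on_open_const: "Ck_on_open k (\<lambda>x. c) U"
proof (induction k arbitrary: c)
  case (Suc k)
  then show ?case by (simp add: Ck_on_open.simps(2))
qed simp

lemma Ck_on_open_add:
  assumes "open U"
  shows "Ck_on_open k f U \<Longrightarrow> Ck_on_open k g U \<Longrightarrow> Ck_on_open k (\<lambda>x. f x + g x) U"
proof (induction k arbitrary: f g)
  case 0
  then show ?case by (simp add: continuous_on_add)
next
  case (Suc k)
  show ?case
  proof (rule Ck_on_open_SucI[OF assms])
    fix x assume "x \<in> U"
    show "((\<lambda>x. f x + g x) has_derivative
        (\<lambda>v. frechet_derivative f (at x) v + frechet_derivative g (at x) v)) (at x)"
      using Suc.prems \<open>x \<in> U\<close> by (intro has_derivative_add Ck_on_open_Suc_derivative)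
  qed (intro Suc.IH Ck_on_open_Suc_directional Suc.prems)
qed

lemma Ck_on_open_sum:
  assumes "open U" "\<And>i. i \<in> I \<Longrightarrow> Ck_on_open k (f i) U"
  shows "Ck_on_open k (\<lambda>x. \<Sum>i\<in>I. f i x) U"
  using assms(2)
proof (induction I rule: infinite_finite_induct)
  case (insert i I)
  then show ?case using Ck_on_open_add[OF assms(1), of k "f i"] by simp
qed (simp_all add: Ck_on_open_const)

lemma Ck_on_open_linear_compose:
  assumes "open U" "bounded_linear h"
  shows "Ck_on_open k f U \<Longrightarrow> Ck_on_open k (\<lambda>x. h (f x)) U"
proof (induction k arbitrary: f)
  case 0
  then show ?case
    by (auto intro: bounded_linear.continuous_on[OF assms(2)])
next
  case (Suc k)
  show ?case
    by (rule Ck_on_open_SucI[OF assms(1) bounded_linear.has_derivative[OF assms(2) Ck_on_open_Suc_derivative[OF Suc.prems]]])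
       (assumption, intro Suc.IH Ck_on_open_Suc_directional Suc.prems)
qed

lemma Ck_on_open_bounded_linear:
  assumes "open U" "bounded_linear h"
  shows "Ck_on_open k h U"
proof (cases k)
  case 0
  then show ?thesis using assms(2) by (auto intro: linear_continuous_on)
next
  case (Suc j)
  show ?thesis unfolding Suc
    by (rule Ck_on_open_SucI[OF assms(1) bounded_linear_imp_has_derivative[OF assms(2)] Ck_on_open_const])
qed

lemma Ck_on_open_ident: "open U \<Longrightarrow> Ck_on_open k (\<lambda>x. x) U"
  by (simp add: Ck_on_open_bounded_linear)

text \<open>The product rule pairs one function with a derivative of the other, so the induction has
  to vary both and to lower the undifferentiated one by one order.\<close>

lemma Ck_on_open_bilinear:
  assumes "open U" "bounded_bilinear bop"
  shows "Ck_on_open k f U \<Longrightarrow> Ck_on_open k g U \<Longrightarrow> Ck_on_open k (\<lambda>x. bop (f x) (g x)) U"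
proof (induction k arbitrary: f g)
  case 0
  then show ?case
    by (auto intro: bounded_bilinear.continuous_on[OF assms(2)])
next
  case (Suc k)
  show ?case
  proof (rule Ck_on_open_SucI[OF assms(1)])
    fix x assume x: "x \<in> U"
    show "((\<lambda>x. bop (f x) (g x)) has_derivative
        (\<lambda>v. bop (f x) (frechet_derivative g (at x) v) + bop (frechet_derivative f (at x) v) (g x))) (at x)"
      using Suc.prems x
      by (intro bounded_bilinear.FDERIV[OF assms(2)] Ck_on_open_Suc_derivative)
  next
    fix v
    show "Ck_on_open k (\<lambda>x. bop (f x) (frechet_derivative g (at x) v) + bop (frechet_derivative f (at x) v) (g x)) U"
      by (intro Ck_on_open_add assms(1) Suc.IH Ck_on_open_Suc_directional
          Suc.prems[THEN Ck_on_open_SucD] Suc.prems)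
  qed
qed

lemmas Ck_on_open_inner = Ck_on_open_bilinear[OF _ bounded_bilinear_inner]
lemmas Ck_on_open_scaleR = Ck_on_open_bilinear[OF _ bounded_bilinear_scaleR]

lemma Ck_on_open_mult:
  fixes f g :: "'a::euclidean_space \<Rightarrow> real"
  assumes "open U" "Ck_on_open k f U" "Ck_on_open k g U"
  shows "Ck_on_open k (\<lambda>x. f x * g x) U"
  using Ck_on_open_scaleR[OF assms] by simp

lemma Ck_on_open_minus:
  assumes "open U" "Ck_on_open k f U"
  shows "Ck_on_open k (\<lambda>x. - f x) U"
  using Ck_on_open_linear_compose[OF assms(1) bounded_linear_minus[OF bounded_linear_ident] assms(2)] .

lemma Ck_on_open_diff:
  assumes "open U" "Ck_on_open k f U" "Ck_on_open k g U"
  shows "Ck_on_open k (\<lambda>x. f x - g x) U"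
  using Ck_on_open_add[OF assms(1,2) Ck_on_open_minus[OF assms(1,3)]] by simp

lemma Ck_on_open_Pair:
  assumes "open U" "Ck_on_open k f U" "Ck_on_open k g U"
  shows "Ck_on_open k (\<lambda>x. (f x, g x)) U"
proof -
  have "bounded_linear (\<lambda>a::'b. (a, 0::'c))" "bounded_linear (\<lambda>a::'c. (0::'b, a))"
    by (auto intro!: bounded_linear_Pair bounded_linear_ident bounded_linear_zero)
  from Ck_on_open_add[OF assms(1) Ck_on_open_linear_compose[OF assms(1) this(1) assms(2)]
      Ck_on_open_linear_compose[OF assms(1) this(2) assms(3)]]
  show ?thesis by simp
qed

lemma Ck_on_open_fst: "open U \<Longrightarrow> Ck_on_open k f U \<Longrightarrow> Ck_on_open k (\<lambda>x. fst (f x)) U"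
  by (rule Ck_on_open_linear_compose[OF _ bounded_linear_fst])

lemma Ck_on_open_snd: "open U \<Longrightarrow> Ck_on_open k f U \<Longrightarrow> Ck_on_open k (\<lambda>x. snd (f x)) U"
  by (rule Ck_on_open_linear_compose[OF _ bounded_linear_snd])

lemma linear_eq_sum_Basis:
  assumes "linear h"
  shows "h v = (\<Sum>b\<in>Basis. (v \<bullet> b) *\<^sub>R h b)"
proof -
  have "h v = h (\<Sum>b\<in>Basis. (v \<bullet> b) *\<^sub>R b)" by (simp add: euclidean_representation)
  then show ?thesis by (simp only: linear_sum[OF assms] linear_scale[OF assms])
qed

text \<open>The chain rule produces a derivative of f in a direction that varies with x, while
  \<open>Ck_on_open\<close> speaks of fixed directions. Expanding the direction in the basis leaves
  products of coordinates of the derivative of g with compositions to which the induction hypothesis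
  applies.\<close>

lemma Ck_on_open_compose:
  assumes "open U" "open V" "g \<in> U \<rightarrow> V"
  shows "Ck_on_open k f V \<Longrightarrow> Ck_on_open k g U \<Longrightarrow> Ck_on_open k (\<lambda>x. f (g x)) U"
proof (induction k arbitrary: f)
  case 0
  then show ?case using assms by (auto intro: continuous_on_compose2)
next
  case (Suc k)
  let ?f' = "\<lambda>x. frechet_derivative f (at x)" and ?g' = "\<lambda>x. frechet_derivative g (at x)"
  have V: "g x \<in> V" if "x \<in> U" for x using assms(3) that by auto
  show ?case
  proof (rule Ck_on_open_SucI[OF assms(1)])
    fix x assume x: "x \<in> U"
    have "((\<lambda>x. f (g x)) has_derivative (\<lambda>v. ?f' (g x) (?g' x v))) (at x)"
      using Suc.prems x V[OF x] by (intro has_derivative_compose[of g _ _ _ f] Ck_on_open_Suc_derivative)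
    moreover have "linear (?f' (g x))"
      using Suc.prems V[OF x] by (auto simp: Ck_on_open.simps(2) intro: linear_frechet_derivative)
    then have "?f' (g x) (?g' x v) = (\<Sum>b\<in>Basis. (?g' x v \<bullet> b) *\<^sub>R ?f' (g x) b)" for v
      by (rule linear_eq_sum_Basis)
    ultimately show "((\<lambda>x. f (g x)) has_derivative (\<lambda>v. \<Sum>b\<in>Basis. (?g' x v \<bullet> b) *\<^sub>R ?f' (g x) b)) (at x)"
      by simp
  next
    fix v
    show "Ck_on_open k (\<lambda>x. \<Sum>b\<in>Basis. (?g' x v \<bullet> b) *\<^sub>R ?f' (g x) b) U"
      by (intro Ck_on_open_sum Ck_on_open_scaleR Ck_on_open_inner Ck_on_open_const assms(1) Suc.IH
          Ck_on_open_Suc_directional Suc.prems Suc.prems(2)[THEN Ck_on_open_SucD])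
  qed
qed

lemma Ck_on_open_derivative_compose:
  assumes "open U" "open V" "g \<in> U \<rightarrow> V"
    and "Ck_on_open (Suc k) f V" "Ck_on_open k g U" "Ck_on_open k h U"
  shows "Ck_on_open k (\<lambda>x. frechet_derivative f (at (g x)) (h x)) U"
proof -
  have V: "g x \<in> V" if "x \<in> U" for x using assms(3) that by auto
  have *: "Ck_on_open k (\<lambda>x. \<Sum>b\<in>Basis. (h x \<bullet> b) *\<^sub>R frechet_derivative f (at (g x)) b) U"
    by (intro Ck_on_open_sum Ck_on_open_scaleR Ck_on_open_inner Ck_on_open_const assms
         Ck_on_open_compose[OF assms(1-3) Ck_on_open_Suc_directional[OF assms(4)] assms(5)])
  have eq: "frechet_derivative f (at (g x)) (h x) =
      (\<Sum>b\<in>Basis. (h x \<bullet> b) *\<^sub>R frechet_derivative f (at (g x)) b)" if "x \<in> U" for x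
    proof (rule linear_eq_sum_Basis)
    show "linear (frechet_derivative f (at (g x)))"
      using assms(4) V[OF that] by (auto simp: Ck_on_open.simps(2) intro: linear_frechet_derivative)
  qed
  show ?thesis by (rule iffD2[OF Ck_on_open_cong[OF assms(1) eq] *])
qed

lemma Ck_on_open_inverse:
  fixes f :: "'a::euclidean_space \<Rightarrow> real"
  assumes "open U" "\<And>x. x \<in> U \<Longrightarrow> f x \<noteq> 0"
  shows "Ck_on_open k f U \<Longrightarrow> Ck_on_open k (\<lambda>x. inverse (f x)) U"
proof (induction k)
  case 0
  then show ?case using assms by (auto intro: continuous_on_inverse)
next
  case (Suc k)
  show ?case
  proof (rule Ck_on_open_SucI[OF assms(1)])
    fix x assume x: "x \<in> U"
    show "((\<lambda>x. inverse (f x)) has_derivative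
      (\<lambda>v. - (inverse (f x) * frechet_derivative f (at x) v * inverse (f x)))) (at x)"
      using Suc.prems x assms(2) by (intro Deriv.has_derivative_inverse Ck_on_open_Suc_derivative)
  next
    fix v
    have "Ck_on_open k (\<lambda>x. inverse (f x)) U"
      by (intro Suc.IH Suc.prems[THEN Ck_on_open_SucD])
    then show "Ck_on_open k (\<lambda>x. - (inverse (f x) * frechet_derivative f (at x) v * inverse (f x))) U"
      by (intro Ck_on_open_minus Ck_on_open_mult assms(1) Ck_on_open_Suc_directional Suc.prems)
  qed
qed

lemma Ck_on_open_divide:
  fixes f :: "'a::euclidean_space \<Rightarrow> real"
  assumes "open U" "Ck_on_open k f U" "Ck_on_open k g U" "\<And>x. x \<in> U \<Longrightarrow> g x \<noteq> 0"
  shows "Ck_on_open k (\<lambda>x. f x / g x) U"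
  unfolding divide_inverse using assms by (intro Ck_on_open_mult Ck_on_open_inverse)

lemma Ck_on_open_power:
  fixes f :: "'a::euclidean_space \<Rightarrow> real"
  assumes "open U" "Ck_on_open k f U"
  shows "Ck_on_open k (\<lambda>x. f x ^ n) U"
  by (induction n) (auto intro: Ck_on_open_const Ck_on_open_mult assms)

text \<open>The derivative of the norm is algebraic in x and the norm itself, so the smoothness of
  the norm feeds its own induction.\<close>

lemma Ck_on_open_norm: "Ck_on_open k (norm :: 'a::euclidean_space \<Rightarrow> real) (- {0})"
proof (induction k)
  case 0
  then show ?case by (simp add: continuous_on_norm_id)
next
  case (Suc k)
  have op: "open (- {0::'a})" by auto
  show ?case
  proof (rule Ck_on_open_SucI[OF op])
    fix x :: 'a assume "x \<in> - {0}"
    then show "(norm has_derivative (\<lambda>v. (v \<bullet> x) * inverse (norm x))) (at x)"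
      using has_derivative_norm[of x] by (simp add: sgn_div_norm mult.commute)
  next
    fix v :: 'a
    show "Ck_on_open k (\<lambda>x. (v \<bullet> x) * inverse (norm x)) (- {0})"
      by (rule Ck_on_open_mult[OF op Ck_on_open_inner[OF op Ck_on_open_const Ck_on_open_ident[OF op]]
            Ck_on_open_inverse[OF op _ Suc]]) simp
  qed
qed

lemma Ck_on_open_norm_compose:
  assumes "open U" "Ck_on_open k f U" "\<And>x. x \<in> U \<Longrightarrow> f x \<noteq> 0"
  shows "Ck_on_open k (\<lambda>x. norm (f x)) U"
  using assms by (intro Ck_on_open_compose[OF _ _ _ Ck_on_open_norm]) auto

subsection \<open>Inverse functions\<close>

text \<open>At a zero of f the increment of g only enters multiplied by something of order h, so
  mere continuity of g suffices for the product rule. This allows an inverse to be differentiated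
  when only its continuity is known.\<close>

lemma has_derivative_scaleR_at_zero:
  fixes f :: "'a::real_normed_vector \<Rightarrow> real" and g :: "'a \<Rightarrow> 'b::real_normed_vector"
  assumes f: "(f has_derivative f') (at x)" and "f x = 0" and g: "isCont g x"
  shows "((\<lambda>y. f y *\<^sub>R g y) has_derivative (\<lambda>h. f' h *\<^sub>R g x)) (at x)"
proof -
  have bl: "bounded_linear f'" using f by (rule has_derivative_bounded_linear)
  obtain C where C: "\<And>h. norm (f' h) \<le> norm h * C" using bounded_linear.bounded[OF bl] by blast
  let ?e = "\<lambda>h. norm (f (x + h) - f x - f' h) / norm h"
  have e: "(?e \<longlongrightarrow> 0) (at 0)" using f by (simp add: has_derivative_at)
  have gx: "((\<lambda>h. g (x + h)) \<longlongrightarrow> g x) (at 0)"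
    using g by (simp add: isCont_iff)
  have lim: "((\<lambda>h. ?e h * norm (g (x + h)) + \<bar>C\<bar> * norm (g (x + h) - g x)) \<longlongrightarrow> 0 * norm (g x) + \<bar>C\<bar> * norm (g x - g x)) (at 0)"
    by (intro tendsto_intros e gx)
  let ?q = "\<lambda>h. norm (f (x + h) *\<^sub>R g (x + h) - f x *\<^sub>R g x - f' h *\<^sub>R g x) / norm h"
  have bd: "norm (?q h) \<le> ?e h * norm (g (x + h)) + \<bar>C\<bar> * norm (g (x + h) - g x)" for h
  proof -
    show "norm (norm (f (x + h) *\<^sub>R g (x + h) - f x *\<^sub>R g x - f' h *\<^sub>R g x) / norm h)
        \<le> norm (f (x + h) - f x - f' h) / norm h * norm (g (x + h)) + \<bar>C\<bar> * norm (g (x + h) - g x)"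
    proof (cases "h = 0")
      case False
      have "f (x + h) *\<^sub>R g (x + h) - f x *\<^sub>R g x - f' h *\<^sub>R g x
          = (f (x + h) - f x - f' h) *\<^sub>R g (x + h) + f' h *\<^sub>R (g (x + h) - g x)"
        using \<open>f x = 0\<close> by (simp add: algebra_simps)
      also have "norm \<dots> \<le> norm (f (x + h) - f x - f' h) * norm (g (x + h)) + norm (f' h) * norm (g (x + h) - g x)"
        by (metis norm_scaleR norm_triangle_ineq real_norm_def)
      also have "\<dots> \<le> norm (f (x + h) - f x - f' h) * norm (g (x + h)) + norm h * \<bar>C\<bar> * norm (g (x + h) - g x)"
        using C[of h] by (intro add_left_mono mult_right_mono order_trans[OF C[of h]] mult_left_mono) auto
      finally show ?thesis using False by (simp add: field_simps)
    qed simp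
  qed
  have "(?q \<longlongrightarrow> 0) (at 0)"
    by (rule Lim_null_comparison[OF always_eventually]) (use bd lim in auto)
  then show ?thesis
    using bounded_linear_scaleR_const[OF bl, of "g x"] by (simp add: has_derivative_at)
qed

text \<open>No determinants: continuity of B follows from a lower bound on A that is stable near x0.
  Differentiability follows from B x v - B x0 v = B x (v - A x (B x0 v)), whose argument vanishes at
  x0. The derivative - B (DA) B involves B only algebraically, so the induction closes.\<close>

lemma Ck_on_open_linear_inverse:
  fixes A :: "'p::euclidean_space \<Rightarrow> 'a::euclidean_space \<Rightarrow> 'b::euclidean_space"
  assumes U: "open U" and lin: "\<And>x. x \<in> U \<Longrightarrow> linear (A x)" "\<And>x. x \<in> U \<Longrightarrow> linear (B x)"
    and AB: "\<And>x v. x \<in> U \<Longrightarrow> A x (B x v) = v" and BA: "\<And>x v. x \<in> U \<Longrightarrow> B x (A x v) = v"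
    and A: "\<And>v. Ck_on_open k (\<lambda>x. A x v) U"
  shows "Ck_on_open k (\<lambda>x. B x v) U"
proof -
  have cont: "continuous_on U (\<lambda>x. B x v)" for v
  proof (rule continuous_at_imp_continuous_on, rule ballI)
    fix x0 assume x0: "x0 \<in> U"
    have "inj (A x0)" by (rule inj_on_inverseI[of _ "B x0"]) (use BA x0 in auto)
    then obtain c where c: "c > 0" "\<And>w. c * norm w \<le> norm (A x0 w)"
      using linear_inj_bounded_below_pos[OF lin(1)[OF x0]] by metis
    have contA: "isCont (\<lambda>x. A x w) x0" for w
      using Ck_on_open_imp_continuous_on[OF A] U x0 by (simp add: continuous_on_eq_continuous_at)
    have "((\<lambda>x. \<Sum>b\<in>Basis. norm (A x b - A x0 b)) \<longlongrightarrow> (\<Sum>b\<in>Basis. norm (A x0 b - A x0 b))) (at x0)"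
      using contA by (intro tendsto_intros) (auto simp: isCont_def)
    \<comment> \<open>Half of the lower bound \<open>c\<close> of \<open>A x0\<close> is spent on
      the perturbation; the other half remains as a lower bound for \<open>A x\<close>.\<close>
    then have "\<forall>\<^sub>F x in at x0. (\<Sum>b\<in>Basis. norm (A x b - A x0 b)) < c/2"
      using c(1) by (intro order_tendstoD(2)) auto
    moreover have "\<forall>\<^sub>F x in at x0. x \<in> U" using U x0 by (rule eventually_at_in_open')
    ultimately have ev: "\<forall>\<^sub>F x in at x0. norm (B x v - B x0 v) \<le> 2/c * norm (v - A x (B x0 v))"
    proof eventually_elim
      case (elim x)
      have low: "c/2 * norm w \<le> norm (A x w)" for w
      proof -
        have "norm (A x w - A x0 w) = norm (\<Sum>b\<in>Basis. (w \<bullet> b) *\<^sub>R (A x b - A x0 b))"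
          using linear_eq_sum_Basis[OF lin(1)[OF elim(2)], of w] linear_eq_sum_Basis[OF lin(1)[OF x0], of w]
          by (simp add: sum_subtractf algebra_simps)
        also have "\<dots> \<le> (\<Sum>b\<in>Basis. norm w * norm (A x b - A x0 b))"
          by (intro order_trans[OF norm_sum] sum_mono) (auto intro!: mult_right_mono simp: Basis_le_norm)
        also have "\<dots> \<le> norm w * (c/2)"
          unfolding sum_distrib_left[symmetric] using elim(1) by (intro mult_left_mono) auto
        finally have "norm (A x w - A x0 w) \<le> norm w * (c/2)" .
        moreover have "norm (A x0 w) \<le> norm (A x w) + norm (A x w - A x0 w)"
          by (metis norm_minus_commute norm_triangle_sub)
        ultimately show ?thesis using c(2)[of w] by (simp add: field_simps)
      qed
      have "A x (B x v - B x0 v) = v - A x (B x0 v)"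
        using AB[OF elim(2)] lin(1)[OF elim(2)] by (simp add: linear_diff)
      then have "c/2 * norm (B x v - B x0 v) \<le> norm (v - A x (B x0 v))"
        using low[of "B x v - B x0 v"] by simp
      then show ?case using c(1) by (simp add: field_simps)
    qed
    have "((\<lambda>x. 2/c * norm (v - A x (B x0 v))) \<longlongrightarrow> 2/c * norm (v - A x0 (B x0 v))) (at x0)"
      using contA by (intro tendsto_intros) (auto simp: isCont_def)
    then have "((\<lambda>x. 2/c * norm (v - A x (B x0 v))) \<longlongrightarrow> 0) (at x0)"
      using AB[OF x0] by simp
    then have "((\<lambda>x. B x v - B x0 v) \<longlongrightarrow> 0) (at x0)"
      by (rule Lim_null_comparison[OF ev])
    then show "isCont (\<lambda>x. B x v) x0" unfolding isCont_def by (rule LIM_zero_cancel)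
  qed
  show ?thesis
    using A
  proof (induction k arbitrary: v)
    case 0
    show ?case using cont by simp
  next
    case (Suc k)
    let ?D = "\<lambda>x w h. frechet_derivative (\<lambda>x. A x w) (at x) h"
    have IH: "Ck_on_open k (\<lambda>x. B x w) U" for w
      by (rule Suc.IH[OF Ck_on_open_SucD[OF Suc.prems]])
    show ?case
    proof (rule Ck_on_open_SucI[OF U])
      fix x0 assume x0: "x0 \<in> U"
      let ?s = "B x0 v"
      let ?q = "\<lambda>x. v - A x ?s"
      have q: "(?q has_derivative (\<lambda>h. - ?D x0 ?s h)) (at x0)"
        using has_derivative_diff[OF has_derivative_const[of v] Ck_on_open_Suc_derivative[OF Suc.prems x0]] by simp
      have "((\<lambda>x. \<Sum>b\<in>Basis. (?q x \<bullet> b) *\<^sub>R B x b) has_derivative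
          (\<lambda>h. \<Sum>b\<in>Basis. (- ?D x0 ?s h \<bullet> b) *\<^sub>R B x0 b)) (at x0)"
      proof (intro has_derivative_sum has_derivative_scaleR_at_zero)
        fix b :: 'b
        show "((\<lambda>x. ?q x \<bullet> b) has_derivative (\<lambda>h. - ?D x0 ?s h \<bullet> b)) (at x0)"
          by (intro has_derivative_inner_left q)
        show "?q x0 \<bullet> b = 0" by (simp add: AB[OF x0])
        show "isCont (\<lambda>x. B x b) x0" using cont[of b] U x0 by (simp add: continuous_on_eq_continuous_at)
      qed
      moreover have "(\<Sum>b\<in>Basis. (?q x \<bullet> b) *\<^sub>R B x b) = B x v - ?s" if "x \<in> U" for x
      proof -
        have "B x v - ?s = B x (?q x)"
          using BA[OF that] lin(2)[OF that] by (simp add: linear_diff)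
        then show ?thesis using linear_eq_sum_Basis[OF lin(2)[OF that], of "?q x"] by metis
      qed
      ultimately have "((\<lambda>x. B x v - ?s) has_derivative (\<lambda>h. \<Sum>b\<in>Basis. (- ?D x0 ?s h \<bullet> b) *\<^sub>R B x0 b)) (at x0)"
        using U x0 by (auto intro: has_derivative_transform_within_open)
      from has_derivative_add[OF this has_derivative_const[of ?s]]
      have "((\<lambda>x. B x v) has_derivative (\<lambda>h. \<Sum>b\<in>Basis. (- ?D x0 ?s h \<bullet> b) *\<^sub>R B x0 b)) (at x0)"
        by simp
      \<comment> \<open>The vector \<open>?s = B x0 v\<close> changes with the base point. In the
        basis expansion only the fixed functions x |-> A x c are differentiated, and
        \<open>?s\<close> contributes scalar coefficients of class C^k.\<close>
      moreover have "?D x0 ?s h = (\<Sum>c\<in>Basis. (?s \<bullet> c) *\<^sub>R ?D x0 c h)" for h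
      proof -
        have "((\<lambda>x. \<Sum>c\<in>Basis. (?s \<bullet> c) *\<^sub>R A x c) has_derivative (\<lambda>h. \<Sum>c\<in>Basis. (?s \<bullet> c) *\<^sub>R ?D x0 c h)) (at x0)"
          by (intro has_derivative_sum has_derivative_scaleR_right Ck_on_open_Suc_derivative[OF Suc.prems x0])
        then have "((\<lambda>x. A x ?s) has_derivative (\<lambda>h. \<Sum>c\<in>Basis. (?s \<bullet> c) *\<^sub>R ?D x0 c h)) (at x0)"
          by (rule has_derivative_transform_within_open[OF _ U x0]) (rule linear_eq_sum_Basis[OF lin(1), symmetric])
        from fun_cong[OF frechet_derivative_at[OF this], of h] show ?thesis by (rule sym)
      qed
      ultimately show "((\<lambda>x. B x v) has_derivative
        (\<lambda>h. \<Sum>b\<in>Basis. (- (\<Sum>c\<in>Basis. (B x0 v \<bullet> c) *\<^sub>R ?D x0 c h) \<bullet> b) *\<^sub>R B x0 b)) (at x0)"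
        by simp
    next
      fix h
      show "Ck_on_open k (\<lambda>x. \<Sum>b\<in>Basis. (- (\<Sum>c\<in>Basis. (B x v \<bullet> c) *\<^sub>R ?D x c h) \<bullet> b) *\<^sub>R B x b) U"
        by (rule Ck_on_open_sum[OF U], rule Ck_on_open_scaleR[OF U _ IH],
            rule Ck_on_open_inner[OF U _ Ck_on_open_const], rule Ck_on_open_minus[OF U],
            rule Ck_on_open_sum[OF U],
            rule Ck_on_open_scaleR[OF U Ck_on_open_inner[OF U IH Ck_on_open_const]
              Ck_on_open_Suc_directional[OF Suc.prems]])
    qed
  qed
qed

text \<open>The classical theorem provides g with derivative inverse to that of f at g y. The order
  is then bootstrapped: if g is C^j with j <= k, so is the derivative of f along g, hence so is its
  inverse, and g is C^(j+1).\<close>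

lemma Ck_on_open_inverse_function:
  fixes f :: "'a::euclidean_space \<Rightarrow> 'a"
  assumes U: "open U" and f: "Ck_on_open (Suc k) f U"
    and inj: "\<And>x. x \<in> U \<Longrightarrow> inj (frechet_derivative f (at x))" and x0: "x0 \<in> U"
  obtains U' V g where "open U'" "U' \<subseteq> U" "x0 \<in> U'" "open V" "homeomorphism U' V f g"
    "Ck_on_open (Suc k) g V"
proof -
  let ?D = "\<lambda>x. frechet_derivative f (at x)"
  have lin: "linear (?D x)" if "x \<in> U" for x
    using f that by (auto simp: Ck_on_open.simps(2) intro: linear_frechet_derivative)
  define f' where "f' = (\<lambda>x. Blinfun (?D x))"
  have f': "blinfun_apply (f' x) = ?D x" if "x \<in> U" for x
    using lin[OF that] unfolding f'_def by (simp add: bounded_linear_Blinfun_apply linear_linear)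
  have "continuous_on U (\<lambda>x. f' x b)" for b
    using f' Ck_on_open_imp_continuous_on[OF Ck_on_open_Suc_directional[OF f]] by (simp cong: continuous_on_cong)
  then have contf: "continuous_on U f'" by (intro continuous_on_blinfun_componentwise)
  obtain h where h: "linear h" "\<And>x. h (?D x0 x) = x"
    using linear_injective_left_inverse[OF lin inj] x0 by (metis comp_apply id_apply)
  have "Blinfun h o\<^sub>L f' x0 = id_blinfun"
    using h by (intro blinfun_eqI) (simp add: f' x0 bounded_linear_Blinfun_apply linear_linear)
  then obtain U' V g g' where *: "open U'" "U' \<subseteq> U" "x0 \<in> U'" "open V" "homeomorphism U' V f g"
    "\<And>y. y \<in> V \<Longrightarrow> (g has_derivative (g' y)) (at y)"
    "\<And>y. y \<in> V \<Longrightarrow> g' y = inv (blinfun_apply (f' (g y)))"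
    "\<And>y. y \<in> V \<Longrightarrow> bij (blinfun_apply (f' (g y)))"
    using inverse_function_theorem[OF U _ contf x0] f' Ck_on_open_Suc_derivative[OF f]
    by (metis (no_types, lifting))
  have gU: "g y \<in> U" if "y \<in> V" for y using *(2,5) that by (auto simp: homeomorphism_def)
  have bij: "bij (?D (g y))" and g': "g' y = inv (?D (g y))" if "y \<in> V" for y
    using *(7,8)[OF that] f'[OF gU[OF that]] by auto
  have cg: "continuous_on V g" using *(5) by (simp add: homeomorphism_def)
  have "Ck_on_open j g V" if "j \<le> Suc k" for j
    using that
  proof (induction j)
    case 0
    show ?case using cg by simp
  next
    case (Suc j)
    have fj: "Ck_on_open j (\<lambda>x. ?D x v) U" for v
    proof -
      have "i \<le> m \<Longrightarrow> Ck_on_open m q U \<Longrightarrow> Ck_on_open i q U" for i m and q :: "'a \<Rightarrow> 'a"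
        by (induction rule: inc_induct) (auto intro: Ck_on_open_SucD)
      with Suc.prems Ck_on_open_Suc_directional[OF f] show ?thesis by simp
    qed
    have A: "Ck_on_open j (\<lambda>y. ?D (g y) v) V" for v
      by (rule Ck_on_open_compose[OF *(4) U _ fj Suc.IH]) (use gU Suc.prems in auto)
    show ?case
    proof (rule Ck_on_open_SucI[OF *(4,6)])
      fix v
      show "Ck_on_open j (\<lambda>x. g' x v) V"
      proof (rule Ck_on_open_linear_inverse[OF *(4) _ _ _ _ A])
        fix y v assume y: "y \<in> V"
        show "linear (?D (g y))" using lin gU y by auto
        show "linear (g' y)" using *(6)[OF y] has_derivative_linear by auto
        show "?D (g y) (g' y v) = v" "g' y (?D (g y) v) = v"
          using bij[OF y] g'[OF y] by (auto simp: bij_def surj_f_inv_f)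
      qed
    qed auto
  qed
  with * that show thesis by blast
qed

subsection \<open>Parameter integrals\<close>

lemma set_integrable_compact_continuous:
  fixes f :: "'a::euclidean_space \<Rightarrow> 'b::euclidean_space"
  assumes "compact D" "continuous_on D f"
  shows "set_integrable lborel D f"
  unfolding set_integrable_def using assms by (rule borel_integrable_compact)

lemma norm_set_integral_compact_le:
  fixes f :: "'a::euclidean_space \<Rightarrow> 'b::euclidean_space"
  assumes "compact D" "continuous_on D f" "\<And>x. x \<in> D \<Longrightarrow> norm (f x) \<le> e"
  shows "norm (LINT x:D|lborel. f x) \<le> e * measure lborel D"
proof -
  have "set_integrable lborel D (\<lambda>x. norm (f x))" "set_integrable lborel D (\<lambda>x. e)"
    using assms by (auto intro!: set_integrable_compact_continuous continuous_on_norm)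
  then have "(LINT x:D|lborel. norm (f x)) \<le> (LINT x:D|lborel. e)"
    using assms(3) by (intro set_integral_mono)
  also have "(LINT x:D|lborel. e) = e * measure lborel D"
    using assms(1) emeasure_compact_finite[OF assms(1)]
    by (subst set_integral_const) (auto simp: top_unique borel_compact)
  finally show ?thesis
    using set_integral_norm_bound[OF set_integrable_compact_continuous[OF assms(1,2)]] by linarith
qed

lemma continuous_on_integral_parameter:
  fixes \<Phi> :: "'p::euclidean_space \<times> 'a::euclidean_space \<Rightarrow> 'b::euclidean_space"
  assumes D: "compact D" and \<Phi>: "continuous_on (A \<times> D) \<Phi>"
  shows "continuous_on A (\<lambda>a. LINT w:D|lborel. \<Phi> (a, w))"
proof -
  let ?F = "\<lambda>a. LINT w:D|lborel. \<Phi> (a, w)"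
  have cont: "continuous_on D (\<lambda>w. \<Phi> (a, w))" if "a \<in> A" for a
    by (rule continuous_on_compose2[OF \<Phi>]) (auto intro!: continuous_intros that)
  have "\<exists>X. open X \<and> a \<in> X \<and> (\<forall>x\<in>X \<inter> A. dist (?F x) (?F a) < e)" if a: "a \<in> A" and e: "e > 0" for a e
  proof -
    define m where "m = measure lborel D"
    have m: "m \<ge> 0" by (simp add: m_def)
    \<comment> \<open>Compactness of \<open>D\<close> makes the closeness uniform in t; the 1 in
      \<open>m + 1\<close> covers a null set \<open>D\<close>.\<close>
    obtain X where X: "a \<in> X" "open X" "\<forall>x\<in>X \<inter> A. \<forall>t\<in>D. dist (\<Phi> (x, t)) (\<Phi> (a, t)) \<le> e / (m + 1)"
      using continuous_on_prod_compactE[OF \<Phi> D a, of "e / (m + 1)"] e m by auto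
    have "dist (?F x) (?F a) < e" if x: "x \<in> X \<inter> A" for x
    proof -
      have "?F x - ?F a = (LINT w:D|lborel. \<Phi> (x, w) - \<Phi> (a, w))"
        using x a cont by (intro set_integral_diff(2)[symmetric] set_integrable_compact_continuous D) auto
      also have "norm \<dots> \<le> e / (m + 1) * m"
      proof -
        have "continuous_on D (\<lambda>w. \<Phi> (x, w) - \<Phi> (a, w))"
          using x a by (intro continuous_on_diff cont) auto
        moreover have "norm (\<Phi> (x, w) - \<Phi> (a, w)) \<le> e / (m + 1)" if "w \<in> D" for w
          using X(3) x that by (auto simp: dist_norm)
        ultimately show ?thesis
          unfolding m_def by (rule norm_set_integral_compact_le[OF D])
      qed
      also have "\<dots> < e" using e m by (simp add: field_simps)
      finally show ?thesis by (simp add: dist_norm)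
    qed
    with X show ?thesis by blast
  qed
  note * = this
  show ?thesis
    unfolding continuous_on_iff
  proof (intro ballI allI impI)
    fix a and e :: real assume "a \<in> A" "e > 0"
    from *[OF this] obtain X where X: "open X" "a \<in> X" "\<forall>x\<in>X \<inter> A. dist (?F x) (?F a) < e" by blast
    then obtain d where "d > 0" "ball a d \<subseteq> X" by (meson openE)
    with X(3) show "\<exists>d>0. \<forall>x\<in>A. dist x a < d \<longrightarrow> dist (?F x) (?F a) < e"
      by (intro exI[of _ d]) (auto simp: dist_commute subset_iff)
  qed
qed

text \<open>By compactness of D the partial derivative varies little near a0 uniformly in w. The
  mean value inequality turns this into a uniform linearization error, which is then integrated over
  D.\<close>

lemma has_derivative_integral_parameter:
  fixes \<Phi> :: "'p::euclidean_space \<times> 'a::euclidean_space \<Rightarrow> 'b::euclidean_space"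
  assumes A: "open A" and D: "compact D"
    and cont: "continuous_on (A \<times> D) \<Phi>"
    and der: "\<And>a w. a \<in> A \<Longrightarrow> w \<in> D \<Longrightarrow> ((\<lambda>a. \<Phi> (a, w)) has_derivative \<Phi>' (a, w)) (at a)"
    and contd: "\<And>b. continuous_on (A \<times> D) (\<lambda>z. \<Phi>' z b)"
    and a0: "a0 \<in> A"
  shows "((\<lambda>a. LINT w:D|lborel. \<Phi> (a, w)) has_derivative (\<lambda>h. LINT w:D|lborel. \<Phi>' (a0, w) h)) (at a0)"
proof -
  let ?F = "\<lambda>a. LINT w:D|lborel. \<Phi> (a, w)" and ?F' = "\<lambda>h. LINT w:D|lborel. \<Phi>' (a0, w) h"
  have ci: "set_integrable lborel D (\<lambda>w. \<Phi> (a, w))" if "a \<in> A" for a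
    by (intro set_integrable_compact_continuous D continuous_on_compose2[OF cont])
       (auto intro!: continuous_intros that)
  have cd: "continuous_on D (\<lambda>w. \<Phi>' (a, w) h)" if "a \<in> A" for a h
    by (rule continuous_on_compose2[OF contd]) (auto intro!: continuous_intros that)
  have ci': "set_integrable lborel D (\<lambda>w. \<Phi>' (a, w) h)" if "a \<in> A" for a h
    by (intro set_integrable_compact_continuous D cd that)
  have lin: "linear (\<Phi>' (a, w))" if "a \<in> A" "w \<in> D" for a w
    using der[OF that] by (rule has_derivative_linear)
  have "linear ?F'"
  proof (rule linearI)
    fix x y
    have "?F' (x + y) = (LINT w:D|lborel. \<Phi>' (a0, w) x + \<Phi>' (a0, w) y)"
      using D by (intro set_lebesgue_integral_cong) (auto simp: linear_add[OF lin[OF a0]] borel_compact)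
    also have "\<dots> = ?F' x + ?F' y" by (intro set_integral_add ci' a0)
    finally show "?F' (x + y) = ?F' x + ?F' y" .
  next
    fix r x
    have "?F' (r *\<^sub>R x) = (LINT w:D|lborel. r *\<^sub>R \<Phi>' (a0, w) x)"
      using D by (intro set_lebesgue_integral_cong) (auto simp: linear_scale[OF lin[OF a0]] borel_compact)
    then show "?F' (r *\<^sub>R x) = r *\<^sub>R ?F' x" by simp
  qed
  moreover have "\<exists>d>0. \<forall>y. norm (y - a0) < d \<longrightarrow> norm (?F y - ?F a0 - ?F' (y - a0)) \<le> e * norm (y - a0)"
    if e: "e > 0" for e
  proof -
    define m where "m = measure lborel D"
    have m: "m \<ge> 0" by (simp add: m_def)
    \<comment> \<open>The operator norm is estimated by a sum over \<open>DIM('p)\<close> basis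
      directions, and the resulting error is integrated over a set of measure
      \<open>m\<close>.\<close>
    define \<eta> where "\<eta> = e / (m + 1) / DIM('p)"
    have \<eta>: "\<eta> > 0" using e m by (simp add: \<eta>_def)
    have "\<exists>X. open X \<and> a0 \<in> X \<and> (\<forall>x\<in>X \<inter> A. \<forall>t\<in>D. dist (\<Phi>' (x, t) b) (\<Phi>' (a0, t) b) \<le> \<eta>)" for b
      using continuous_on_prod_compactE[OF contd D a0 \<eta>] by metis
    then obtain X where X: "\<And>b. open (X b)" "\<And>b. a0 \<in> X b"
      "\<And>b x t. x \<in> X b \<Longrightarrow> x \<in> A \<Longrightarrow> t \<in> D \<Longrightarrow> dist (\<Phi>' (x, t) b) (\<Phi>' (a0, t) b) \<le> \<eta>"
      by (metis IntI)
    have "open (A \<inter> (\<Inter>b\<in>Basis. X b))" "a0 \<in> A \<inter> (\<Inter>b\<in>Basis. X b)"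
      using A X a0 by (auto intro!: open_INT)
    then obtain d where d: "d > 0" "ball a0 d \<subseteq> A \<inter> (\<Inter>b\<in>Basis. X b)"
      by (meson openE)
    have "norm (?F y - ?F a0 - ?F' (y - a0)) \<le> e * norm (y - a0)" if y: "norm (y - a0) < d" for y
    proof -
      have yA: "y \<in> A" using d y by (auto simp: dist_norm norm_minus_commute)
      have bd: "norm (\<Phi> (y, w) - \<Phi> (a0, w) - \<Phi>' (a0, w) (y - a0)) \<le> norm (y - a0) * (e / (m + 1))"
        if w: "w \<in> D" for w
      proof (rule differentiable_bound_linearization[where S = "ball a0 d"])
        fix t :: real assume t: "t \<in> {0..1}"
        have "norm (t *\<^sub>R (y - a0)) \<le> norm (y - a0)" using t by (simp add: mult_left_le_one_le)
        with y show "a0 + t *\<^sub>R (y - a0) \<in> ball a0 d" by (simp add: dist_norm)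
      next
        fix x assume x: "x \<in> ball a0 d"
        then have xA: "x \<in> A" using d by auto
        show "((\<lambda>a. \<Phi> (a, w)) has_derivative \<Phi>' (x, w)) (at x within ball a0 d)"
          using der[OF xA w] by (rule has_derivative_at_withinI)
        show "onorm (\<Phi>' (x, w) - \<Phi>' (a0, w)) \<le> e / (m + 1)"
        proof (rule onorm_bound)
          fix h
          have "norm ((\<Phi>' (x, w) - \<Phi>' (a0, w)) h) = norm (\<Sum>b\<in>Basis. (h \<bullet> b) *\<^sub>R (\<Phi>' (x, w) b - \<Phi>' (a0, w) b))"
            unfolding fun_diff_def linear_eq_sum_Basis[OF lin[OF xA w], of h] linear_eq_sum_Basis[OF lin[OF a0 w], of h]
            by (simp add: sum_subtractf algebra_simps)
          also have "\<dots> \<le> (\<Sum>b\<in>(Basis::'p set). norm h * \<eta>)"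
          proof (intro order_trans[OF norm_sum] sum_mono)
            fix b :: 'p assume b: "b \<in> Basis"
            have "norm (\<Phi>' (x, w) b - \<Phi>' (a0, w) b) \<le> \<eta>"
              using X(3)[of x b w] x d xA w b by (auto simp: dist_norm)
            then show "norm ((h \<bullet> b) *\<^sub>R (\<Phi>' (x, w) b - \<Phi>' (a0, w) b)) \<le> norm h * \<eta>"
              using Basis_le_norm[OF b] by (simp add: mult_mono)
          qed
          also have "\<dots> = e / (m + 1) * norm h" by (simp add: \<eta>_def)
          finally show "norm ((\<Phi>' (x, w) - \<Phi>' (a0, w)) h) \<le> e / (m + 1) * norm h" .
        qed (use e m in auto)
      qed (use d in auto)
      have "?F y - ?F a0 - ?F' (y - a0) = (LINT w:D|lborel. \<Phi> (y, w) - \<Phi> (a0, w) - \<Phi>' (a0, w) (y - a0))"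
        using ci[OF yA] ci[OF a0] ci'[OF a0] by (simp add: set_integral_diff)
      also have "norm \<dots> \<le> norm (y - a0) * (e / (m + 1)) * m"
      proof -
        have c: "continuous_on D (\<lambda>w. \<Phi> (a, w))" if "a \<in> A" for a
          by (rule continuous_on_compose2[OF cont]) (auto intro!: continuous_intros that)
        have "continuous_on D (\<lambda>w. \<Phi> (y, w) - \<Phi> (a0, w) - \<Phi>' (a0, w) (y - a0))"
          by (intro continuous_on_diff c cd yA a0)
        from norm_set_integral_compact_le[OF D this bd] show ?thesis unfolding m_def .
      qed
      also have "\<dots> \<le> e * norm (y - a0)"
      proof -
        have "e / (m + 1) * m \<le> e" using e m by (simp add: field_simps)
        then have "norm (y - a0) * (e / (m + 1) * m) \<le> norm (y - a0) * e" by (intro mult_left_mono) auto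
        then show ?thesis by (simp add: mult_ac)
      qed
      finally show ?thesis .
    qed
    with d(1) show ?thesis by blast
  qed
  ultimately show ?thesis by (auto simp: has_derivative_at_alt linear_linear)
qed

text \<open>Differentiating in a parameter direction (h, 0) gives an integral of the same kind, so
  the order drops by one and induction applies. The open set N around D is there because
  \<open>Ck_on_open\<close> takes two-sided derivatives in all variables.\<close>

lemma Ck_on_open_integral_parameter:
  fixes \<Phi> :: "'p::euclidean_space \<times> 'a::euclidean_space \<Rightarrow> 'b::euclidean_space"
  assumes A: "open A" and N: "open N" and D: "compact D" "D \<subseteq> N"
  shows "Ck_on_open k \<Phi> (A \<times> N) \<Longrightarrow> Ck_on_open k (\<lambda>a. LINT w:D|lborel. \<Phi> (a, w)) A"
proof (induction k arbitrary: \<Phi>)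
  case 0
  with D have "continuous_on (A \<times> D) \<Phi>" by (auto intro: continuous_on_subset)
  then show ?case using continuous_on_integral_parameter[OF D(1)] by simp
next
  case (Suc k)
  let ?D = "\<lambda>z. frechet_derivative \<Phi> (at z)"
  have sub: "A \<times> D \<subseteq> A \<times> N" using D by auto
  note dir = Ck_on_open_Suc_directional[OF Suc.prems]
  show ?case
  proof (rule Ck_on_open_SucI[OF A])
    fix a0 assume a0: "a0 \<in> A"
    show "((\<lambda>a. LINT w:D|lborel. \<Phi> (a, w)) has_derivative (\<lambda>h. LINT w:D|lborel. (\<lambda>z h. ?D z (h, 0)) (a0, w) h)) (at a0)"
    proof (rule has_derivative_integral_parameter[OF A D(1) _ _ _ a0])
      show "continuous_on (A \<times> D) \<Phi>"
        by (rule continuous_on_subset[OF Ck_on_open_imp_continuous_on[OF Suc.prems] sub])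
      show "continuous_on (A \<times> D) (\<lambda>z. ?D z (b, 0))" for b
        by (rule continuous_on_subset[OF Ck_on_open_imp_continuous_on[OF dir] sub])
      fix a w assume "a \<in> A" "w \<in> D"
      then have "(\<Phi> has_derivative ?D (a, w)) (at (a, w))"
        using sub by (intro Ck_on_open_Suc_derivative[OF Suc.prems]) auto
      moreover have "((\<lambda>a. (a, w)) has_derivative (\<lambda>h. (h, 0))) (at a)"
        by (intro has_derivative_Pair has_derivative_ident has_derivative_const)
      ultimately show "((\<lambda>a. \<Phi> (a, w)) has_derivative (\<lambda>h. ?D (a, w) (h, 0))) (at a)"
        by (rule has_derivative_compose[rotated])
    qed
  next
    fix v
    show "Ck_on_open k (\<lambda>x. LINT w:D|lborel. (\<lambda>z h. ?D z (h, 0)) (x, w) v) A"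
      using Suc.IH[OF dir] by simp
  qed
qed

subsection \<open>Isometries and polar integration\<close>

lemma negligible_norm_preserving_image:
  fixes f :: "'a::euclidean_space \<Rightarrow> 'a"
  assumes "linear f" "\<And>x. norm (f x) = norm x" "negligible N"
  shows "negligible (f ` N)"
  using assms(3)
proof (rule negligible_locally_Lipschitz_image[rotated])
  fix x assume "x \<in> N"
  have "norm (f y - f x) \<le> 1 * norm (y - x)" for y
    using assms(1,2) by (metis linear_diff mult_1 order_refl)
  then show "\<exists>T B. open T \<and> x \<in> T \<and> (\<forall>y\<in>N \<inter> T. norm (f y - f x) \<le> B * norm (y - x))"
    by (intro exI[of _ UNIV] exI[of _ 1]) auto
qed simp

text \<open>Isometries map balls to balls of the same measure, and by Vitali's covering theorem an open
  set is a disjoint union of balls up to a null set.\<close>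

lemma emeasure_norm_preserving_image_open:
  fixes f :: "'a::euclidean_space \<Rightarrow> 'a"
  assumes lin: "linear f" and norm: "\<And>x. norm (f x) = norm x" and S: "open S"
  shows "emeasure lebesgue (f ` S) = emeasure lebesgue S"
proof -
  have inj: "inj f"
    using lin norm by (metis linear_injective_0 norm_eq_zero)
  have surj: "surj f" by (rule linear_injective_imp_surjective[OF lin inj]) simp
  have dist: "dist (f x) (f y) = dist x y" for x y
    using lin norm by (metis dist_norm linear_diff)
  have ball: "f ` ball x r = ball (f x) r" for x r
  proof
    show "ball (f x) r \<subseteq> f ` ball x r"
    proof
      fix y assume "y \<in> ball (f x) r"
      moreover obtain z where "y = f z" using surj by auto
      ultimately show "y \<in> f ` ball x r" by (auto simp: dist)
    qed
  qed (auto simp: dist)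
  have eball: "emeasure lebesgue (ball x r) = emeasure lebesgue (ball (f x) r)" for x r
  proof -
    have "(\<lambda>z. z + (f x - x)) ` ball x r = (+) (f x - x) ` ball x r" by (simp add: add.commute)
    also have "\<dots> = ball (f x) r" by (simp add: ball_translation[symmetric])
    finally have "(\<lambda>z. z + (f x - x)) ` ball x r = ball (f x) r" .
    then show ?thesis using emeasure_lebesgue_affine[of 1 "f x - x" "ball x r"] by simp
  qed
  let ?K = "{p. snd p > 0 \<and> ball (fst p) (snd p) \<subseteq> S}"
  have "\<exists>i. i \<in> ?K \<and> x \<in> ball (fst i) (snd i) \<and> snd i < d" if xS: "x \<in> S" "0 < d" for x d
  proof -
    obtain e where "e > 0" "ball x e \<subseteq> S" using openE[OF S xS(1)] by blast
    then show ?thesis using xS by (intro exI[of _ "(x, min e (d/2))"]) auto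
  qed
  then obtain C where C: "countable C" "C \<subseteq> ?K"
    "pairwise (\<lambda>i j. disjnt (ball (fst i) (snd i)) (ball (fst j) (snd j))) C"
    "negligible (S - (\<Union>i\<in>C. ball (fst i) (snd i)))"
    by (rule Vitali_covering_theorem_balls)
  let ?B = "\<lambda>i. ball (fst i) (snd i)" let ?N = "S - (\<Union>i\<in>C. ?B i)"
  have Ssplit: "S = (\<Union>i\<in>C. ?B i) \<union> ?N" using C(2) by auto
  have fS: "f ` S = (\<Union>i\<in>C. f ` ?B i) \<union> f ` ?N"
    using arg_cong[OF Ssplit, of "(`) f"] by (simp only: image_Un image_UN)
  have null: "?N \<in> null_sets lebesgue" "f ` ?N \<in> null_sets lebesgue"
    using C(4) negligible_norm_preserving_image[OF lin norm C(4)] by (simp_all add: negligible_iff_null_sets)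
  have meas: "(\<Union>i\<in>C. ?B i) \<in> sets lebesgue" "(\<Union>i\<in>C. f ` ?B i) \<in> sets lebesgue"
    unfolding ball by (intro sets.countable_UN''[OF C(1)]; simp)+
  have d1: "disjoint_family_on ?B C"
    using C(3) by (auto simp: disjoint_family_on_def pairwise_def disjnt_def)
  have d2: "disjoint_family_on (\<lambda>i. f ` ?B i) C"
    using d1 inj by (auto simp: disjoint_family_on_def image_Int[symmetric])
  have "emeasure lebesgue S = emeasure lebesgue (\<Union>i\<in>C. ?B i)"
    by (rule trans[OF arg_cong[OF Ssplit, of "emeasure lebesgue"] emeasure_Un_null_set[OF meas(1) null(1)]])
  also have "\<dots> = (\<integral>\<^sup>+i. emeasure lebesgue (?B i) \<partial>count_space C)"
    by (rule emeasure_UN_countable[OF _ C(1) d1]) simp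
  also have "\<dots> = (\<integral>\<^sup>+i. emeasure lebesgue (f ` ?B i) \<partial>count_space C)"
    by (simp only: ball eball[symmetric])
  also have "\<dots> = emeasure lebesgue (\<Union>i\<in>C. f ` ?B i)"
    by (rule emeasure_UN_countable[OF _ C(1) d2, symmetric]) (simp add: ball)
  also have "\<dots> = emeasure lebesgue (f ` S)"
    by (rule trans[OF arg_cong[OF fS, of "emeasure lebesgue"] emeasure_Un_null_set[OF meas(2) null(2)], symmetric])
  finally show ?thesis by simp
qed

text \<open>Lebesgue measure is determined by its values on boxes, and the preimage of an open box
  is open, so invariance on open sets is enough.\<close>

lemma distr_lborel_norm_preserving:
  fixes f :: "'a::euclidean_space \<Rightarrow> 'a"
  assumes lin: "linear f" and norm: "\<And>x. norm (f x) = norm x"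
  shows "distr lborel borel f = lborel"
proof (rule lborel_eqI[symmetric])
  fix l u :: 'a assume le: "\<And>b. b \<in> Basis \<Longrightarrow> l \<bullet> b \<le> u \<bullet> b"
  have inj: "inj f" using lin norm by (metis linear_injective_0 norm_eq_zero)
  have surj: "surj f" by (rule linear_injective_imp_surjective[OF lin inj]) simp
  have cont: "continuous_on UNIV f" using lin by (simp add: linear_continuous_on linear_linear)
  have op: "open (f -` box l u)" using open_vimage[OF open_box cont] .
  have "emeasure (distr lborel borel f) (box l u) = emeasure lebesgue (f -` box l u)"
    using cont op by (subst emeasure_distr) (auto intro: borel_measurable_continuous_onI)
  also have "\<dots> = emeasure lebesgue (f ` (f -` box l u))"
    by (rule emeasure_norm_preserving_image_open[OF lin norm op, symmetric])
  also have "f ` (f -` box l u) = box l u" using surj by auto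
  also have "emeasure lebesgue (box l u) = (\<Prod>b\<in>Basis. (u - l) \<bullet> b)"
    using le by (simp add: emeasure_lborel_box_eq)
  finally show "emeasure (distr lborel borel f) (box l u) = (\<Prod>b\<in>Basis. (u - l) \<bullet> b)" .
qed simp

lemma set_integral_norm_preserving:
  fixes f :: "'a::euclidean_space \<Rightarrow> 'a" and g :: "'a \<Rightarrow> 'b::euclidean_space"
  assumes lin: "linear f" and norm: "\<And>x. norm (f x) = norm x"
    and D: "\<And>x. f x \<in> D' \<longleftrightarrow> x \<in> D" and g: "set_integrable lborel D' g"
  shows "(LINT z:D'|lborel. g z) = (LINT w:D|lborel. g (f w))"
proof -
  have [measurable]: "f \<in> borel_measurable borel"
    using lin by (intro borel_measurable_continuous_onI linear_continuous_on) (simp add: linear_linear)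
  have [measurable]: "(\<lambda>z. indicator D' z *\<^sub>R g z) \<in> borel_measurable borel"
    using g by (auto simp: set_integrable_def)
  have "(LINT z:D'|lborel. g z) = (\<integral>z. indicator D' z *\<^sub>R g z \<partial>distr lborel borel f)"
    by (simp add: set_lebesgue_integral_def distr_lborel_norm_preserving[OF lin norm])
  also have "\<dots> = (\<integral>w. indicator D' (f w) *\<^sub>R g (f w) \<partial>lborel)"
    by (rule integral_distr) auto
  also have "\<dots> = (LINT w:D|lborel. g (f w))"
    unfolding set_lebesgue_integral_def by (rule Bochner_Integration.integral_cong) (auto simp: indicator_def D)
  finally show ?thesis .
qed

lemma nn_integral_lborel_affine:
  fixes f :: "'a::euclidean_space \<Rightarrow> ennreal"
  assumes [measurable]: "f \<in> borel_measurable borel" and c: "c \<noteq> 0"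
  shows "(\<integral>\<^sup>+x. f x \<partial>lborel) = ennreal (\<bar>c\<bar> ^ DIM('a)) * (\<integral>\<^sup>+x. f (t + c *\<^sub>R x) \<partial>lborel)"
  by (subst lborel_affine[OF c, of t])
     (simp add: nn_integral_density nn_integral_distr nn_integral_cmult)

text \<open>Polar integration without a surface measure: a whole annulus is integrated over, each ray being
  counted with weight \<open>\<integral> dr / r = ln 2\<close>.\<close>

lemma nn_integral_annulus_polar:
  fixes f :: "'a::euclidean_space \<Rightarrow> ennreal"
  assumes [measurable]: "f \<in> borel_measurable borel"
  shows "ennreal (ln 2) * (\<integral>\<^sup>+x. f x \<partial>lborel) =
    (\<integral>\<^sup>+z. indicator {z. 1 \<le> norm z \<and> norm z \<le> 2} z *
      (\<integral>\<^sup>+r. indicator {0<..} r * ennreal (r ^ (DIM('a) - 1)) * f (r *\<^sub>R z) \<partial>lborel) \<partial>lborel)"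
proof -
  let ?A = "{z::'a. 1 \<le> norm z \<and> norm z \<le> 2}" let ?n = "DIM('a)"
  have n: "?n = Suc (?n - 1)" by simp
  have [measurable]: "?A \<in> sets borel" by measurable
  \<comment> \<open>For fixed r, replacing z by z / r turns the weight r^(n-1) into 1/r and puts the
    dilation into the indicator of the annulus. Fubini before and after then leaves an integral in r
    for each fixed z.\<close>
  have scale: "(\<integral>\<^sup>+z. indicator ?A z * (indicator {0<..} r * ennreal (r ^ (?n - 1)) * f (r *\<^sub>R z)) \<partial>lborel)
     = (\<integral>\<^sup>+z. indicator {0<..} r * ennreal (1 / r) * (indicator ?A (z /\<^sub>R r) * f z) \<partial>lborel)" (is "?L = ?R") for r :: real
  proof (cases "r > 0")
    case True
    have "?R = ennreal (1 / r) * (\<integral>\<^sup>+z. indicator ?A (z /\<^sub>R r) * f z \<partial>lborel)"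
      using True by (subst nn_integral_cmult[symmetric]) auto
    also have "(\<integral>\<^sup>+z. indicator ?A (z /\<^sub>R r) * f z \<partial>lborel)
       = ennreal (r ^ ?n) * (\<integral>\<^sup>+z. indicator ?A z * f (r *\<^sub>R z) \<partial>lborel)"
      using True by (subst nn_integral_lborel_affine[where c = r and t = 0]) auto
    also have "ennreal (1 / r) * (ennreal (r ^ ?n) * (\<integral>\<^sup>+z. indicator ?A z * f (r *\<^sub>R z) \<partial>lborel))
       = ennreal (r ^ (?n - 1)) * (\<integral>\<^sup>+z. indicator ?A z * f (r *\<^sub>R z) \<partial>lborel)"
    proof -
      have "r ^ ?n = r * r ^ (?n - 1)" by (metis n power_Suc)
      then have "1 / r * r ^ ?n = r ^ (?n - 1)" using True by simp
      then show ?thesis using True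
        by (simp add: mult.assoc[symmetric] ennreal_mult[symmetric] del: One_nat_def)
    qed
    also have "\<dots> = ?L"
      using True by (subst nn_integral_cmult[symmetric]) (auto intro!: nn_integral_cong simp: mult_ac)
    finally show ?thesis by simp
  qed simp
  have inner: "(\<integral>\<^sup>+r. indicator {0<..} r * ennreal (1 / r) * (indicator ?A (z /\<^sub>R r) * f z) \<partial>lborel) = ennreal (ln 2) * f z"
    if "z \<noteq> 0" for z
  proof -
    \<comment> \<open>z / r lies in the annulus exactly for r between these bounds; their ratio is 2
      for every z, which gives the constant ln 2.\<close>
    let ?a = "norm z / 2" and ?b = "norm z"
    have a: "0 < ?a" "?a \<le> ?b" using that by auto
    have "(\<integral>\<^sup>+r. indicator {0<..} r * ennreal (1 / r) * (indicator ?A (z /\<^sub>R r) * f z) \<partial>lborel)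
      = (\<integral>\<^sup>+r. ennreal (1 / r) * indicator {?a..?b} r * f z \<partial>lborel)"
    proof (intro nn_integral_cong)
      fix r :: real
      have pos: "norm z \<le> r * 2 \<Longrightarrow> 0 < r" using that by (smt (verit) zero_less_norm_iff)
      show "indicator {0<..} r * ennreal (1 / r) * (indicator ?A (z /\<^sub>R r) * f z)
          = ennreal (1 / r) * indicator {?a..?b} r * f z"
      proof (cases "r > 0")
        case False
        with pos show ?thesis by (auto simp: indicator_def field_simps)
      qed (auto simp: indicator_def field_simps)
    qed
    also have "\<dots> = (\<integral>\<^sup>+r. ennreal (1 / r) * indicator {?a..?b} r \<partial>lborel) * f z"
      by (rule nn_integral_multc) measurable
    also have "(\<integral>\<^sup>+r. ennreal (1 / r) * indicator {?a..?b} r \<partial>lborel) = ln ?b - ln ?a"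
    proof (rule nn_integral_FTC_Icc)
      fix r assume "r \<in> {?a..?b}"
      then have "?a \<le> r" by simp
      with a(1) have "r > 0" by (rule less_le_trans)
      then show "(ln has_real_derivative 1 / r) (at r)" "0 \<le> 1 / r"
        by (auto intro!: derivative_eq_intros)
    qed (use a in auto)
    also have "ln ?b - ln ?a = ln 2" using that by (simp add: ln_div)
    finally show ?thesis .
  qed
  have "(\<integral>\<^sup>+z. indicator ?A z * (\<integral>\<^sup>+r. indicator {0<..} r * ennreal (r ^ (?n - 1)) * f (r *\<^sub>R z) \<partial>lborel) \<partial>lborel)
      = (\<integral>\<^sup>+z. (\<integral>\<^sup>+r. indicator ?A z * (indicator {0<..} r * ennreal (r ^ (?n - 1)) * f (r *\<^sub>R z)) \<partial>lborel) \<partial>lborel)"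
    by (intro nn_integral_cong nn_integral_cmult[symmetric]) measurable
  also have "\<dots> = (\<integral>\<^sup>+r. (\<integral>\<^sup>+z. indicator ?A z * (indicator {0<..} r * ennreal (r ^ (?n - 1)) * f (r *\<^sub>R z)) \<partial>lborel) \<partial>lborel)"
    by (rule lborel_pair.Fubini'[symmetric]) measurable
  also have "\<dots> = (\<integral>\<^sup>+r. (\<integral>\<^sup>+z. indicator {0<..} r * ennreal (1 / r) * (indicator ?A (z /\<^sub>R r) * f z) \<partial>lborel) \<partial>lborel)"
    by (simp only: scale)
  also have "\<dots> = (\<integral>\<^sup>+z. (\<integral>\<^sup>+r. indicator {0<..} r * ennreal (1 / r) * (indicator ?A (z /\<^sub>R r) * f z) \<partial>lborel) \<partial>lborel)"
    by (rule lborel_pair.Fubini') measurable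
  also have "\<dots> = (\<integral>\<^sup>+z. ennreal (ln 2) * f z \<partial>lborel)"
    by (rule nn_integral_cong_AE) (use AE_lborel_singleton[of "0::'a"] inner in auto)
  also have "\<dots> = ennreal (ln 2) * (\<integral>\<^sup>+z. f z \<partial>lborel)"
    by (rule nn_integral_cmult) measurable
  finally show ?thesis by simp
qed

subsection \<open>Radial functions and polar normals\<close>

text \<open>Envelope theorem. Uniqueness says that the closed inequalities expressing maximality cut
  out exactly the graph of \<nu>, and a closed graph into a compact set means continuity. Comparing
  the maximizers at x and y bounds the linearization error between 0 and (y - x) . (\<nu> y - \<nu>
  x), which is o(|y - x|).\<close>

lemma support_maximizer_derivative:
  fixes P :: "'a::euclidean_space set"
  assumes U: "open U" and P: "compact P"
    and mx: "\<And>x. x \<in> U \<Longrightarrow> \<nu> x \<in> P" "\<And>x w. x \<in> U \<Longrightarrow> w \<in> P \<Longrightarrow> x \<bullet> w \<le> x \<bullet> \<nu> x"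
    and un: "\<And>x w. x \<in> U \<Longrightarrow> w \<in> P \<Longrightarrow> x \<bullet> w = x \<bullet> \<nu> x \<Longrightarrow> w = \<nu> x"
  shows "continuous_on U \<nu>"
    and "\<And>x. x \<in> U \<Longrightarrow> ((\<lambda>x. x \<bullet> \<nu> x) has_derivative (\<lambda>h. h \<bullet> \<nu> x)) (at x)"
proof -
  have "(\<lambda>x. (x, \<nu> x)) ` U = (U \<times> P) \<inter> (\<Inter>w\<in>P. {z. fst z \<bullet> w \<le> fst z \<bullet> snd z})"
    using mx un by (auto simp: image_iff) (metis order_antisym)
  moreover have "closed (\<Inter>w\<in>P. {z::'a \<times> 'a. fst z \<bullet> w \<le> fst z \<bullet> snd z})"
    by (intro closed_INT ballI closed_Collect_le continuous_intros)
  ultimately have "closedin (top_of_set (U \<times> P)) ((\<lambda>x. (x, \<nu> x)) ` U)"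
    by (simp add: closedin_closed_Int)
  then show cont: "continuous_on U \<nu>"
    using continuous_closed_graph_eq[OF P, of \<nu> U] mx(1) by auto
  fix x assume x: "x \<in> U"
  show "((\<lambda>x. x \<bullet> \<nu> x) has_derivative (\<lambda>h. h \<bullet> \<nu> x)) (at x)"
    unfolding has_derivative_at_alt
  proof (intro conjI allI impI)
    show "bounded_linear (\<lambda>h. h \<bullet> \<nu> x)" by (rule bounded_linear_inner_left)
    fix e :: real assume "e > 0"
    moreover have "isCont \<nu> x" using cont U x by (simp add: continuous_on_eq_continuous_at)
    ultimately obtain d where d: "d > 0" "\<And>y. dist y x < d \<Longrightarrow> dist (\<nu> y) (\<nu> x) < e"
      unfolding continuous_at_eps_delta by blast
    obtain d' where d': "d' > 0" "ball x d' \<subseteq> U" using U x by (meson openE)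
    have "norm (y \<bullet> \<nu> y - x \<bullet> \<nu> x - (y - x) \<bullet> \<nu> x) \<le> e * norm (y - x)" if y: "norm (y - x) < min d d'" for y
    proof -
      have yU: "y \<in> U" using d' y by (auto simp: dist_norm norm_minus_commute)
      have "0 \<le> y \<bullet> \<nu> y - x \<bullet> \<nu> x - (y - x) \<bullet> \<nu> x"
        using mx(2)[OF yU mx(1)[OF x]] by (simp add: inner_diff_left)
      moreover have "y \<bullet> \<nu> y - x \<bullet> \<nu> x - (y - x) \<bullet> \<nu> x \<le> (y - x) \<bullet> (\<nu> y - \<nu> x)"
        using mx(2)[OF x mx(1)[OF yU]] by (simp add: inner_diff_left inner_diff_right)
      moreover have "(y - x) \<bullet> (\<nu> y - \<nu> x) \<le> norm (y - x) * norm (\<nu> y - \<nu> x)"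
        by (rule norm_cauchy_schwarz)
      moreover have "norm (y - x) * norm (\<nu> y - \<nu> x) \<le> norm (y - x) * e"
        using d(2)[of y] y by (intro mult_left_mono) (auto simp: dist_norm)
      ultimately show ?thesis by (simp add: mult.commute)
    qed
    then show "\<exists>d>0. \<forall>y. norm (y - x) < d \<longrightarrow> norm (y \<bullet> \<nu> y - x \<bullet> \<nu> x - (y - x) \<bullet> \<nu> x) \<le> e * norm (y - x)"
      using d d' by (intro exI[of _ "min d d'"]) auto
  qed
qed

text \<open>The admissible r form a closed bounded set, so the \<open>GREATEST\<close> is attained.
  Every nonzero x is allowed, not only unit vectors: the radial function is used as a function on
  the punctured space, where C^k has its ordinary meaning.\<close>

lemma radial_function_props:
  fixes M :: "'a::euclidean_space set"
  assumes M: "compact M" and v: "v \<in> interior M" and x: "x \<noteq> 0"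
  shows "radial_function M v x > 0" "v + radial_function M v x *\<^sub>R x \<in> M"
    "\<And>r. r \<ge> 0 \<Longrightarrow> v + r *\<^sub>R x \<in> M \<Longrightarrow> r \<le> radial_function M v x"
proof -
  let ?S = "{r. 0 \<le> r \<and> v + r *\<^sub>R x \<in> M}"
  have vM: "v \<in> M" using v interior_subset by auto
  obtain B where B: "\<And>y. y \<in> M \<Longrightarrow> norm y \<le> B" using compact_imp_bounded[OF M] by (auto simp: bounded_iff)
  have bdd: "r \<le> (B + norm v) / norm x" if "r \<in> ?S" for r
  proof -
    have "norm (r *\<^sub>R x) \<le> norm (v + r *\<^sub>R x) + norm v" by (metis add.commute norm_triangle_sub norm_minus_commute add_diff_cancel_left')
    also have "\<dots> \<le> B + norm v" using that B by auto
    finally show ?thesis using that x by (simp add: field_simps)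
  qed
  have "?S = {0..} \<inter> (\<lambda>r. v + r *\<^sub>R x) -` M" by auto
  also have "closed \<dots>" using compact_imp_closed[OF M] by (intro closed_Int closed_vimage continuous_intros) auto
  finally have cl: "closed ?S" .
  have ne: "0 \<in> ?S" using vM by simp
  have bd: "bdd_above ?S" using bdd by (meson bdd_aboveI)
  have Sup: "Sup ?S \<in> ?S" using closed_contains_Sup[OF _ bd cl] ne by blast
  have up: "r \<le> Sup ?S" if "r \<in> ?S" for r using bd that by (rule cSup_upper[rotated])
  have R: "radial_function M v x = Sup ?S"
    unfolding radial_function_def using Sup up by (intro Greatest_equality) auto
  show "v + radial_function M v x *\<^sub>R x \<in> M" using Sup by (simp add: R)
  show "r \<le> radial_function M v x" if "r \<ge> 0" "v + r *\<^sub>R x \<in> M" for r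
    unfolding R using that by (intro up) auto
  obtain e where e: "e > 0" "ball v e \<subseteq> M" using v by (auto simp: mem_interior)
  let ?r = "e / (2 * norm x)"
  have "v + ?r *\<^sub>R x \<in> M" using e x by (intro subsetD[OF e(2)]) (simp add: dist_norm)
  with up[of ?r] e x show "radial_function M v x > 0"
    unfolding R by (smt (verit, ccfv_SIG) divide_pos_pos mem_Collect_eq zero_less_norm_iff)
qed

lemma frontier_radial_function:
  fixes M :: "'a::euclidean_space set"
  assumes M: "compact M" and v: "v \<in> interior M" and x: "x \<noteq> 0"
  shows "v + radial_function M v x *\<^sub>R x \<notin> interior M"
proof
  let ?r = "radial_function M v x"
  assume "v + ?r *\<^sub>R x \<in> interior M"
  then obtain e where e: "e > 0" "ball (v + ?r *\<^sub>R x) e \<subseteq> M" by (auto simp: mem_interior)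
  let ?s = "e / (2 * norm x)"
  have "v + (?r + ?s) *\<^sub>R x \<in> M"
    using e x by (intro subsetD[OF e(2)]) (simp add: dist_norm scaleR_add_left)
  moreover have "?s > 0" using e x by simp
  ultimately show False
    using radial_function_props[OF assms] by (smt (verit))
qed

text \<open>A ray from an interior point of a convex set leaves it only once, since everything
  strictly before a point of the set is interior.\<close>

lemma radial_function_eqI:
  fixes M :: "'a::euclidean_space set"
  assumes M: "compact M" "convex M" and v: "v \<in> interior M" and x: "x \<noteq> 0"
    and r: "r > 0" "v + r *\<^sub>R x \<in> M" "v + r *\<^sub>R x \<notin> interior M"
  shows "radial_function M v x = r"
proof (rule ccontr)
  let ?\<rho> = "radial_function M v x"
  note R = radial_function_props[OF M(1) v x]
  assume "?\<rho> \<noteq> r"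
  with R(3)[of r] r have lt: "r < ?\<rho>" by simp
  have "v + r *\<^sub>R x \<in> open_segment v (v + ?\<rho> *\<^sub>R x)"
    unfolding in_segment using lt r x R(1)
    by (intro conjI exI[of _ "r / ?\<rho>"]) (auto simp: algebra_simps)
  with in_interior_closure_convex_segment[OF M(2) v, of "v + ?\<rho> *\<^sub>R x"] R(2) r(3) closure_subset
  show False by blast
qed

text \<open>The polar body of M - v. For a convex body M with v in its interior, its support
  function is the gauge of M about v, the reciprocal of the radial function.\<close>

definition centered_polar :: "'a::euclidean_space set \<Rightarrow> 'a \<Rightarrow> 'a set" where
  "centered_polar M v = {w. \<forall>y\<in>M. (y - v) \<bullet> w \<le> 1}"

lemma compact_centered_polar:
  fixes M :: "'a::euclidean_space set"
  assumes v: "v \<in> interior M"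
  shows "compact (centered_polar M v)"
proof -
  obtain e where e: "e > 0" "ball v e \<subseteq> M" using v by (auto simp: mem_interior)
  have "norm w \<le> 2 / e" if w: "w \<in> centered_polar M v" for w
  proof (cases "w = 0")
    case False
    let ?y = "v + (e / (2 * norm w)) *\<^sub>R w"
    have "?y \<in> M" using e False by (intro subsetD[OF e(2)]) (simp add: dist_norm)
    then have "(e / (2 * norm w)) * (w \<bullet> w) \<le> 1" using w by (auto simp: centered_polar_def)
    then show ?thesis using False e by (simp add: dot_square_norm power2_eq_square field_simps)
  qed (use e in simp)
  then have "bounded (centered_polar M v)" by (auto simp: bounded_iff)
  moreover have "centered_polar M v = (\<Inter>y\<in>M. {w. (y - v) \<bullet> w \<le> 1})"
    by (auto simp: centered_polar_def)
  then have "closed (centered_polar M v)" by (auto intro!: closed_INT closed_halfspace_le)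
  ultimately show ?thesis by (simp add: compact_eq_bounded_closed)
qed

lemma centered_polar_radial_le:
  assumes M: "compact M" and v: "v \<in> interior M" and x: "x \<noteq> 0" and w: "w \<in> centered_polar M v"
  shows "radial_function M v x * (x \<bullet> w) \<le> 1"
  using radial_function_props(2)[OF M v x] w unfolding centered_polar_def by fastforce

lemma centered_polar_normal_exists:
  fixes M :: "'a::euclidean_space set"
  assumes M: "compact M" "convex M" and v: "v \<in> interior M" and x: "x \<noteq> 0"
  shows "\<exists>w\<in>centered_polar M v. radial_function M v x * (x \<bullet> w) = 1"
proof -
  let ?b = "v + radial_function M v x *\<^sub>R x"
  note R = radial_function_props[OF M(1) v x]
  have "?b \<notin> rel_interior M"
    using frontier_radial_function[OF M(1) v x] v interior_rel_interior_gen[of M]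
    by (metis empty_iff interior_rel_interior_gen rel_interior_nonempty_interior)
  from supporting_hyperplane_rel_boundary[OF M(2) R(2) this]
  obtain a where a: "a \<noteq> 0" "\<And>y. y \<in> M \<Longrightarrow> a \<bullet> ?b \<le> a \<bullet> y" "\<And>y. y \<in> rel_interior M \<Longrightarrow> a \<bullet> ?b < a \<bullet> y" by blast
  have "v \<in> rel_interior M" using v by (metis empty_iff rel_interior_nonempty_interior)
  from a(3)[OF this] have neg: "radial_function M v x * (a \<bullet> x) < 0" by (simp add: inner_add_right)
  \<comment> \<open>The functional \<open>a\<close> is minimal at \<open>?b\<close>, so
    \<open>- a\<close> is an outer normal there, and \<open>c\<close> is its value on
    \<open>?b - v\<close>; dividing by it normalizes the value to 1.\<close>
  define c where "c = - (radial_function M v x * (a \<bullet> x))"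
  have c: "c > 0" using neg by (simp add: c_def)
  have "(y - v) \<bullet> (- a /\<^sub>R c) \<le> 1" if "y \<in> M" for y
  proof -
    have "- (a \<bullet> (y - v)) \<le> c"
      using a(2)[OF that] by (simp add: c_def inner_add_right inner_diff_right)
    then show ?thesis using c by (simp add: inner_commute[of _ a] field_simps)
  qed
  moreover have "radial_function M v x * (x \<bullet> (- a /\<^sub>R c)) = 1"
  proof -
    have "radial_function M v x * (x \<bullet> (- a /\<^sub>R c)) = inverse c * c"
      by (simp add: inner_commute[of _ a]) (simp add: c_def)
    then show ?thesis using c by simp
  qed
  ultimately show ?thesis unfolding centered_polar_def by blast
qed

text \<open>The gauge x . \<nu> x has gradient \<nu> and so is one order smoother than \<nu>. The
  guard \<open>k > 0\<close> reflects that continuity of \<nu> already follows from the uniqueness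
  \<open>un\<close>.\<close>

lemma Ck_on_open_radial_function:
  fixes M :: "'a::euclidean_space set"
  assumes M: "compact M" "convex M" and v: "v \<in> interior M"
    and \<nu>: "\<And>x. x \<noteq> 0 \<Longrightarrow> \<nu> x \<in> centered_polar M v"
      "\<And>x. x \<noteq> 0 \<Longrightarrow> radial_function M v x * (x \<bullet> \<nu> x) = 1"
    and un: "\<And>x w. x \<noteq> 0 \<Longrightarrow> w \<in> centered_polar M v \<Longrightarrow> radial_function M v x * (x \<bullet> w) = 1 \<Longrightarrow> w = \<nu> x"
    and k: "k > 0 \<Longrightarrow> Ck_on_open k \<nu> (- {0})"
  shows "Ck_on_open (Suc k) (radial_function M v) (- {0})"
proof -
  have op: "open (- {0::'a})" by auto
  note R = radial_function_props[OF M(1) v]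
  have mx: "x \<bullet> w \<le> x \<bullet> \<nu> x" if "x \<in> - {0}" "w \<in> centered_polar M v" for x w
    using centered_polar_radial_le[OF M(1) v _ that(2), of x] \<nu>(2)[of x] R(1)[of x] that
    by (metis ComplD insertI1 mult_le_cancel_left_pos)
  have un': "w = \<nu> x" if "x \<in> - {0}" "w \<in> centered_polar M v" "x \<bullet> w = x \<bullet> \<nu> x" for x w
    using un[of x w] \<nu>(2)[of x] that by simp
  note D = support_maximizer_derivative[OF op compact_centered_polar[OF v] _ mx un']
  have cont: "continuous_on (- {0}) \<nu>" using \<nu>(1) by (intro D(1)) auto
  have der: "((\<lambda>x. x \<bullet> \<nu> x) has_derivative (\<lambda>h. h \<bullet> \<nu> x)) (at x)" if "x \<in> - {0}" for x
    using \<nu>(1) that by (intro D(2)) auto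
  have "Ck_on_open k \<nu> (- {0})" using k cont by (cases "k = 0") auto
  then have "Ck_on_open k (\<lambda>x. h \<bullet> \<nu> x) (- {0})" for h
    by (intro Ck_on_open_inner[OF op Ck_on_open_const])
  then have "Ck_on_open (Suc k) (\<lambda>x. x \<bullet> \<nu> x) (- {0})"
    by (intro Ck_on_open_SucI[OF op der])
  moreover have nz: "x \<bullet> \<nu> x \<noteq> 0" if "x \<in> - {0}" for x using \<nu>(2)[of x] that by auto
  ultimately have C: "Ck_on_open (Suc k) (\<lambda>x. inverse (x \<bullet> \<nu> x)) (- {0})"
    by (intro Ck_on_open_inverse[OF op]) auto
  have eq: "radial_function M v x = inverse (x \<bullet> \<nu> x)" if "x \<in> - {0}" for x
    using \<nu>(2)[of x] that by (metis ComplD inverse_unique mult.commute singletonI)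
  show ?thesis by (rule iffD2[OF Ck_on_open_cong[OF op eq] C])
qed

subsection \<open>Caps and the bathtub principle\<close>

definition cap :: "'a::euclidean_space set \<Rightarrow> 'a \<Rightarrow> real \<Rightarrow> 'a set" where
  "cap K u t = {y \<in> K. t \<le> u \<bullet> y}"

lemma cap_subset: "cap K u t \<subseteq> K"
  by (auto simp: cap_def)

lemma compact_cap:
  assumes "compact K"
  shows "compact (cap K u t)"
proof -
  have "cap K u t = K \<inter> {y. t \<le> u \<bullet> y}" by (auto simp: cap_def)
  then show ?thesis using assms by (simp add: compact_Int_closed closed_halfspace_ge)
qed

locale floating_body =
  fixes K :: "'a::euclidean_space set" and \<delta> :: real
  assumes compact_K: "compact K" and convex_K: "convex K" and interior_K: "interior K \<noteq> {}"
    and \<delta>_pos: "0 < \<delta>" and \<delta>_less: "\<delta> < measure lebesgue K"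
begin

abbreviation \<mu> :: "'a measure" where "\<mu> \<equiv> lebesgue_on K"

definition admissible :: "('a \<Rightarrow> real) \<Rightarrow> bool" where
  "admissible f \<longleftrightarrow> f \<in> borel_measurable \<mu> \<and> f \<in> K \<rightarrow> {0..1} \<and> (LINT y|\<mu>. f y) = \<delta>"

definition centroid :: "('a \<Rightarrow> real) \<Rightarrow> 'a" where
  "centroid f = (1 / \<delta>) *\<^sub>R (LINT y|\<mu>. f y *\<^sub>R y)"

lemma ulam_floating_body_eq: "ulam_floating_body \<delta> K = {centroid f | f. admissible f}"
  unfolding ulam_floating_body_def centroid_def admissible_def using \<delta>_pos by (auto simp: field_simps)

lemma K_lebesgue [measurable]: "K \<in> sets lebesgue"
  using compact_K by (simp add: borel_compact)

lemma K_lmeasurable: "K \<in> lmeasurable"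
  using compact_K by (rule lmeasurable_compact)

lemma finite_measure_\<mu>: "finite_measure \<mu>"
  by (rule finite_measure_lebesgue_on[OF K_lmeasurable])

lemma space_\<mu> [simp]: "space \<mu> = K"
  by (simp add: space_restrict_space)

lemma borel_measurable_\<mu>: "f \<in> borel_measurable borel \<Longrightarrow> f \<in> borel_measurable \<mu>"
  by (intro measurable_restrict_space1 measurable_completion) auto

lemma integrable_\<mu>:
  fixes h :: "'a \<Rightarrow> 'b::euclidean_space"
  assumes "h \<in> borel_measurable \<mu>" "\<And>y. y \<in> K \<Longrightarrow> norm (h y) \<le> B"
  shows "integrable \<mu> h"
proof -
  interpret finite_measure \<mu> by (rule finite_measure_\<mu>)
  show ?thesis using assms by (intro integrable_const_bound[of h B] AE_I2) auto
qed

lemma AE_\<mu>I: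
  assumes "negligible N" "\<And>y. y \<in> K \<Longrightarrow> y \<notin> N \<Longrightarrow> P y"
  shows "AE y in \<mu>. P y"
proof -
  have "AE y in lebesgue. y \<notin> N"
    using assms(1) by (simp add: negligible_iff_null_sets AE_not_in)
  then have "AE y in lebesgue. y \<in> K \<longrightarrow> P y"
    by eventually_elim (use assms(2) in auto)
  then show ?thesis by (simp add: AE_restrict_space_iff)
qed

lemma open_AE_\<mu>_empty:
  assumes "open U" "U \<subseteq> K" "AE y in \<mu>. y \<notin> U"
  shows "U = {}"
proof -
  have "AE y in lebesgue. y \<notin> U"
    using assms(2,3) by (auto simp: AE_restrict_space_iff elim!: eventually_mono)
  then have "U \<in> null_sets lebesgue"
    using assms(1) by (subst AE_iff_null_sets) auto
  then show ?thesis
    using open_not_negligible[OF assms(1)] by (auto simp: negligible_iff_null_sets)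
qed

section \<open>Volume of caps\<close>

lemma cap_borel [measurable]: "cap K u t \<in> sets borel"
  using compact_cap[OF compact_K] by (rule borel_compact)

lemma integral_indicator_cap: "(LINT y|\<mu>. indicator (cap K u t) y) = measure lebesgue (cap K u t)"
proof -
  have "(LINT y|\<mu>. indicator (cap K u t) y :: real) = measure \<mu> (cap K u t \<inter> K)"
    by simp
  also have "\<dots> = measure lebesgue (cap K u t)"
    using cap_subset[of K u t] by (subst measure_restrict_space) (auto simp: Int_absorb2)
  finally show ?thesis .
qed

lemma admissible_cap:
  "measure lebesgue (cap K u t) = \<delta> \<Longrightarrow> admissible (indicator (cap K u t))"
  unfolding admissible_def integral_indicator_cap
  by (intro conjI borel_measurable_\<mu>) (auto simp: indicator_def)

text \<open>Indicators of caps converge pointwise off the limiting hyperplane, a null set because u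
  is nonzero; dominated convergence does the rest.\<close>

lemma continuous_cap_volume:
  assumes "u \<noteq> 0"
  shows "isCont (\<lambda>t. measure lebesgue (cap K u t)) t"
  unfolding continuous_at_sequentially comp_def
proof (intro allI impI)
  fix s :: "nat \<Rightarrow> real" assume s: "s \<longlonglongrightarrow> t"
  have "(\<lambda>j. LINT y|\<mu>. indicator (cap K u (s j)) y :: real) \<longlonglongrightarrow> (LINT y|\<mu>. indicator (cap K u t) y)"
  proof (rule integral_dominated_convergence[where w = "\<lambda>_. 1"])
    show "AE y in \<mu>. (\<lambda>j. indicator (cap K u (s j)) y :: real) \<longlonglongrightarrow> indicator (cap K u t) y"
    proof (rule AE_\<mu>I[where N = "{y. u \<bullet> y = t}"])
      show "negligible {y. u \<bullet> y = t}" using assms by (simp add: negligible_hyperplane)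
      fix y assume y: "y \<in> K" "y \<notin> {y. u \<bullet> y = t}"
      then consider "t < u \<bullet> y" | "u \<bullet> y < t" by fastforce
      then have "\<forall>\<^sub>F j in sequentially. indicator (cap K u (s j)) y = (indicator (cap K u t) y :: real)"
      proof cases
        case 1
        from order_tendstoD(2)[OF s 1] show ?thesis
          by eventually_elim (use 1 y in \<open>auto simp: cap_def indicator_def\<close>)
      next
        case 2
        from order_tendstoD(1)[OF s 2] show ?thesis
          by eventually_elim (use 2 y in \<open>auto simp: cap_def indicator_def\<close>)
      qed
      then show "(\<lambda>j. indicator (cap K u (s j)) y :: real) \<longlonglongrightarrow> indicator (cap K u t) y"
        by (rule tendsto_eventually)
    qed
  qed (auto intro!: borel_measurable_\<mu> integrable_\<mu>[where B = 1])
  then show "(\<lambda>j. measure lebesgue (cap K u (s j))) \<longlonglongrightarrow> measure lebesgue (cap K u t)"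
    by (simp only: integral_indicator_cap)
qed

lemma bounded_K: "\<exists>B>0. \<forall>y\<in>K. norm y \<le> B"
  using compact_imp_bounded[OF compact_K] by (auto simp: bounded_pos)

lemma cap_volume_exists:
  assumes "u \<noteq> 0"
  shows "\<exists>t. measure lebesgue (cap K u t) = \<delta>"
proof -
  obtain B where B: "B > 0" "\<And>y. y \<in> K \<Longrightarrow> norm y \<le> B" using bounded_K by blast
  \<comment> \<open>By Cauchy-Schwarz the cap at height \<open>?a\<close> is all of
    \<open>K\<close>; the added 1 makes the cap at \<open>?b\<close> empty.\<close>
  let ?a = "- (norm u * B)" and ?b = "norm u * B + 1"
  have bd: "\<bar>u \<bullet> y\<bar> \<le> norm u * B" if "y \<in> K" for y
    using Cauchy_Schwarz_ineq2[of u y] mult_left_mono[OF B(2)[OF that], of "norm u"] by simp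
  have "cap K u ?a = K" "cap K u ?b = {}"
    using bd by (force simp: cap_def abs_le_iff)+
  then have "measure lebesgue (cap K u ?b) \<le> \<delta>" "\<delta> \<le> measure lebesgue (cap K u ?a)"
    using \<delta>_pos \<delta>_less by auto
  moreover have "?a \<le> ?b" using B(1) by simp
  ultimately show ?thesis
    using IVT2[of "\<lambda>t. measure lebesgue (cap K u t)" ?b \<delta> ?a] continuous_cap_volume[OF assms] by blast
qed

text \<open>A hyperplane missing the connected interior has it on one side, so the cap would be a
  null set or all of K, against 0 < \<delta> < |K|.\<close>

lemma cap_hyperplane_interior:
  assumes u: "u \<noteq> 0" and vol: "measure lebesgue (cap K u t) = \<delta>"
  shows "\<exists>p\<in>interior K. u \<bullet> p = t"
proof (rule ccontr)
  assume "\<not> ?thesis"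
  then have ne: "u \<bullet> p \<noteq> t" if "p \<in> interior K" for p using that by blast
  have "connected ((\<lambda>p. u \<bullet> p) ` interior K)"
    by (intro connected_continuous_image convex_connected convex_interior convex_K continuous_intros)
  then have "is_interval ((\<lambda>p. u \<bullet> p) ` interior K)" by (simp add: is_interval_connected_1)
  then have side: "(\<forall>p\<in>interior K. u \<bullet> p < t) \<or> (\<forall>p\<in>interior K. t < u \<bullet> p)"
  proof -
    assume int: "is_interval ((\<lambda>p. u \<bullet> p) ` interior K)"
    have False if "p \<in> interior K" "q \<in> interior K" "u \<bullet> p < t" "t < u \<bullet> q" for p q
    proof -
      have "t \<in> (\<lambda>p. u \<bullet> p) ` interior K"
        using int that unfolding is_interval_1 by (meson imageI less_imp_le)
      then show False using ne by auto
    qed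
    then show ?thesis using ne by (meson linorder_neqE_linordered_idom)
  qed
  have cl: "K \<subseteq> closure (interior K)"
    using convex_closure_interior[OF convex_K interior_K] closure_subset by auto
  from side show False
  proof
    assume "\<forall>p\<in>interior K. u \<bullet> p < t"
    then have "interior K \<subseteq> {p. u \<bullet> p \<le> t}" by auto
    then have "closure (interior K) \<subseteq> {p. u \<bullet> p \<le> t}" by (intro closure_minimal closed_halfspace_le)
    with cl have "cap K u t \<subseteq> {p. u \<bullet> p = t}" by (fastforce simp: cap_def)
    then have "negligible (cap K u t)" using u negligible_hyperplane negligible_subset by blast
    from negligible_imp_measure0[OF this] vol \<delta>_pos show False by linarith
  next
    assume "\<forall>p\<in>interior K. t < u \<bullet> p"
    then have "interior K \<subseteq> {p. t \<le> u \<bullet> p}" by auto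
    then have "closure (interior K) \<subseteq> {p. t \<le> u \<bullet> p}" by (intro closure_minimal closed_halfspace_ge)
    with cl have "cap K u t = K" by (auto simp: cap_def)
    with vol \<delta>_less show False by simp
  qed
qed

section \<open>The bathtub principle\<close>

lemma admissible_integrable:
  assumes "admissible f" "h \<in> borel_measurable borel" "\<And>y. y \<in> K \<Longrightarrow> norm (h y) \<le> B"
  shows "integrable \<mu> (\<lambda>y. f y *\<^sub>R (h y :: 'b::euclidean_space))"
proof (rule integrable_\<mu>)
  have [measurable]: "f \<in> borel_measurable \<mu>" "h \<in> borel_measurable \<mu>"
    using assms by (auto simp: admissible_def intro: borel_measurable_\<mu>)
  show "(\<lambda>y. f y *\<^sub>R h y) \<in> borel_measurable \<mu>" by measurable
  fix y assume y: "y \<in> K"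
  then have "0 \<le> f y" "f y \<le> 1" using assms(1) by (auto simp: admissible_def Pi_iff)
  then have "norm (f y *\<^sub>R h y) \<le> 1 * norm (h y)" by (simp add: mult_left_le_one_le)
  with assms(3)[OF y] show "norm (f y *\<^sub>R h y) \<le> B" by simp
qed

lemma admissible_integrable_ident:
  assumes "admissible f"
  shows "integrable \<mu> (\<lambda>y. f y *\<^sub>R y)"
proof -
  obtain B where "B > 0" "\<And>y. y \<in> K \<Longrightarrow> norm y \<le> B" using bounded_K by blast
  then show ?thesis using admissible_integrable[OF assms, of "\<lambda>y. y" B] by simp
qed

lemma admissible_integrable_real:
  "admissible f \<Longrightarrow> integrable \<mu> f"
  using admissible_integrable[of f "\<lambda>_. 1::real" 1] by simp

lemma inner_centroid:
  assumes "admissible f"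
  shows "u \<bullet> centroid f = (LINT y|\<mu>. f y * (u \<bullet> y)) / \<delta>"
  using integral_inner_right[OF admissible_integrable_ident[OF assms], of u]
  by (simp add: centroid_def field_simps)

text \<open>Since 0 <= f <= 1, the factors 1_C - f and u . y - t never have opposite signs, so their
  product is its own absolute value; the part with t integrates to zero because both densities have
  mass \<delta>. Maximality, uniqueness and stability of the cap are all read off this
  identity.\<close>

lemma cap_deficit:
  assumes f: "admissible f" and vol: "measure lebesgue (cap K u t) = \<delta>"
  shows "integrable \<mu> (\<lambda>y. \<bar>indicator (cap K u t) y - f y\<bar> * \<bar>u \<bullet> y - t\<bar>)"
    and "u \<bullet> centroid (indicator (cap K u t)) - u \<bullet> centroid f =
      (LINT y|\<mu>. \<bar>indicator (cap K u t) y - f y\<bar> * \<bar>u \<bullet> y - t\<bar>) / \<delta>"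
proof -
  let ?c = "indicator (cap K u t) :: 'a \<Rightarrow> real"
  note c = admissible_cap[OF vol]
  obtain B where B: "B > 0" "\<And>y. y \<in> K \<Longrightarrow> norm y \<le> B" using bounded_K by blast
  have bd: "\<bar>u \<bullet> y\<bar> \<le> norm u * B" if "y \<in> K" for y
    using Cauchy_Schwarz_ineq2[of u y] mult_left_mono[OF B(2)[OF that], of "norm u"] by simp
  have int: "integrable \<mu> (\<lambda>y. g y * (u \<bullet> y))" if "admissible g" for g
    using admissible_integrable[OF that, of "\<lambda>y. u \<bullet> y" "norm u * B"] bd by auto
  note ints = int[OF f] int[OF c] admissible_integrable_real[OF f] admissible_integrable_real[OF c]
  have pw: "\<bar>?c y - f y\<bar> * \<bar>u \<bullet> y - t\<bar> = (?c y * (u \<bullet> y) - f y * (u \<bullet> y)) - t * (?c y - f y)" if "y \<in> K" for y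
  proof -
    have "0 \<le> f y" "f y \<le> 1" using f that by (auto simp: admissible_def Pi_iff)
    then show ?thesis using that
      by (cases "t \<le> u \<bullet> y") (auto simp: cap_def algebra_simps)
  qed
  have "integrable \<mu> (\<lambda>y. (?c y * (u \<bullet> y) - f y * (u \<bullet> y)) - t * (?c y - f y))"
    using ints by (intro Bochner_Integration.integrable_diff integrable_mult_right) auto
  then show "integrable \<mu> (\<lambda>y. \<bar>?c y - f y\<bar> * \<bar>u \<bullet> y - t\<bar>)"
    by (rule Bochner_Integration.integrable_cong[THEN iffD2, rotated 2]) (auto simp: pw)
  have "(LINT y|\<mu>. \<bar>?c y - f y\<bar> * \<bar>u \<bullet> y - t\<bar>) = (LINT y|\<mu>. (?c y * (u \<bullet> y) - f y * (u \<bullet> y)) - t * (?c y - f y))"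
    by (rule Bochner_Integration.integral_cong) (auto simp: pw)
  also have "\<dots> = (LINT y|\<mu>. ?c y * (u \<bullet> y)) - (LINT y|\<mu>. f y * (u \<bullet> y)) - t * ((LINT y|\<mu>. ?c y) - (LINT y|\<mu>. f y))"
    using ints by (simp add: Bochner_Integration.integral_diff)
  also have "\<dots> = (LINT y|\<mu>. ?c y * (u \<bullet> y)) - (LINT y|\<mu>. f y * (u \<bullet> y))"
    using f c by (simp add: admissible_def)
  finally show "u \<bullet> centroid ?c - u \<bullet> centroid f = (LINT y|\<mu>. \<bar>?c y - f y\<bar> * \<bar>u \<bullet> y - t\<bar>) / \<delta>"
    unfolding inner_centroid[OF f] inner_centroid[OF c] by (simp add: diff_divide_distrib)
qed

lemma centroid_le_cap:
  assumes f: "admissible f" and vol: "measure lebesgue (cap K u t) = \<delta>"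
  shows "u \<bullet> centroid f \<le> u \<bullet> centroid (indicator (cap K u t))"
proof -
  have "0 \<le> (LINT y|\<mu>. \<bar>indicator (cap K u t) y - f y\<bar> * \<bar>u \<bullet> y - t\<bar>) / \<delta>"
    using \<delta>_pos by (intro divide_nonneg_pos integral_nonneg_AE AE_I2) auto
  then show ?thesis using cap_deficit(2)[OF assms] by linarith
qed

text \<open>Zero deficit makes the caps agree almost everywhere. The open parts of the interior
  where they disagree are then empty, so near an interior point p of the first hyperplane the second
  one must pass through p and bound the same side.\<close>

lemma cap_normal_unique:
  assumes u: "u \<noteq> 0" and u': "u' \<noteq> 0"
    and vol: "measure lebesgue (cap K u t) = \<delta>" and vol': "measure lebesgue (cap K u' t') = \<delta>"
    and le: "u \<bullet> centroid (indicator (cap K u t)) \<le> u \<bullet> centroid (indicator (cap K u' t'))"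
  shows "\<exists>c>0. u' = c *\<^sub>R u"
proof -
  let ?c = "indicator (cap K u t) :: 'a \<Rightarrow> real" and ?c' = "indicator (cap K u' t') :: 'a \<Rightarrow> real"
  let ?h = "\<lambda>y. \<bar>?c y - ?c' y\<bar> * \<bar>u \<bullet> y - t\<bar>"
  note D = cap_deficit[OF admissible_cap[OF vol'] vol]
  have "(LINT y|\<mu>. ?h y) / \<delta> \<le> 0" using le D(2) by linarith
  then have "(LINT y|\<mu>. ?h y) \<le> 0" by (simp only: pos_divide_le_eq[OF \<delta>_pos] mult_zero_left)
  moreover have "0 \<le> (LINT y|\<mu>. ?h y)" by (intro integral_nonneg_AE AE_I2) auto
  ultimately have "(LINT y|\<mu>. ?h y) = 0" by (rule order_antisym)
  then have ae: "AE y in \<mu>. ?h y = 0"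
    by (subst (asm) integral_nonneg_eq_0_iff_AE[OF D(1)]) auto
  \<comment> \<open>Points in one open half-space and outside the other closed one: there the
    integrand \<open>?h\<close> is nonzero.\<close>
  let ?O1 = "interior K \<inter> {y. t < u \<bullet> y} \<inter> {y. u' \<bullet> y < t'}"
  let ?O2 = "interior K \<inter> {y. u \<bullet> y < t} \<inter> {y. t' < u' \<bullet> y}"
  have sub: "interior K \<subseteq> K" by (rule interior_subset)
  have O1: "?O1 = {}"
    using sub by (intro open_AE_\<mu>_empty open_Int open_interior open_halfspace_gt open_halfspace_lt)
      (auto intro!: eventually_mono[OF ae] simp: cap_def indicator_def split: if_splits)
  have O2: "?O2 = {}"
    using sub by (intro open_AE_\<mu>_empty open_Int open_interior open_halfspace_gt open_halfspace_lt)
      (auto intro!: eventually_mono[OF ae] simp: cap_def indicator_def split: if_splits)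
  obtain p where p: "p \<in> interior K" "u \<bullet> p = t" using cap_hyperplane_interior[OF u vol] by blast
  have small: "\<exists>e>0. \<forall>s. \<bar>s\<bar> \<le> e \<longrightarrow> p + s *\<^sub>R z \<in> interior K" for z
  proof -
    obtain r where r: "r > 0" "ball p r \<subseteq> interior K" using p(1) open_interior by (meson openE)
    have "norm (s *\<^sub>R z) < r" if "\<bar>s\<bar> \<le> r / (norm z + 1)" for s
    proof -
      have "\<bar>s\<bar> * norm z \<le> r / (norm z + 1) * norm z" using that by (intro mult_right_mono) auto
      also have "\<dots> < r" using r(1) by (simp add: field_simps add_pos_nonneg)
      finally show ?thesis by simp
    qed
    then show ?thesis using r by (intro exI[of _ "r / (norm z + 1)"]) (auto simp: dist_norm intro!: divide_pos_pos add_nonneg_pos subsetD[OF r(2)])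
  qed
  have half: "t' \<le> u' \<bullet> (p + s *\<^sub>R z)" if "s > 0" "u \<bullet> z > 0" "p + s *\<^sub>R z \<in> interior K" for s z
    using O1 that p by (auto simp: inner_add_right)
  have tp: "u' \<bullet> p = t'"
  proof (rule ccontr)
    assume ne: "u' \<bullet> p \<noteq> t'"
    obtain e where e: "e > 0" "\<And>s. \<bar>s\<bar> \<le> e \<Longrightarrow> p + s *\<^sub>R u \<in> interior K" using small by blast
    \<comment> \<open>Small enough that moving p by d u in either direction changes the value of
      \<open>u'\<close> by less than its distance from \<open>t'\<close>; the 1 keeps the
      denominator positive.\<close>
    define d where "d = min e (\<bar>u' \<bullet> p - t'\<bar> / (2 * (\<bar>u' \<bullet> u\<bar> + 1)))"
    have d: "d > 0" "d \<le> e" using e ne by (auto simp: d_def)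
    have q: "\<bar>u' \<bullet> u\<bar> + 1 > 0" by simp
    have "d \<le> \<bar>u' \<bullet> p - t'\<bar> / (2 * (\<bar>u' \<bullet> u\<bar> + 1))" by (simp add: d_def)
    with q have "d * (\<bar>u' \<bullet> u\<bar> + 1) \<le> \<bar>u' \<bullet> p - t'\<bar> / 2"
      by (simp add: pos_le_divide_eq mult.assoc) (simp add: algebra_simps)
    moreover have "d * \<bar>u' \<bullet> u\<bar> < d * (\<bar>u' \<bullet> u\<bar> + 1)" using d by simp
    ultimately have small': "\<bar>d * (u' \<bullet> u)\<bar> < \<bar>u' \<bullet> p - t'\<bar>"
      unfolding abs_mult abs_of_pos[OF d(1)] using zero_less_abs_iff[of "u' \<bullet> p - t'"] ne by argo
    have uu: "d * (u \<bullet> u) > 0" using u d by simp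
    show False
    proof (cases "u' \<bullet> p < t'")
      case True
      then have "p + d *\<^sub>R u \<in> ?O1" using e(2)[of d] d p uu small' by (simp add: inner_add_right)
      then show False using O1 by blast
    next
      case False
      then have "p + (- d) *\<^sub>R u \<in> ?O2" using e(2)[of "- d"] d p uu small' ne by (simp add: inner_diff_right)
      then show False using O2 by blast
    qed
  qed
  have pos: "u' \<bullet> z \<ge> 0" if "u \<bullet> z > 0" for z
  proof -
    obtain e where e: "e > 0" "\<And>s. \<bar>s\<bar> \<le> e \<Longrightarrow> p + s *\<^sub>R z \<in> interior K" using small by blast
    have "t' \<le> u' \<bullet> (p + e *\<^sub>R z)" using half[of e z] e that by auto
    then show ?thesis using tp e(1) by (simp add: inner_add_right zero_le_mult_iff)
  qed
  define c where "c = (u' \<bullet> u) / (u \<bullet> u)"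
  define w where "w = u' - c *\<^sub>R u"
  have uu: "u \<bullet> u > 0" using u by simp
  have wu: "u \<bullet> w = 0" using uu by (simp add: w_def c_def inner_diff_right inner_commute)
  have "w = 0"
  proof (rule ccontr)
    assume "w \<noteq> 0"
    then have ww: "w \<bullet> w > 0" by simp
    have u'w: "u' \<bullet> w = w \<bullet> w" using wu by (simp add: w_def inner_diff_left)
    \<comment> \<open>Subtracting this multiple of w leaves the value of u unchanged and positive
      but makes that of u' negative, contradicting \<open>pos\<close>.\<close>
    let ?s = "(\<bar>u' \<bullet> u\<bar> + 1) / (w \<bullet> w)"
    have "0 \<le> u' \<bullet> (u - ?s *\<^sub>R w)" using wu uu by (intro pos) (simp add: inner_diff_right)
    also have "\<dots> = u' \<bullet> u - (\<bar>u' \<bullet> u\<bar> + 1)" using ww u'w by (simp add: inner_diff_right)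
    finally show False by linarith
  qed
  then have "u' = c *\<^sub>R u" by (simp add: w_def)
  moreover have "c \<ge> 0" using pos[of u] uu by (simp add: c_def)
  ultimately show ?thesis using u' by (intro exI[of _ c]) auto
qed

section \<open>The Ulam floating body is a convex body\<close>

lemma centroid_cap_mem:
  "measure lebesgue (cap K u t) = \<delta> \<Longrightarrow> centroid (indicator (cap K u t)) \<in> ulam_floating_body \<delta> K"
  using admissible_cap by (auto simp: ulam_floating_body_eq)

lemma convex_ulam: "convex (ulam_floating_body \<delta> K)"
proof (rule convexI)
  fix x y and a b :: real
  assume xy: "x \<in> ulam_floating_body \<delta> K" "y \<in> ulam_floating_body \<delta> K" and ab: "0 \<le> a" "0 \<le> b" "a + b = 1"
  obtain f g where f: "x = centroid f" "admissible f" and g: "y = centroid g" "admissible g"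
    using xy by (auto simp: ulam_floating_body_eq)
  let ?h = "\<lambda>y. a * f y + b * g y"
  have [measurable]: "f \<in> borel_measurable \<mu>" "g \<in> borel_measurable \<mu>"
    using f g by (auto simp: admissible_def)
  have "?h y \<in> {0..1}" if "y \<in> K" for y
  proof -
    have fg: "0 \<le> f y" "f y \<le> 1" "0 \<le> g y" "g y \<le> 1"
      using f g that by (auto simp: admissible_def Pi_iff)
    have "?h y \<le> a * 1 + b * 1" using fg ab by (intro add_mono mult_left_mono) auto
    then show ?thesis using fg ab by simp
  qed
  moreover have "(LINT y|\<mu>. ?h y) = a * (LINT y|\<mu>. f y) + b * (LINT y|\<mu>. g y)"
    using admissible_integrable_real[OF f(2)] admissible_integrable_real[OF g(2)]
    by (subst Bochner_Integration.integral_add) auto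
  then have "(LINT y|\<mu>. ?h y) = a * \<delta> + b * \<delta>"
    using f(2) g(2) by (simp add: admissible_def)
  then have "(LINT y|\<mu>. ?h y) = \<delta>" using ab by (simp add: distrib_right[symmetric])
  ultimately have h: "admissible ?h" by (auto simp: admissible_def)
  have "(LINT y|\<mu>. ?h y *\<^sub>R y) = (LINT y|\<mu>. a *\<^sub>R (f y *\<^sub>R y) + b *\<^sub>R (g y *\<^sub>R y))"
    by (simp add: scaleR_add_left)
  also have "\<dots> = a *\<^sub>R (LINT y|\<mu>. f y *\<^sub>R y) + b *\<^sub>R (LINT y|\<mu>. g y *\<^sub>R y)"
    using Bochner_Integration.integral_add[OF integrable_scaleR_right[OF admissible_integrable_ident[OF f(2)]]
        integrable_scaleR_right[OF admissible_integrable_ident[OF g(2)]], of a b]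
    by (simp only: integral_scaleR_right)
  finally have "centroid ?h = a *\<^sub>R x + b *\<^sub>R y"
    unfolding f g centroid_def by (simp add: scaleR_add_right mult.commute)
  with h show "a *\<^sub>R x + b *\<^sub>R y \<in> ulam_floating_body \<delta> K"
    unfolding ulam_floating_body_eq mem_Collect_eq by (intro exI[of _ ?h]) auto
qed

lemma bounded_ulam: "bounded (ulam_floating_body \<delta> K)"
proof -
  obtain B where B: "B > 0" "\<And>y. y \<in> K \<Longrightarrow> norm y \<le> B" using bounded_K by blast
  have "norm (centroid f) \<le> B" if f: "admissible f" for f
  proof -
    have "norm (LINT y|\<mu>. f y *\<^sub>R y) \<le> (LINT y|\<mu>. norm (f y *\<^sub>R y))" by (rule integral_norm_bound)
    also have "\<dots> \<le> (LINT y|\<mu>. f y * B)"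
    proof (rule integral_mono)
      show "integrable \<mu> (\<lambda>y. norm (f y *\<^sub>R y))" by (intro integrable_norm admissible_integrable_ident f)
      show "integrable \<mu> (\<lambda>y. f y * B)" using admissible_integrable_real[OF f] by simp
      fix y assume "y \<in> space \<mu>"
      then show "norm (f y *\<^sub>R y) \<le> f y * B"
        using B f by (auto simp: admissible_def Pi_iff mult_left_mono)
    qed
    also have "\<dots> = \<delta> * B" using f by (simp add: admissible_def)
    finally show ?thesis using \<delta>_pos by (simp add: centroid_def field_simps)
  qed
  then show ?thesis by (auto simp: bounded_iff ulam_floating_body_eq)
qed

text \<open>Stability in the bathtub principle: only a thin slab around the cutting hyperplane,
  whose volume is small, is not controlled by the deficit. This replaces a weak compactness argument
  for the closedness of the floating body.\<close>

lemma centroid_cap_stable: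
  assumes u: "u \<noteq> 0" and vol: "measure lebesgue (cap K u t) = \<delta>" and e: "e > 0"
  shows "\<exists>d>0. \<forall>f. admissible f \<longrightarrow> u \<bullet> centroid (indicator (cap K u t)) - u \<bullet> centroid f < d \<longrightarrow>
    norm (centroid (indicator (cap K u t)) - centroid f) < e"
proof -
  let ?c = "indicator (cap K u t) :: 'a \<Rightarrow> real"
  note c = admissible_cap[OF vol]
  obtain B where B: "B > 0" "\<And>y. y \<in> K \<Longrightarrow> norm y \<le> B" using bounded_K by blast
  \<comment> \<open>The densities will differ in L1 by less than 3 \<epsilon>: 2 \<epsilon> from the
    slab and \<epsilon> from its complement. The centroids then differ by less than 3 \<epsilon> B /
    \<delta>, which the 4 keeps below e.\<close>
  define \<epsilon> where "\<epsilon> = e * \<delta> / (4 * B)"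
  have \<epsilon>: "\<epsilon> > 0" using e B \<delta>_pos by (simp add: \<epsilon>_def)
  have "isCont (\<lambda>s. measure lebesgue (cap K u s)) t" by (rule continuous_cap_volume[OF u])
  then obtain r where r: "r > 0" "\<And>s. \<bar>s - t\<bar> < r \<Longrightarrow> \<bar>measure lebesgue (cap K u s) - measure lebesgue (cap K u t)\<bar> < \<epsilon>"
    using \<epsilon> unfolding continuous_at_eps_delta dist_real_def by blast
  define s where "s = r / 2"
  have s: "s > 0" "s < r" using r(1) by (auto simp: s_def)
  let ?S = "cap K u (t - s) - cap K u (t + s)"
  have sub: "cap K u (t + s) \<subseteq> cap K u (t - s)" using s by (auto simp: cap_def)
  have intc: "integrable \<mu> (indicator (cap K u x) :: 'a \<Rightarrow> real)" for x
    by (intro integrable_\<mu>[where B = 1] borel_measurable_\<mu>) auto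
  have indS: "indicator ?S y = (indicator (cap K u (t - s)) y - indicator (cap K u (t + s)) y :: real)" for y
    using sub by (auto simp: indicator_def)
  have intS: "integrable \<mu> (indicator ?S :: 'a \<Rightarrow> real)"
    unfolding indS[abs_def] by (intro Bochner_Integration.integrable_diff intc)
  have "(LINT y|\<mu>. indicator ?S y :: real) = measure lebesgue (cap K u (t - s)) - measure lebesgue (cap K u (t + s))"
    unfolding indS integral_indicator_cap[symmetric] by (intro Bochner_Integration.integral_diff intc)
  also have "\<dots> < 2 * \<epsilon>" using r(2)[of "t - s"] r(2)[of "t + s"] s by (simp add: abs_less_iff)
  finally have volS: "(LINT y|\<mu>. indicator ?S y :: real) < 2 * \<epsilon>" .
  \<comment> \<open>Off the slab |u . y - t| is at least s, so a deficit below d leaves L1 mass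
    below d \<delta> / s = \<epsilon> there.\<close>
  define d where "d = \<epsilon> * s / \<delta>"
  have d: "d > 0" using \<epsilon> s \<delta>_pos by (simp add: d_def)
  have "norm (centroid ?c - centroid f) < e"
    if f: "admissible f" and gap: "u \<bullet> centroid ?c - u \<bullet> centroid f < d" for f
  proof -
    let ?g = "\<lambda>y. \<bar>?c y - f y\<bar>" and ?h = "\<lambda>y. \<bar>?c y - f y\<bar> * \<bar>u \<bullet> y - t\<bar>"
    note D = cap_deficit[OF f vol]
    have H: "(LINT y|\<mu>. ?h y) < \<epsilon> * s"
      using gap \<delta>_pos unfolding D(2) d_def by (simp add: divide_less_cancel)
    have intg: "integrable \<mu> ?g"
      by (intro Bochner_Integration.integrable_abs Bochner_Integration.integrable_diff
          admissible_integrable_real c f)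
    have "(LINT y|\<mu>. ?g y) \<le> (LINT y|\<mu>. indicator ?S y + ?h y / s)"
    proof (rule integral_mono[OF intg])
      show "integrable \<mu> (\<lambda>y. indicator ?S y + ?h y / s)"
        using D(1) intS by (intro Bochner_Integration.integrable_add) auto
      fix y assume "y \<in> space \<mu>"
      then have y: "y \<in> K" by simp
      then have f01: "0 \<le> f y" "f y \<le> 1" using f by (auto simp: admissible_def Pi_iff)
      show "?g y \<le> indicator ?S y + ?h y / s"
      proof (cases "y \<in> ?S")
        case True
        moreover have "?g y \<le> 1" using f01 by (auto simp: indicator_def)
        moreover have "?h y / s \<ge> 0" using s by simp
        ultimately show ?thesis by simp
      next
        case False
        then have "s \<le> \<bar>u \<bullet> y - t\<bar>" using y by (auto simp: cap_def)
        then have "?g y * s \<le> ?h y" by (intro mult_left_mono) auto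
        then show ?thesis using s False by (simp add: pos_le_divide_eq)
      qed
    qed
    also have "\<dots> = (LINT y|\<mu>. indicator ?S y) + (LINT y|\<mu>. ?h y) / s"
      using D(1) intS by (subst Bochner_Integration.integral_add) auto
    also have "\<dots> < 2 * \<epsilon> + \<epsilon>"
      using volS H s by (intro add_strict_mono) (auto simp: pos_divide_less_eq)
    finally have G: "(LINT y|\<mu>. ?g y) < 3 * \<epsilon>" by simp
    have ints: "integrable \<mu> (\<lambda>y. ?c y *\<^sub>R y)" "integrable \<mu> (\<lambda>y. f y *\<^sub>R y)"
      by (intro admissible_integrable_ident c f)+
    have "centroid ?c - centroid f = (1 / \<delta>) *\<^sub>R (LINT y|\<mu>. ?c y *\<^sub>R y - f y *\<^sub>R y)"
      unfolding centroid_def using ints by (simp add: scaleR_diff_right)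
    then have "norm (centroid ?c - centroid f) = norm (LINT y|\<mu>. ?c y *\<^sub>R y - f y *\<^sub>R y) / \<delta>"
      using \<delta>_pos by simp
    also have "norm (LINT y|\<mu>. ?c y *\<^sub>R y - f y *\<^sub>R y) \<le> (LINT y|\<mu>. ?g y * B)"
    proof (rule order_trans[OF integral_norm_bound integral_mono])
      show "integrable \<mu> (\<lambda>y. norm (?c y *\<^sub>R y - f y *\<^sub>R y))"
        by (intro integrable_norm Bochner_Integration.integrable_diff ints)
      show "integrable \<mu> (\<lambda>y. ?g y * B)" using intg by simp
      fix y assume "y \<in> space \<mu>"
      then have "norm y \<le> B" using B by simp
      then show "norm (?c y *\<^sub>R y - f y *\<^sub>R y) \<le> ?g y * B"
        unfolding scaleR_diff_left[symmetric] norm_scaleR by (intro mult_left_mono) auto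
    qed
    also have "(LINT y|\<mu>. ?g y * B) = (LINT y|\<mu>. ?g y) * B" by simp
    also have "(LINT y|\<mu>. ?g y) * B / \<delta> < 3 * \<epsilon> * B / \<delta>"
      using G B \<delta>_pos by (intro divide_strict_right_mono mult_strict_right_mono)
    also have "3 * \<epsilon> * B / \<delta> \<le> e" using e B \<delta>_pos by (simp add: \<epsilon>_def)
    finally show ?thesis using \<delta>_pos by (simp add: divide_right_mono)
  qed
  with d show ?thesis by blast
qed

text \<open>Uniqueness of the maximizer is stated on the closure because closedness is to be derived
  from it: an approximating centroid has small deficit, and stability puts it near the centroid of
  the cap.\<close>

lemma closure_ulam_maximizer:
  assumes u: "u \<noteq> 0" and vol: "measure lebesgue (cap K u t) = \<delta>"
    and z: "z \<in> closure (ulam_floating_body \<delta> K)"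
    and ge: "u \<bullet> centroid (indicator (cap K u t)) \<le> u \<bullet> z"
  shows "z = centroid (indicator (cap K u t))"
proof (rule ccontr)
  let ?c = "centroid (indicator (cap K u t))"
  assume ne: "z \<noteq> ?c"
  define e where "e = dist z ?c / 2"
  have e: "e > 0" using ne by (simp add: e_def)
  obtain d where d: "d > 0" "\<And>f. admissible f \<Longrightarrow> u \<bullet> ?c - u \<bullet> centroid f < d \<Longrightarrow> norm (?c - centroid f) < e"
    using centroid_cap_stable[OF u vol e] by blast
  define r where "r = min e (d / norm u)"
  have r: "r > 0" using e d u by (simp add: r_def)
  obtain f where f: "admissible f" "dist (centroid f) z < r"
    using z r unfolding closure_approachable ulam_floating_body_eq by blast
  have "u \<bullet> z - u \<bullet> centroid f \<le> norm u * norm (z - centroid f)"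
    by (simp add: inner_diff_right[symmetric] norm_cauchy_schwarz)
  also have "\<dots> < norm u * (d / norm u)"
    using f(2) u by (intro mult_strict_left_mono) (auto simp: r_def dist_norm norm_minus_commute)
  also have "\<dots> = d" using u by simp
  finally have "norm (?c - centroid f) < e" using ge by (intro d(2) f) linarith
  then have "dist z ?c < e + e"
    using f(2) dist_triangle[of z ?c "centroid f"] by (auto simp: r_def dist_norm norm_minus_commute)
  then show False by (simp add: e_def)
qed

lemma ulam_supporting_point:
  assumes "z \<in> closure (ulam_floating_body \<delta> K)" "u \<noteq> 0"
    and "\<And>y. y \<in> ulam_floating_body \<delta> K \<Longrightarrow> u \<bullet> y \<le> u \<bullet> z" "measure lebesgue (cap K u t) = \<delta>"
  shows "z = centroid (indicator (cap K u t))"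
  using assms centroid_cap_mem by (intro closure_ulam_maximizer) auto

text \<open>In a hyperplane orthogonal to a, the cap centroids for a and - a would have the same
  value under a, and uniqueness of normals would make - a a positive multiple of a.\<close>

lemma interior_ulam: "interior (ulam_floating_body \<delta> K) \<noteq> {}"
proof
  assume "interior (ulam_floating_body \<delta> K) = {}"
  then obtain a b where a: "a \<noteq> 0" "ulam_floating_body \<delta> K \<subseteq> {x. a \<bullet> x = b}"
    using empty_interior_subset_hyperplane[OF convex_ulam] by blast
  obtain t t' where t: "measure lebesgue (cap K a t) = \<delta>" "measure lebesgue (cap K (- a) t') = \<delta>"
    using cap_volume_exists[of a] cap_volume_exists[of "- a"] a(1) by auto
  have "a \<bullet> centroid (indicator (cap K a t)) = b" "a \<bullet> centroid (indicator (cap K (- a) t')) = b"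
    using a(2) centroid_cap_mem t by blast+
  then obtain c where "c > 0" "- a = c *\<^sub>R a"
    using cap_normal_unique[OF a(1) _ t] a(1) by auto
  then have "(c + 1) *\<^sub>R a = 0" by (metis add.commute neg_eq_iff_add_eq_0 scaleR_left_distrib scaleR_one)
  with \<open>c > 0\<close> a(1) show False by simp
qed

text \<open>Convexity puts the relative interior of the closure into the set; any other point of the
  closure is supported by a hyperplane and hence is the centroid of a cap.\<close>

lemma closed_ulam: "closed (ulam_floating_body \<delta> K)"
proof -
  let ?M = "ulam_floating_body \<delta> K"
  have "z \<in> ?M" if z: "z \<in> closure ?M" for z
  proof (cases "z \<in> rel_interior (closure ?M)")
    case True
    then show ?thesis
      using convex_rel_interior_closure[OF convex_ulam] rel_interior_subset by blast
  next
    case False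
    obtain a where a: "\<And>y. y \<in> closure ?M \<Longrightarrow> a \<bullet> z \<le> a \<bullet> y" "a \<noteq> 0"
      using supporting_hyperplane_rel_boundary[OF convex_closure[OF convex_ulam] z False] by metis
    obtain t where t: "measure lebesgue (cap K (- a) t) = \<delta>"
      using cap_volume_exists[of "- a"] a(2) by auto
    have "z = centroid (indicator (cap K (- a) t))"
      using a closure_subset by (intro ulam_supporting_point[OF z _ _ t]) auto
    then show ?thesis using centroid_cap_mem[OF t] by simp
  qed
  then have "closure ?M \<subseteq> ?M" by blast
  then show ?thesis by (simp add: closure_subset_eq)
qed

lemma compact_ulam: "compact (ulam_floating_body \<delta> K)"
  using bounded_ulam closed_ulam by (simp add: compact_eq_bounded_closed)

end

subsection \<open>Radial functions with moving centre\<close>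

lemma radial_function_scaleR:
  fixes K :: "'a::euclidean_space set"
  assumes K: "compact K" "convex K" and v: "v \<in> interior K" and x: "x \<noteq> 0" and c: "c > 0"
  shows "radial_function K v (c *\<^sub>R x) = radial_function K v x / c"
  using radial_function_props[OF K(1) v x] frontier_radial_function[OF K(1) v x] x c
  by (intro radial_function_eqI[OF K v]) auto

text \<open>The local extensions g granted by \<open>Ck_on\<close> are arbitrary off the sphere.
  Only g(x/|x|) / |x| is used, which equals the radial function because that is homogeneous of
  degree -1.\<close>

lemma Ck_on_sphere_radial_function:
  fixes K :: "'a::euclidean_space set"
  assumes K: "compact K" "convex K" and v: "v \<in> interior K"
    and C: "Ck_on k (radial_function K v) (sphere 0 1)"
  shows "Ck_on_open k (radial_function K v) (- {0})"
proof (rule Ck_on_open_local)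
  fix x0 :: 'a assume x0: "x0 \<in> - {0}"
  have op: "open (- {0::'a})" by auto
  let ?s = "\<lambda>x::'a. inverse (norm x) *\<^sub>R x"
  have sph: "?s x \<in> sphere 0 1" if "x \<in> - {0}" for x using that by simp
  have s: "Ck_on_open k ?s (- {0})"
    by (rule Ck_on_open_scaleR[OF op Ck_on_open_inverse[OF op _ Ck_on_open_norm] Ck_on_open_ident[OF op]]) auto
  have "\<exists>U g. open U \<and> ?s x0 \<in> U \<and> Ck_on_open k g U \<and> (\<forall>y\<in>sphere 0 1 \<inter> U. g y = radial_function K v y)"
    by (rule bspec[OF C[unfolded Ck_on_def] sph[OF x0]])
  then obtain U g where U: "open U" "?s x0 \<in> U" "Ck_on_open k g U"
    and g: "\<forall>y\<in>sphere 0 1 \<inter> U. g y = radial_function K v y"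
    by (elim exE conjE)
  define V where "V = - {0} \<inter> ?s -` U"
  have V: "open V" unfolding V_def
    by (rule continuous_open_preimage[OF Ck_on_open_imp_continuous_on[OF s] op U(1)])
  have "V \<subseteq> - {0}" by (auto simp: V_def)
  note sub = Ck_on_open_subset[OF _ this]
  have "Ck_on_open k (\<lambda>x. g (?s x)) V"
    by (rule Ck_on_open_compose[OF V U(1) _ U(3) sub[OF s]]) (auto simp: V_def)
  then have C': "Ck_on_open k (\<lambda>x. inverse (norm x) * g (?s x)) V"
    by (rule Ck_on_open_mult[OF V sub[OF Ck_on_open_inverse[OF op _ Ck_on_open_norm]], rotated]) auto
  have eq: "radial_function K v x = inverse (norm x) * g (?s x)" if "x \<in> V" for x
  proof -
    have x: "x \<noteq> 0" and "?s x \<in> U" using that by (auto simp: V_def)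
    then have "g (?s x) = radial_function K v x * norm x"
      using bspec[OF g, of "?s x"] sph[of x] radial_function_scaleR[OF K v x, of "inverse (norm x)"]
      by (simp add: divide_inverse)
    then show ?thesis using x by simp
  qed
  have "Ck_on_open k (radial_function K v) V"
    by (rule iffD2[OF Ck_on_open_cong[OF V eq] C'])
  then show "\<exists>V. open V \<and> x0 \<in> V \<and> Ck_on_open k (radial_function K v) V"
    using V x0 U(2) by (intro exI[of _ V]) (auto simp: V_def)
qed

text \<open>The boundary is the level set of the gauge \<open>1 / \<rho>\<close>, and a ray from an interior point
  crosses it transversally because the supporting functional at the exit point increases along the ray;
  so the inverse function theorem applies to \<open>(p, z, r) \<mapsto> (p, z, gauge (p + r z))\<close>.\<close>

lemma Ck_on_open_radial_function_moving:
  fixes K :: "'a::euclidean_space set"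
  assumes K: "compact K" "convex K" and v: "v \<in> interior K"
    and \<rho>: "Ck_on_open (Suc k) (radial_function K v) (- {0})"
  shows "Ck_on_open (Suc k) (\<lambda>q. radial_function K (fst q) (snd q)) (interior K \<times> (- {0}))"
proof (rule Ck_on_open_local)
  fix q0 :: "'a \<times> 'a" assume "q0 \<in> interior K \<times> (- {0})"
  then obtain p0 z0 where q0: "q0 = (p0, z0)" and p0: "p0 \<in> interior K" and z0: "z0 \<noteq> 0" by auto
  define g where "g = (\<lambda>x. inverse (radial_function K v (x - v)))"
  have opv: "open (- {v})" by auto
  have g: "Ck_on_open (Suc k) g (- {v})"
    unfolding g_def
  proof (rule Ck_on_open_inverse[OF opv])
    show "Ck_on_open (Suc k) (\<lambda>x. radial_function K v (x - v)) (- {v})"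
      by (rule Ck_on_open_compose[OF opv _ _ \<rho>])
         (auto intro!: Ck_on_open_diff Ck_on_open_ident Ck_on_open_const opv)
    show "radial_function K v (x - v) \<noteq> 0" if "x \<in> - {v}" for x
      using radial_function_props(1)[OF K(1) v, of "x - v"] that by auto
  qed
  let ?Dg = "\<lambda>x. frechet_derivative g (at x)"
  define Y where "Y = (\<lambda>q :: 'a \<times> 'a \<times> real. fst q + snd (snd q) *\<^sub>R fst (snd q))"
  have contY: "continuous_on S Y" for S unfolding Y_def by (intro continuous_intros)
  define W0 where "W0 = Y -` (- {v})"
  have W0: "open W0" unfolding W0_def by (rule open_vimage[OF opv contY])
  have Y: "Ck_on_open m Y W0" for m
    unfolding Y_def
    by (intro Ck_on_open_add Ck_on_open_scaleR Ck_on_open_fst Ck_on_open_snd Ck_on_open_ident W0)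
  have YW: "Y \<in> W0 \<rightarrow> - {v}" by (auto simp: W0_def)
  have Dz: "continuous_on W0 (\<lambda>q. ?Dg (Y q) (fst (snd q)))"
    by (rule Ck_on_open_imp_continuous_on[OF Ck_on_open_derivative_compose[OF W0 opv YW g Y]])
       (intro Ck_on_open_fst Ck_on_open_snd Ck_on_open_ident W0)
  \<comment> \<open>The open set where the gauge is differentiable at p + r z and the ray is
    transversal, with p interior and r positive; transversality is exactly injectivity of the
    derivative of \<Theta>.\<close>
  define W where "W = (W0 \<inter> (\<lambda>q. ?Dg (Y q) (fst (snd q))) -` (- {0})) \<inter> (interior K \<times> (UNIV \<times> {0<..}))"
  have W: "open W"
    unfolding W_def by (intro open_Int continuous_open_preimage[OF Dz W0] open_Times open_interior) auto
  have WW0: "W \<subseteq> W0" by (auto simp: W_def)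
  define \<Theta> where "\<Theta> = (\<lambda>q. (fst q, fst (snd q), g (Y q)))"
  have \<Theta>: "Ck_on_open (Suc k) \<Theta> W"
    unfolding \<Theta>_def
    by (rule Ck_on_open_subset[OF _ WW0])
       (intro Ck_on_open_Pair Ck_on_open_fst Ck_on_open_snd Ck_on_open_ident W0 Ck_on_open_compose[OF W0 opv YW g Y])
  have inj: "inj (frechet_derivative \<Theta> (at q))" if q: "q \<in> W" for q
  proof -
    have Yv: "Y q \<in> - {v}" using q by (auto simp: W_def W0_def)
    have dY: "(Y has_derivative (\<lambda>h. fst h + (snd (snd q) *\<^sub>R fst (snd h) + snd (snd h) *\<^sub>R fst (snd q)))) (at q)"
      unfolding Y_def by (auto intro!: derivative_eq_intros)
    have dg: "(g has_derivative ?Dg (Y q)) (at (Y q))"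
      by (rule Ck_on_open_Suc_derivative[OF g Yv])
    have "(\<Theta> has_derivative (\<lambda>h. (fst h, fst (snd h),
        ?Dg (Y q) (fst h + (snd (snd q) *\<^sub>R fst (snd h) + snd (snd h) *\<^sub>R fst (snd q)))))) (at q)"
      unfolding \<Theta>_def
      by (intro has_derivative_Pair has_derivative_compose[OF dY dg])
         (auto intro!: derivative_eq_intros)
    then have D: "frechet_derivative \<Theta> (at q) = (\<lambda>h. (fst h, fst (snd h),
        ?Dg (Y q) (fst h + (snd (snd q) *\<^sub>R fst (snd h) + snd (snd h) *\<^sub>R fst (snd q)))))"
      by (rule frechet_derivative_at[symmetric])
    have lin: "linear (frechet_derivative \<Theta> (at q))"
      using Ck_on_open_Suc_derivative[OF \<Theta> q] has_derivative_linear by blast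
    have lg: "linear (?Dg (Y q))" using dg has_derivative_linear by blast
    have "h = 0" if "frechet_derivative \<Theta> (at q) h = 0" for h
    proof -
      obtain a b c where h: "h = (a, b, c)" by (cases h) auto
      have ab: "a = 0" "b = 0" and "?Dg (Y q) (c *\<^sub>R fst (snd q)) = 0"
        using that unfolding D h by (auto simp: zero_prod_def)
      then have "c * ?Dg (Y q) (fst (snd q)) = 0" using linear_scale[OF lg] by simp
      then show ?thesis using q ab by (auto simp: h W_def zero_prod_def)
    qed
    then show ?thesis using lin by (simp add: linear_injective_0)
  qed
  define r0 where "r0 = radial_function K p0 z0"
  define y0 where "y0 = p0 + r0 *\<^sub>R z0"
  have r0: "r0 > 0" and y0K: "y0 \<in> K" and y0i: "y0 \<notin> interior K"
    using radial_function_props[OF K(1) p0 z0] frontier_radial_function[OF K(1) p0 z0]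
    by (auto simp: r0_def y0_def)
  have y0v: "y0 \<noteq> v" using v y0i by auto
  then have y0v': "y0 - v \<noteq> 0" by simp
  have \<rho>1: "radial_function K v (y0 - v) = 1"
    using y0K y0i by (intro radial_function_eqI[OF K v y0v']) auto
  obtain w where w: "w \<in> centered_polar K v" "(y0 - v) \<bullet> w = 1"
    using centered_polar_normal_exists[OF K v y0v'] \<rho>1 by auto
  \<comment> \<open>The gauge dominates the polar functional w and touches it at y0, so the
    difference has a minimum there and the derivatives coincide.\<close>
  have Dg0: "?Dg y0 = (\<lambda>h. h \<bullet> w)"
  proof -
    have "((\<lambda>y. g y - (y - v) \<bullet> w) has_derivative (\<lambda>h. ?Dg y0 h - h \<bullet> w)) (at y0)"
      using Ck_on_open_Suc_derivative[OF g, of y0] y0v by (auto intro!: derivative_eq_intros)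
    moreover have "g y0 - (y0 - v) \<bullet> w \<le> g y - (y - v) \<bullet> w" if "y \<in> - {v}" for y
    proof -
      have nz: "y - v \<noteq> 0" using that by auto
      have "radial_function K v (y - v) * ((y - v) \<bullet> w) \<le> 1"
        by (rule centered_polar_radial_le[OF K(1) v nz w(1)])
      then have "(y - v) \<bullet> w \<le> g y"
        using radial_function_props(1)[OF K(1) v nz] by (simp add: g_def field_simps)
      then show ?thesis using w(2) \<rho>1 by (simp add: g_def)
    qed
    ultimately have "(\<lambda>h. ?Dg y0 h - h \<bullet> w) = (\<lambda>h. 0)"
      using differential_zero_maxmin[of y0 "- {v}"] y0v opv by blast
    then show ?thesis by (auto simp: fun_eq_iff)
  qed
  have z0w: "z0 \<bullet> w \<noteq> 0"
  proof -
    have w0: "w \<noteq> 0" using w(2) by auto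
    obtain e where e: "e > 0" "ball p0 e \<subseteq> K" using p0 by (auto simp: mem_interior)
    have "p0 + (e / (2 * norm w)) *\<^sub>R w \<in> K" using e w0 by (intro subsetD[OF e(2)]) (simp add: dist_norm)
    then have "(p0 + (e / (2 * norm w)) *\<^sub>R w - v) \<bullet> w \<le> 1" using w(1) by (auto simp: centered_polar_def)
    then have "(p0 - v) \<bullet> w + (e / (2 * norm w)) * (w \<bullet> w) \<le> 1" by (simp add: inner_add_left inner_diff_left)
    moreover have "(e / (2 * norm w)) * (w \<bullet> w) > 0" using e w0 by simp
    ultimately have "(p0 - v) \<bullet> w < 1" by linarith
    moreover have "(y0 - v) \<bullet> w = (p0 - v) \<bullet> w + r0 * (z0 \<bullet> w)"
      by (simp add: y0_def inner_add_left inner_diff_left)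
    ultimately show ?thesis using w(2) by auto
  qed
  have q0W: "(p0, z0, r0) \<in> W"
    using y0v Dg0 z0w p0 r0 by (simp add: W_def W0_def Y_def y0_def)
  obtain U' V \<psi> where U': "open U'" "U' \<subseteq> W" "(p0, z0, r0) \<in> U'" and V: "open V"
    and hom: "homeomorphism U' V \<Theta> \<psi>" and \<psi>: "Ck_on_open (Suc k) \<psi> V"
    using Ck_on_open_inverse_function[OF W \<Theta> inj q0W] by metis
  define \<iota> where "\<iota> = (\<lambda>q :: 'a \<times> 'a. (fst q, snd q, 1::real))"
  have \<iota>: "Ck_on_open (Suc k) \<iota> S" if "open S" for S
    unfolding \<iota>_def by (intro Ck_on_open_Pair Ck_on_open_fst Ck_on_open_snd Ck_on_open_ident Ck_on_open_const that)
  define N where "N = \<iota> -` V"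
  have N: "open N" unfolding N_def \<iota>_def by (intro open_vimage V continuous_intros)
  have "\<Theta> (p0, z0, r0) \<in> V" using hom U'(3) by (auto simp: homeomorphism_def)
  moreover have "\<Theta> (p0, z0, r0) = \<iota> q0"
    using \<rho>1 by (simp add: \<Theta>_def \<iota>_def q0 Y_def y0_def[symmetric] g_def)
  ultimately have q0N: "q0 \<in> N" by (simp add: N_def)
  have C: "Ck_on_open (Suc k) (\<lambda>q. snd (snd (\<psi> (\<iota> q)))) N"
    by (intro Ck_on_open_snd N Ck_on_open_compose[OF N V _ \<psi> \<iota>[OF N]]) (auto simp: N_def)
  \<comment> \<open>The inverse at gauge value 1 returns some r > 0 with p + r z on the boundary,
    and a ray crosses the boundary only once.\<close>
  have eq: "radial_function K (fst q) (snd q) = snd (snd (\<psi> (\<iota> q)))" if "q \<in> N" for q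
  proof -
    have inU: "\<psi> (\<iota> q) \<in> U'" and eq: "\<Theta> (\<psi> (\<iota> q)) = \<iota> q"
      using hom that by (auto simp: N_def homeomorphism_def)
    obtain p z r where \<psi>q: "\<psi> (\<iota> q) = (p, z, r)" by (cases "\<psi> (\<iota> q)") auto
    from eq have pz: "fst q = p" "snd q = z" and g1: "g (p + r *\<^sub>R z) = 1"
      unfolding \<psi>q by (auto simp: \<Theta>_def \<iota>_def Y_def)
    have inW: "(p, z, r) \<in> W" using inU U'(2) \<psi>q by auto
    then have p: "p \<in> interior K" and r: "r > 0" and nv: "p + r *\<^sub>R z - v \<noteq> 0"
      and nz: "?Dg (Y (p, z, r)) z \<noteq> 0" by (auto simp: W_def W0_def Y_def)
    have "linear (?Dg (Y (p, z, r)))"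
      using inW Ck_on_open_Suc_derivative[OF g] by (intro has_derivative_linear) (auto simp: W_def W0_def)
    with nz have z: "z \<noteq> 0" using linear_0 by force
    have "radial_function K v (p + r *\<^sub>R z - v) = 1" using g1 by (simp add: g_def)
    then have "p + r *\<^sub>R z \<in> K" "p + r *\<^sub>R z \<notin> interior K"
      using radial_function_props(2)[OF K(1) v nv] frontier_radial_function[OF K(1) v nv] by auto
    from radial_function_eqI[OF K p z r this] show ?thesis by (simp add: pz \<psi>q)
  qed
  have "Ck_on_open (Suc k) (\<lambda>q. radial_function K (fst q) (snd q)) N"
    by (rule iffD2[OF Ck_on_open_cong[OF N eq] C])
  with N q0N show "\<exists>N. open N \<and> q0 \<in> N \<and> Ck_on_open (Suc k) (\<lambda>q. radial_function K (fst q) (snd q)) N" by blast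
qed

subsection \<open>Cap integrals in polar form\<close>

lemma radial_function_le_iff:
  fixes K :: "'a::euclidean_space set"
  assumes K: "compact K" "convex K" and p: "p \<in> interior K" and z: "z \<noteq> 0" and r: "r \<ge> 0"
  shows "p + r *\<^sub>R z \<in> K \<longleftrightarrow> r \<le> radial_function K p z"
proof
  let ?R = "radial_function K p z"
  note R = radial_function_props[OF K(1) p z]
  show "p + r *\<^sub>R z \<in> K \<Longrightarrow> r \<le> ?R" using R(3) r by auto
  assume le: "r \<le> ?R"
  have "(1 - r / ?R) *\<^sub>R p + (r / ?R) *\<^sub>R (p + ?R *\<^sub>R z) \<in> K"
    using K(2) R(1,2) r le p interior_subset by (intro convexD) auto
  also have "(1 - r / ?R) *\<^sub>R p + (r / ?R) *\<^sub>R (p + ?R *\<^sub>R z) = p + r *\<^sub>R z"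
    using R(1) by (simp add: algebra_simps)
  finally show "p + r *\<^sub>R z \<in> K" .
qed

definition half_annulus :: "'a::euclidean_space \<Rightarrow> 'a set" where
  "half_annulus u = {z. 1 \<le> norm z \<and> norm z \<le> 2 \<and> 0 \<le> u \<bullet> z}"

lemma compact_half_annulus: "compact (half_annulus u)"
proof -
  have "half_annulus u = cball 0 2 \<inter> ({z. 1 \<le> norm z} \<inter> {z. 0 \<le> u \<bullet> z})"
    by (auto simp: half_annulus_def)
  then show ?thesis
    by (auto intro!: compact_Int_closed closed_Int closed_Collect_le continuous_intros)
qed

lemma half_annulus_nonzero: "z \<in> half_annulus u \<Longrightarrow> z \<noteq> 0"
  by (auto simp: half_annulus_def)

text \<open>With p on the cutting hyperplane, p + r z lies in the cap iff r <= R z and 0 <= u . z,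
  so the radial integral of r^(n-1) (a + r z . b) runs over [0, R z] and is explicit. Affine
  integrands cover volume and moment at once; they are nonnegative so that the polar formula for
  nonnegative integrals applies.\<close>

lemma cap_integral_polar_nonneg:
  fixes K :: "'a::euclidean_space set" and p u b :: 'a and a :: real
  defines "n \<equiv> DIM('a)" and "R \<equiv> radial_function K p"
  assumes K: "compact K" "convex K" and p: "p \<in> interior K"
    and R: "continuous_on (- {0}) R" and nonneg: "\<And>y. y \<in> K \<Longrightarrow> 0 \<le> a + (y - p) \<bullet> b"
  shows "ln 2 * (LINT y:cap K u (u \<bullet> p)|lborel. a + (y - p) \<bullet> b) =
    (LINT z:half_annulus u|lborel. a * (R z ^ n / n) + (z \<bullet> b) * (R z ^ (n + 1) / (n + 1)))"
proof -
  let ?C = "cap K u (u \<bullet> p)" and ?A = "{z::'a. 1 \<le> norm z \<and> norm z \<le> 2}"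
  let ?f = "\<lambda>x. ennreal (indicator ?C (p + x) * (a + x \<bullet> b))"
  let ?Q = "\<lambda>z. a * (R z ^ n / n) + (z \<bullet> b) * (R z ^ (n + 1) / (n + 1))"
  have n: "n > 0" by (simp add: n_def)
  note Rp = radial_function_props[OF K(1) p, folded R_def]
  have C: "compact ?C" by (rule compact_cap[OF K(1)])
  then have [measurable]: "?C \<in> sets borel" by (rule borel_compact)
  have intC: "set_integrable lborel ?C (\<lambda>y. a + (y - p) \<bullet> b)"
    by (intro set_integrable_compact_continuous C continuous_intros)
  have "(\<integral>\<^sup>+x. ?f x \<partial>lborel) = (\<integral>\<^sup>+y. ennreal (indicator ?C y * (a + (y - p) \<bullet> b)) \<partial>lborel)"
    by (subst nn_integral_lborel_affine[where c = 1 and t = p]) auto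
  also have "\<dots> = ennreal (LINT y:?C|lborel. a + (y - p) \<bullet> b)"
    unfolding set_lebesgue_integral_def real_scaleR_def
    using intC nonneg cap_subset[of K u "u \<bullet> p"] unfolding set_integrable_def
    by (intro nn_integral_eq_integral AE_I2) (auto simp: indicator_def)
  finally have L: "(\<integral>\<^sup>+x. ?f x \<partial>lborel) = ennreal (LINT y:?C|lborel. a + (y - p) \<bullet> b)" .
  have Cpos: "0 \<le> (LINT y:?C|lborel. a + (y - p) \<bullet> b)"
    unfolding set_lebesgue_integral_def using nonneg cap_subset[of K u "u \<bullet> p"]
    by (intro integral_nonneg_AE AE_I2) (auto simp: indicator_def)
  have inner: "(\<integral>\<^sup>+r. indicator {0<..} r * ennreal (r ^ (n - 1)) * ?f (r *\<^sub>R z) \<partial>lborel)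
      = (if 0 \<le> u \<bullet> z then ennreal (?Q z) else 0) \<and> 0 \<le> ?Q z" if z: "z \<noteq> 0" for z
  proof -
    let ?h = "\<lambda>r. r ^ (n - 1) * (a + r * (z \<bullet> b))"
    let ?F = "\<lambda>r. a * (r ^ n / n) + (z \<bullet> b) * (r ^ (n + 1) / (n + 1))"
    have mem: "p + r *\<^sub>R z \<in> ?C \<longleftrightarrow> r \<le> R z \<and> 0 \<le> u \<bullet> z" if "r > 0" for r
      using radial_function_le_iff[OF K p z, of r] that
      by (auto simp: cap_def R_def inner_add_right zero_le_mult_iff)
    have pos: "0 \<le> ?h r" if "r \<in> {0..R z}" for r
      using radial_function_le_iff[OF K p z, of r] that nonneg[of "p + r *\<^sub>R z"] by (simp add: R_def)
    have der: "(?F has_real_derivative ?h r) (at r)" for r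
    proof -
      have d: "((\<lambda>r. r ^ Suc m / Suc m) has_real_derivative r ^ m) (at r)" for m
        using DERIV_cdivide[OF DERIV_pow[of "Suc m"], of "real (Suc m)"] by simp
      have d1: "((\<lambda>r. r ^ n / n) has_real_derivative r ^ (n - 1)) (at r)"
        using d[of "n - 1"] n by simp
      have d2: "((\<lambda>r. r ^ (n + 1) / (n + 1)) has_real_derivative r ^ n) (at r)"
        using d[of n] by simp
      have "?h r = a * r ^ (n - 1) + (z \<bullet> b) * r ^ n"
        unfolding power_minus_mult[OF n, of r, symmetric] by (simp only: algebra_simps)
      with DERIV_add[OF DERIV_cmult[OF d1, of a] DERIV_cmult[OF d2, of "z \<bullet> b"]]
      show ?thesis by simp
    qed
    have FTC: "(\<integral>\<^sup>+r. ennreal (?h r) * indicator {0..R z} r \<partial>lborel) = ennreal (?F (R z) - ?F 0)"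
      using Rp(1)[OF z] pos der by (intro nn_integral_FTC_Icc) auto
    have F0: "?F 0 = 0" using n by simp
    have mono: "0 \<le> ?F (R z)"
    proof -
      have "?F 0 \<le> ?F (R z)"
        using Rp(1)[OF z] pos der by (intro DERIV_nonneg_imp_nondecreasing[of 0 "R z" ?F]) (auto intro!: exI)
      then show ?thesis unfolding F0 .
    qed
    have "(\<integral>\<^sup>+r. indicator {0<..} r * ennreal (r ^ (n - 1)) * ?f (r *\<^sub>R z) \<partial>lborel)
       = (\<integral>\<^sup>+r. (if 0 \<le> u \<bullet> z then 1 else 0) * (ennreal (?h r) * indicator {0..R z} r) \<partial>lborel)"
    proof (rule nn_integral_cong_AE, use AE_lborel_singleton[of "0::real"] in eventually_elim)
      fix r :: real assume "r \<noteq> 0"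
      show "indicator {0<..} r * ennreal (r ^ (n - 1)) * ?f (r *\<^sub>R z)
         = (if 0 \<le> u \<bullet> z then 1 else 0) * (ennreal (?h r) * indicator {0..R z} r)"
      proof (cases "r > 0")
        case True
        then show ?thesis using mem[OF True] by (auto simp: indicator_def ennreal_mult'[symmetric])
      next
        case False
        with \<open>r \<noteq> 0\<close> show ?thesis by (auto simp: indicator_def)
      qed
    qed
    also have "\<dots> = (if 0 \<le> u \<bullet> z then ennreal (?Q z) else 0)"
      using FTC[unfolded F0 diff_zero] by (subst nn_integral_cmult) auto
    finally show ?thesis using mono by simp
  qed
  have intQ: "set_integrable lborel (half_annulus u) ?Q"
    using n by (intro set_integrable_compact_continuous compact_half_annulus continuous_intros
        continuous_on_subset[OF R]) (auto dest: half_annulus_nonzero)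
  have "ennreal (ln 2) * (\<integral>\<^sup>+x. ?f x \<partial>lborel) =
    (\<integral>\<^sup>+z. indicator ?A z * (\<integral>\<^sup>+r. indicator {0<..} r * ennreal (r ^ (n - 1)) * ?f (r *\<^sub>R z) \<partial>lborel) \<partial>lborel)"
    unfolding n_def by (rule nn_integral_annulus_polar) measurable
  also have "\<dots> = (\<integral>\<^sup>+z. ennreal (indicator (half_annulus u) z * ?Q z) \<partial>lborel)"
  proof (rule nn_integral_cong)
    fix z :: 'a
    show "indicator ?A z * (\<integral>\<^sup>+r. indicator {0<..} r * ennreal (r ^ (n - 1)) * ?f (r *\<^sub>R z) \<partial>lborel)
      = ennreal (indicator (half_annulus u) z * ?Q z)"
    proof (cases "z \<in> ?A")
      case True
      then have "z \<noteq> 0" by auto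
      from inner[OF this] True show ?thesis by (auto simp: indicator_def half_annulus_def)
    next
      case False
      then show ?thesis by (auto simp: indicator_def half_annulus_def)
    qed
  qed
  also have "\<dots> = ennreal (LINT z:half_annulus u|lborel. ?Q z)"
    unfolding set_lebesgue_integral_def real_scaleR_def
    using intQ inner unfolding set_integrable_def
    by (intro nn_integral_eq_integral AE_I2) (auto simp: indicator_def dest!: half_annulus_nonzero)
  finally have "ennreal (ln 2 * (LINT y:?C|lborel. a + (y - p) \<bullet> b)) = ennreal (LINT z:half_annulus u|lborel. ?Q z)"
    using Cpos by (simp add: L ennreal_mult)
  moreover have "0 \<le> (LINT z:half_annulus u|lborel. ?Q z)"
    unfolding set_lebesgue_integral_def using inner
    by (intro integral_nonneg_AE AE_I2) (auto simp: indicator_def dest!: half_annulus_nonzero)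
  ultimately show ?thesis using Cpos by simp
qed

lemma cap_integrals_polar:
  fixes K :: "'a::euclidean_space set" and p u :: 'a
  defines "n \<equiv> DIM('a)" and "R \<equiv> radial_function K p"
  assumes K: "compact K" "convex K" and p: "p \<in> interior K"
    and R: "continuous_on (- {0}) R"
  shows "ln 2 * measure lebesgue (cap K u (u \<bullet> p)) = (LINT z:half_annulus u|lborel. R z ^ n / n)"
    and "ln 2 *\<^sub>R (LINT y:cap K u (u \<bullet> p)|lborel. y - p) =
      (LINT z:half_annulus u|lborel. (R z ^ (n + 1) / (n + 1)) *\<^sub>R z)"
proof -
  let ?C = "cap K u (u \<bullet> p)" and ?D = "half_annulus u"
  have C: "compact ?C" by (rule compact_cap[OF K(1)])
  have mC: "(LINT y:?C|lborel. c) = c * measure lebesgue ?C" for c :: real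
    using C emeasure_compact_finite[OF C]
    by (subst set_integral_const) (auto simp: borel_compact less_top)
  note polar = cap_integral_polar_nonneg[OF K p R[unfolded R_def], folded n_def R_def]
  from polar[of 1 0 u] show vol: "ln 2 * measure lebesgue ?C = (LINT z:?D|lborel. R z ^ n / n)"
    using mC[of 1] by simp
  have contR: "continuous_on ?D R"
    by (rule continuous_on_subset[OF R]) (auto dest: half_annulus_nonzero)
  have n: "n > 0" by (simp add: n_def)
  have i1: "set_integrable lborel ?D (\<lambda>z. R z ^ n / n)" and i2: "set_integrable lborel ?D (\<lambda>z. (R z ^ (n + 1) / (n + 1)) *\<^sub>R z)"
    and i3: "set_integrable lborel ?C (\<lambda>y. y - p)"
    using n by (auto intro!: set_integrable_compact_continuous compact_half_annulus C continuous_intros contR)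
  have inner_C: "(LINT y:?C|lborel. (y - p) \<bullet> b) = (LINT y:?C|lborel. y - p) \<bullet> b" for b
    using integral_inner_left[of b lborel "\<lambda>y. indicator ?C y *\<^sub>R (y - p)"] i3
    by (simp add: set_lebesgue_integral_def set_integrable_def)
  have inner_D: "(LINT z:?D|lborel. (z \<bullet> b) * (R z ^ (n + 1) / (n + 1))) = (LINT z:?D|lborel. (R z ^ (n + 1) / (n + 1)) *\<^sub>R z) \<bullet> b" for b
    using integral_inner_left[of b lborel "\<lambda>z. indicator ?D z *\<^sub>R ((R z ^ (n + 1) / (n + 1)) *\<^sub>R z)"] i2
    by (simp add: set_lebesgue_integral_def set_integrable_def mult_ac)
  \<comment> \<open>Adding B makes every coordinate of y - p nonnegative on K; its contribution
    cancels afterwards by the volume identity.\<close>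
  obtain B where B: "\<And>y. y \<in> K \<Longrightarrow> norm (y - p) \<le> B"
    using compact_imp_bounded[OF compact_translation_subtract[OF K(1), of p]] by (auto simp: bounded_iff)
  show "ln 2 *\<^sub>R (LINT y:?C|lborel. y - p) = (LINT z:?D|lborel. (R z ^ (n + 1) / (n + 1)) *\<^sub>R z)"
  proof (rule euclidean_eqI)
    fix b :: 'a assume b: "b \<in> Basis"
    have "0 \<le> B + (y - p) \<bullet> b" if "y \<in> K" for y
      using Basis_le_norm[OF b, of "y - p"] B[OF that] by linarith
    from polar[OF this, of u]
    have "ln 2 * (LINT y:?C|lborel. B + (y - p) \<bullet> b)
      = (LINT z:?D|lborel. B * (R z ^ n / n) + (z \<bullet> b) * (R z ^ (n + 1) / (n + 1)))" .
    also have "(LINT y:?C|lborel. B + (y - p) \<bullet> b) = B * measure lebesgue ?C + (LINT y:?C|lborel. y - p) \<bullet> b"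
      unfolding mC[symmetric] inner_C[symmetric]
      by (intro set_integral_add(2) set_integrable_compact_continuous C continuous_intros)
    also have "(LINT z:?D|lborel. B * (R z ^ n / n) + (z \<bullet> b) * (R z ^ (n + 1) / (n + 1)))
      = B * (LINT z:?D|lborel. R z ^ n / n) + (LINT z:?D|lborel. (R z ^ (n + 1) / (n + 1)) *\<^sub>R z) \<bullet> b"
      unfolding inner_D[symmetric] set_integral_mult_right[symmetric]
      using n by (intro set_integral_add(2) set_integrable_compact_continuous compact_half_annulus continuous_intros contR) auto
    finally show "(ln 2 *\<^sub>R (LINT y:?C|lborel. y - p)) \<bullet> b = (LINT z:?D|lborel. (R z ^ (n + 1) / (n + 1)) *\<^sub>R z) \<bullet> b"
      unfolding vol[symmetric] by (simp add: algebra_simps)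
  qed
qed

subsection \<open>Differentiating cap integrals\<close>

text \<open>The symmetry about the line spanned by \<open>m = \<bar>u\<bar> e + u\<close>; it swaps the directions of
  \<open>u\<close> and the unit vector \<open>e\<close>.\<close>

definition swap_reflection :: "'a::euclidean_space \<Rightarrow> 'a \<Rightarrow> 'a" where
  "swap_reflection m w = (2 * (w \<bullet> m) / (m \<bullet> m)) *\<^sub>R m - w"

lemma swap_reflection_linear: "linear (swap_reflection m)"
  unfolding swap_reflection_def by (rule linearI) (auto simp: algebra_simps inner_add_left add_divide_distrib)

lemma swap_reflection_norm:
  assumes "m \<noteq> 0"
  shows "norm (swap_reflection m w) = norm w"
proof -
  let ?c = "2 * (w \<bullet> m) / (m \<bullet> m)"
  have "?c * (m \<bullet> m) = 2 * (w \<bullet> m)" using assms by simp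
  then have "?c * (?c * (m \<bullet> m)) = ?c * (2 * (w \<bullet> m))" by (rule arg_cong)
  then have "swap_reflection m w \<bullet> swap_reflection m w = w \<bullet> w"
    unfolding swap_reflection_def inner_diff_left inner_diff_right inner_scaleR_left inner_scaleR_right
    by (simp add: inner_commute[of m w])
  then show ?thesis by (simp add: norm_eq_sqrt_inner)
qed

lemma swap_reflection_inner:
  assumes e: "norm e = 1" and m: "m = norm u *\<^sub>R e + u" "m \<noteq> 0"
  shows "u \<bullet> swap_reflection m w = norm u * (e \<bullet> w)"
proof -
  have ee: "e \<bullet> e = 1" using e by (simp add: norm_eq_1)
  have uu: "u \<bullet> u = norm u * norm u" by (simp add: dot_square_norm power2_eq_square)
  have um: "m \<bullet> m = 2 * (u \<bullet> m)"
    unfolding m(1) inner_add_left inner_add_right inner_scaleR_left inner_scaleR_right ee uu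
    by (simp add: inner_commute[of e u] algebra_simps)
  have "m \<bullet> m \<noteq> 0" using m(2) by simp
  then have "2 * (w \<bullet> m) / (m \<bullet> m) * (u \<bullet> m) = w \<bullet> m" using um by simp
  then have "u \<bullet> swap_reflection m w = w \<bullet> m - u \<bullet> w"
    by (simp add: swap_reflection_def inner_diff_right)
  also have "\<dots> = norm u * (e \<bullet> w)" by (simp add: m(1) inner_add_right inner_commute)
  finally show ?thesis .
qed

text \<open>Moves the dependence on u from the domain into the integrand, as differentiation under
  the integral over a fixed compact set requires.\<close>

lemma set_integral_half_annulus_swap:
  fixes g :: "'a::euclidean_space \<Rightarrow> 'b::euclidean_space"
  assumes e: "norm e = 1" and m: "m = norm u *\<^sub>R e + u" "m \<noteq> 0" and u: "u \<noteq> 0"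
    and g: "continuous_on (- {0}) g"
  shows "(LINT z:half_annulus u|lborel. g z) = (LINT w:half_annulus e|lborel. g (swap_reflection m w))"
proof (rule set_integral_norm_preserving[OF swap_reflection_linear swap_reflection_norm[OF m(2)]])
  show "swap_reflection m x \<in> half_annulus u \<longleftrightarrow> x \<in> half_annulus e" for x
    using u by (simp add: half_annulus_def swap_reflection_norm[OF m(2)] swap_reflection_inner[OF e m] zero_le_mult_iff)
  show "set_integrable lborel (half_annulus u) g"
    by (intro set_integrable_compact_continuous compact_half_annulus continuous_on_subset[OF g])
       (auto dest: half_annulus_nonzero)
qed

lemma set_integral_cap_shift:
  assumes "compact K"
  shows "(LINT y:cap K u t|lborel. y - v) =
    measure lebesgue (cap K u t) *\<^sub>R (p - v) + (LINT y:cap K u t|lborel. y - p)"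
proof -
  let ?C = "cap K u t"
  have C: "compact ?C" by (rule compact_cap[OF assms])
  have "(LINT y:?C|lborel. y - v) = (LINT y:?C|lborel. (p - v) + (y - p))" by simp
  also have "\<dots> = (LINT y:?C|lborel. p - v) + (LINT y:?C|lborel. y - p)"
    by (intro set_integral_add(2) set_integrable_compact_continuous C continuous_intros)
  also have "(LINT y:?C|lborel. p - v) = measure lebesgue ?C *\<^sub>R (p - v)"
    using C emeasure_compact_finite[OF C]
    by (subst set_integral_const) (auto simp: borel_compact less_top)
  finally show ?thesis .
qed

text \<open>Caps cut by a hyperplane through \<open>p \<in> interior K\<close> are integrated in polar form around \<open>p\<close>;
  a reflection depending smoothly on \<open>u\<close> then makes the domain of integration independent of the
  hyperplane.\<close>

lemma Ck_on_open_cap_integrals: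
  fixes K :: "'a::euclidean_space set"
  assumes K: "compact K" "convex K"
    and R: "Ck_on_open k (\<lambda>q. radial_function K (fst q) (snd q)) (interior K \<times> (- {0}))"
    and u0: "u0 \<noteq> 0" and p0: "p0 \<in> interior K" "u0 \<bullet> p0 = t0"
  shows "\<exists>A. open A \<and> (u0, t0) \<in> A \<and>
    Ck_on_open k (\<lambda>a. measure lebesgue (cap K (fst a) (snd a))) A \<and>
    Ck_on_open k (\<lambda>a. LINT y:cap K (fst a) (snd a)|lborel. y - v) A \<and>
    (\<forall>a\<in>A. fst a \<noteq> 0 \<and> (\<exists>p\<in>interior K. fst a \<bullet> p = snd a))"
proof -
  define e where "e = u0 /\<^sub>R norm u0"
  have e: "norm e = 1" using u0 by (simp add: e_def)
  \<comment> \<open>At (u0, t0) the axis \<open>m\<close> is 2 u0, hence nonzero nearby.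
    \<open>P a\<close>, below, is the orthogonal projection of p0 to the hyperplane given by a; it
    equals p0 at (u0, t0), hence stays in the interior of K nearby.\<close>
  define m where "m = (\<lambda>a::'a \<times> real. norm (fst a) *\<^sub>R e + fst a)"
  define P where "P = (\<lambda>a::'a \<times> real. p0 + ((snd a - fst a \<bullet> p0) / (fst a \<bullet> fst a)) *\<^sub>R fst a)"
  define A0 where "A0 = {a::'a \<times> real. fst a \<noteq> 0}"
  have A0: "open A0"
  proof -
    have "A0 = fst -` (- {0})" by (auto simp: A0_def)
    then show ?thesis by (auto intro!: open_vimage continuous_intros)
  qed
  have cm0: "Ck_on_open k m A0" and cP0: "Ck_on_open k P A0"
  proof -
    have "Ck_on_open k (\<lambda>a::'a \<times> real. fst a) A0" "Ck_on_open k (\<lambda>a::'a \<times> real. snd a) A0"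
      by (intro Ck_on_open_fst Ck_on_open_snd Ck_on_open_ident A0)+
    note fs = this
    show "Ck_on_open k m A0" unfolding m_def
      by (intro Ck_on_open_add Ck_on_open_scaleR Ck_on_open_norm_compose fs Ck_on_open_const A0)
         (auto simp: A0_def)
    show "Ck_on_open k P A0" unfolding P_def
      by (intro Ck_on_open_add Ck_on_open_scaleR Ck_on_open_divide Ck_on_open_diff Ck_on_open_inner
          fs Ck_on_open_const A0) (auto simp: A0_def)
  qed
  define A where "A = (A0 \<inter> m -` (- {0})) \<inter> (A0 \<inter> P -` interior K)"
  have A: "open A" unfolding A_def
    by (intro open_Int continuous_open_preimage[OF Ck_on_open_imp_continuous_on[OF cm0] A0]
        continuous_open_preimage[OF Ck_on_open_imp_continuous_on[OF cP0] A0]) auto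
  have AD: "fst a \<noteq> 0" "m a \<noteq> 0" "P a \<in> interior K" if "a \<in> A" for a
    using that by (auto simp: A_def A0_def)
  have "A \<subseteq> A0" by (auto simp: A_def)
  note cm = Ck_on_open_subset[OF cm0 this] and cP = Ck_on_open_subset[OF cP0 this]
  have "m (u0, t0) = 2 *\<^sub>R u0" using u0 by (simp add: m_def e_def scaleR_2)
  then have a0: "(u0, t0) \<in> A" using u0 p0 by (simp add: A_def A0_def P_def)
  have uP: "fst a \<bullet> P a = snd a" if "a \<in> A" for a
    using AD(1)[OF that] by (simp add: P_def inner_add_right)
  define N where "N = - {0::'a}"
  have N: "open N" unfolding N_def by auto
  have AN: "open (A \<times> N)" using A N by (rule open_Times)
  let ?s = "\<lambda>z. swap_reflection (m (fst z)) (snd z)"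
  have cfst: "Ck_on_open k (\<lambda>z. f (fst z)) (A \<times> N)" if "Ck_on_open k f A" for f :: "'a \<times> real \<Rightarrow> 'a"
    by (rule Ck_on_open_compose[OF AN A _ that Ck_on_open_fst[OF AN Ck_on_open_ident[OF AN]]]) auto
  have cs: "Ck_on_open k ?s (A \<times> N)"
    unfolding swap_reflection_def
    by (intro Ck_on_open_diff Ck_on_open_scaleR Ck_on_open_divide Ck_on_open_mult Ck_on_open_inner
        Ck_on_open_const Ck_on_open_snd Ck_on_open_ident cfst[OF cm] AN) (auto dest: AD(2))
  let ?R = "\<lambda>z. radial_function K (P (fst z)) (?s z)"
  have snz: "?s z \<noteq> 0" if "z \<in> A \<times> N" for z
    using swap_reflection_norm[of "m (fst z)" "snd z"] AD(2)[of "fst z"] that by (auto simp: N_def)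
  have "Ck_on_open k (\<lambda>z. (P (fst z), ?s z)) (A \<times> N)"
    by (intro Ck_on_open_Pair cfst[OF cP] cs AN)
  note cPs = this
  have "(\<lambda>z. (P (fst z), ?s z)) \<in> A \<times> N \<rightarrow> interior K \<times> - {0}"
    using AD(3) snz by fastforce
  from Ck_on_open_compose[OF AN open_Times[OF open_interior N[unfolded N_def]] this R cPs]
  have cR: "Ck_on_open k ?R (A \<times> N)" by simp
  let ?n = "DIM('a)"
  have c1: "Ck_on_open k (\<lambda>a. LINT w:half_annulus e|lborel. ?R (a, w) ^ ?n / ?n) A"
    by (rule Ck_on_open_integral_parameter[OF A N compact_half_annulus])
       (auto simp: N_def[symmetric] dest: half_annulus_nonzero
         intro!: Ck_on_open_divide Ck_on_open_power Ck_on_open_const cR AN, auto simp: N_def dest: half_annulus_nonzero)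
  have c2: "Ck_on_open k (\<lambda>a. LINT w:half_annulus e|lborel. (?R (a, w) ^ (?n + 1) / (?n + 1)) *\<^sub>R ?s (a, w)) A"
    by (rule Ck_on_open_integral_parameter[OF A N compact_half_annulus])
       (auto simp: N_def[symmetric] dest: half_annulus_nonzero simp del: power_Suc
         intro!: Ck_on_open_divide Ck_on_open_power Ck_on_open_scaleR cs Ck_on_open_const cR AN, auto simp: N_def dest: half_annulus_nonzero)
  have contR: "continuous_on (- {0}) (radial_function K p)" if "p \<in> interior K" for p
    using that by (intro continuous_on_compose2[OF Ck_on_open_imp_continuous_on[OF R], where f = "\<lambda>z. (p, z)", simplified])
      (auto intro!: continuous_intros)
  have V: "measure lebesgue (cap K (fst a) (snd a)) = (LINT w:half_annulus e|lborel. ?R (a, w) ^ ?n / ?n) / ln 2"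
    and Y: "(LINT y:cap K (fst a) (snd a)|lborel. y - P a) =
      (1 / ln 2) *\<^sub>R (LINT w:half_annulus e|lborel. (?R (a, w) ^ (?n + 1) / (?n + 1)) *\<^sub>R ?s (a, w))"
    if a: "a \<in> A" for a
  proof -
    note c = contR[OF AD(3)[OF a]]
    note polar = cap_integrals_polar[OF K AD(3)[OF a] c, of "fst a", unfolded uP[OF a]]
    note swap = set_integral_half_annulus_swap[OF e m_def[THEN fun_cong, of a] AD(2)[OF a] AD(1)[OF a]]
    have "ln 2 * measure lebesgue (cap K (fst a) (snd a)) = (LINT w:half_annulus e|lborel. ?R (a, w) ^ ?n / ?n)"
      unfolding polar(1) by (subst swap) (auto intro!: continuous_intros c)
    then show "measure lebesgue (cap K (fst a) (snd a)) = (LINT w:half_annulus e|lborel. ?R (a, w) ^ ?n / ?n) / ln 2"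
      by (simp add: field_simps)
    have "ln 2 *\<^sub>R (LINT y:cap K (fst a) (snd a)|lborel. y - P a) =
        (LINT w:half_annulus e|lborel. (?R (a, w) ^ (?n + 1) / (?n + 1)) *\<^sub>R ?s (a, w))"
      unfolding polar(2) by (subst swap) (auto intro!: continuous_intros c)
    then show "(LINT y:cap K (fst a) (snd a)|lborel. y - P a) =
      (1 / ln 2) *\<^sub>R (LINT w:half_annulus e|lborel. (?R (a, w) ^ (?n + 1) / (?n + 1)) *\<^sub>R ?s (a, w))"
      by (metis (no_types, lifting) divideR_right inverse_eq_divide ln_gt_zero less_numeral_extra(3) one_less_numeral_iff semiring_norm(76))
  qed
  have cV: "Ck_on_open k (\<lambda>a. measure lebesgue (cap K (fst a) (snd a))) A"
    by (rule iffD2[OF Ck_on_open_cong[OF A V] Ck_on_open_divide[OF A c1 Ck_on_open_const]]) auto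
  have "(LINT y:cap K (fst a) (snd a)|lborel. y - v) = measure lebesgue (cap K (fst a) (snd a)) *\<^sub>R (P a - v) +
      (1 / ln 2) *\<^sub>R (LINT w:half_annulus e|lborel. (?R (a, w) ^ (?n + 1) / (?n + 1)) *\<^sub>R ?s (a, w))"
    if "a \<in> A" for a
    unfolding set_integral_cap_shift[OF K(1), of "fst a" "snd a" v "P a"] Y[OF that] ..
  note Yv = this
  have cY: "Ck_on_open k (\<lambda>a. LINT y:cap K (fst a) (snd a)|lborel. y - v) A"
    by (rule iffD2[OF Ck_on_open_cong[OF A Yv]])
       (assumption, intro Ck_on_open_add[OF A] Ck_on_open_scaleR[OF A] Ck_on_open_diff[OF A] cV cP c2 Ck_on_open_const)
  have "\<exists>p\<in>interior K. fst a \<bullet> p = snd a" if "a \<in> A" for a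
    by (rule bexI[where x = "P a"]) (rule uP[OF that], rule AD(3)[OF that])
  then show ?thesis
    by (intro exI[of _ A] conjI A a0 cV cY ballI AD(1); simp)
qed

section \<open>First variation of cap volume and moment\<close>

text \<open>A bound linear in the thickness without integrating sections: a slab of thickness
  parameter H in the half-size ball splits into N thin ones, each of which can be translated along u
  into the top thin slab of the full ball.\<close>

lemma slab_volume:
  fixes y0 u :: "'a::euclidean_space"
  assumes u: "u \<noteq> 0" and r: "r > 0" and t: "u \<bullet> y0 = t"
  shows "\<exists>c>0. \<exists>H>0. \<forall>N::nat. N > 0 \<longrightarrow>
    c / N \<le> measure lebesgue {y \<in> ball y0 r. t - H / N \<le> u \<bullet> y \<and> u \<bullet> y < t}"
proof -
  \<comment> \<open>Translations along u that raise u . y by at most H have length at most r / 2, so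
    they map the half-size ball into the full one.\<close>
  define H where "H = r / 2 * norm u"
  have H: "H > 0" using r u by (simp add: H_def)
  let ?S = "\<lambda>\<rho> a b. {y \<in> ball y0 \<rho>. a \<le> u \<bullet> y \<and> u \<bullet> y < b}"
  have S_eq: "?S \<rho> a b = ball y0 \<rho> \<inter> ({y. a \<le> u \<bullet> y} \<inter> {y. u \<bullet> y < b})" for \<rho> a b by auto
  have Sm: "?S \<rho> a b \<in> lmeasurable" for \<rho> a b
    unfolding S_eq by (rule fmeasurable_Int_fmeasurable)
      (auto intro!: sets.Int borel_closed borel_open closed_halfspace_ge open_halfspace_lt)
  define c where "c = measure lebesgue (?S (r / 2) (t - H) t)"
  have c: "c > 0"
  proof -
    let ?O = "ball y0 (r / 2) \<inter> {y. t - H < u \<bullet> y} \<inter> {y. u \<bullet> y < t}"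
    have uu: "u \<bullet> u = norm u * norm u" by (simp add: dot_square_norm power2_eq_square)
    have "y0 - (r / (4 * norm u)) *\<^sub>R u \<in> ?O"
      using r u t by (simp add: inner_diff_right uu H_def dist_norm field_simps)
    then have ne: "?O \<noteq> {}" by blast
    have op: "open ?O" by (intro open_Int open_ball open_halfspace_lt open_halfspace_gt)
    have "\<not> negligible ?O" using open_not_negligible[OF op ne] .
    moreover have "negligible ?O" if "negligible (?S (r / 2) (t - H) t)"
      by (rule negligible_subset[OF that]) auto
    ultimately have "\<not> negligible (?S (r / 2) (t - H) t)" by blast
    then have "measure lebesgue (?S (r / 2) (t - H) t) \<noteq> 0"
      using Sm negligible_iff_measure0 by blast
    then show ?thesis unfolding c_def by (simp add: less_le)
  qed
  have main: "c / N \<le> measure lebesgue (?S r (t - H / N) t)" if N: "N > 0" for N :: nat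
  proof -
    define \<kappa> where "\<kappa> = H / N"
    have \<kappa>: "\<kappa> > 0" using H N by (simp add: \<kappa>_def)
    let ?T = "\<lambda>j::nat. ?S (r / 2) (t - (j + 1) * \<kappa>) (t - j * \<kappa>)"
    have piece: "measure lebesgue (?T j) \<le> measure lebesgue (?S r (t - \<kappa>) t)" if j: "j < N" for j
    proof -
      let ?d = "(j * \<kappa> / (u \<bullet> u)) *\<^sub>R u"
      have ud: "u \<bullet> ?d = j * \<kappa>" using u by simp
      have "norm ?d = j * \<kappa> / norm u"
        using \<kappa> u by (simp add: dot_square_norm power2_eq_square)
      also have "\<dots> \<le> H / norm u"
      proof -
        have "real j * \<kappa> \<le> real N * \<kappa>" using j \<kappa> by (intro mult_right_mono) auto
        also have "\<dots> = H" using N by (simp add: \<kappa>_def)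
        finally show ?thesis by (simp add: divide_right_mono)
      qed
      also have "\<dots> = r / 2" using u by (simp add: H_def)
      finally have nd: "norm ?d \<le> r / 2" .
      have "(+) ?d ` ?T j \<subseteq> ?S r (t - \<kappa>) t"
      proof
        fix x assume "x \<in> (+) ?d ` ?T j"
        then obtain y where x: "x = ?d + y" and "y \<in> ?T j" by blast
        then have y: "dist y0 y < r / 2" "t - (j + 1) * \<kappa> \<le> u \<bullet> y" "u \<bullet> y < t - j * \<kappa>"
          by (auto simp: add.commute)
        have "dist y0 (?d + y) \<le> dist y0 y + norm ?d"
          by (metis add.commute dist_norm dist_triangle2 norm_minus_commute add_diff_cancel_left' dist_commute)
        then have "dist y0 x < r" unfolding x using y(1) nd by linarith
        moreover have "t - \<kappa> \<le> u \<bullet> x"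
          unfolding x inner_add_right ud using y(2) by (simp add: algebra_simps)
        moreover have "u \<bullet> x < t"
          unfolding x inner_add_right ud using y(3) by simp
        ultimately show "x \<in> ?S r (t - \<kappa>) t" by simp
      qed
      then have "measure lebesgue ((+) ?d ` ?T j) \<le> measure lebesgue (?S r (t - \<kappa>) t)"
        by (rule measure_mono_fmeasurable[OF _ fmeasurableD[OF measurable_translation[OF Sm]] Sm])
      then show ?thesis by (simp add: measure_translation)
    qed
    have "?S (r / 2) (t - H) t \<subseteq> (\<Union>j<N. ?T j)"
    proof
      fix y assume y: "y \<in> ?S (r / 2) (t - H) t"
      \<comment> \<open>The pieces are closed below and open above, j \<kappa> < t - u . y <= (j +
        1) \<kappa>, hence a ceiling minus 1 instead of a floor.\<close>
      define j where "j = nat (\<lceil>(t - u \<bullet> y) / \<kappa>\<rceil> - 1)"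
      have pos: "(t - u \<bullet> y) / \<kappa> > 0" using y \<kappa> by simp
      then have ceil: "\<lceil>(t - u \<bullet> y) / \<kappa>\<rceil> \<ge> 1" by (simp add: one_le_ceiling)
      have jr: "real j = of_int \<lceil>(t - u \<bullet> y) / \<kappa>\<rceil> - 1" using ceil by (simp add: j_def)
      have "(t - u \<bullet> y) / \<kappa> \<le> real j + 1" "real j < (t - u \<bullet> y) / \<kappa>"
        unfolding jr by linarith+
      then have b: "t - u \<bullet> y \<le> (real j + 1) * \<kappa>" "real j * \<kappa> < t - u \<bullet> y"
        using \<kappa> by (simp_all add: field_simps)
      have "real j * \<kappa> < real N * \<kappa>" using b(2) y N by (simp add: \<kappa>_def)
      then have "j < N" using \<kappa> by simp
      moreover have "y \<in> ?T j" using y b by auto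
      ultimately show "y \<in> (\<Union>j<N. ?T j)" by blast
    qed
    then have "c \<le> measure lebesgue (\<Union>j<N. ?T j)"
      unfolding c_def
      by (rule measure_mono_fmeasurable[OF _ fmeasurableD[OF Sm] fmeasurable.finite_UN[OF finite_lessThan Sm]])
    also have "\<dots> \<le> (\<Sum>j<N. measure lebesgue (?T j))"
      by (rule measure_UNION_le) (use Sm in auto)
    also have "\<dots> \<le> (\<Sum>j<N. measure lebesgue (?S r (t - \<kappa>) t))"
      by (intro sum_mono piece) auto
    also have "\<dots> = measure lebesgue (?S r (t - \<kappa>) t) * N" by (simp only: sum_constant card_lessThan mult.commute)
    finally show ?thesis using N by (simp only: \<kappa>_def[symmetric] pos_divide_le_eq of_nat_0_less_iff)
  qed
  show ?thesis
    by (rule exI[of _ c], rule conjI[OF c], rule exI[of _ H], rule conjI[OF H], intro allI impI, rule main) simp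
qed

text \<open>Sign arguments concern integrals of affine functions, while the derivatives are given
  for volume and moment about v; this translates between them.\<close>

lemma cap_affine_integral:
  assumes "compact K"
  shows "(LINT y:cap K u t|lborel. w \<bullet> y - s) =
    w \<bullet> (LINT y:cap K u t|lborel. y - v) - (s - w \<bullet> v) * measure lebesgue (cap K u t)"
proof -
  let ?C = "cap K u t"
  have C: "compact ?C" by (rule compact_cap[OF assms])
  have int: "set_integrable lborel ?C (\<lambda>y. y - v)"
    by (intro set_integrable_compact_continuous C continuous_intros)
  have "(LINT y:?C|lborel. w \<bullet> y - s) = (LINT y:?C|lborel. w \<bullet> (y - v) - (s - w \<bullet> v))"
    by (simp add: inner_diff_right)
  also have "\<dots> = (LINT y:?C|lborel. w \<bullet> (y - v)) - (LINT y:?C|lborel. s - w \<bullet> v)"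
    by (intro set_integral_diff(2) set_integrable_compact_continuous C continuous_intros)
  also have "(LINT y:?C|lborel. s - w \<bullet> v) = (s - w \<bullet> v) * measure lebesgue ?C"
    using C emeasure_compact_finite[OF C]
    by (subst set_integral_const) (auto simp: borel_compact less_top)
  also have "(LINT y:?C|lborel. w \<bullet> (y - v)) = w \<bullet> (LINT y:?C|lborel. y - v)"
    using integral_inner_right[of w lborel "\<lambda>y. indicator ?C y *\<^sub>R (y - v)"] int
    by (simp add: set_lebesgue_integral_def set_integrable_def)
  finally show ?thesis .
qed

lemma cap_affine_integrable:
  assumes "compact K"
  shows "integrable lborel (\<lambda>y. indicator (cap K u t) y * (w \<bullet> y - s))"
proof -
  have "set_integrable lborel (cap K u t) (\<lambda>y. w \<bullet> y - s)"
    by (intro set_integrable_compact_continuous compact_cap assms continuous_intros)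
  then show ?thesis by (simp add: set_integrable_def)
qed

text \<open>For fixed \<open>(u, t)\<close> the integral of \<open>u \<bullet> y - t\<close> over a cap is largest for the cap
  \<open>cap K u t\<close> itself, so its derivative there vanishes.\<close>

lemma cap_derivative_orthogonal:
  fixes K :: "'a::euclidean_space set"
  assumes K: "compact K"
    and dV: "((\<lambda>a. measure lebesgue (cap K (fst a) (snd a))) has_derivative dV) (at (u, t))"
    and dY: "((\<lambda>a. LINT y:cap K (fst a) (snd a)|lborel. y - v) has_derivative dY) (at (u, t))"
  shows "u \<bullet> dY h = (t - u \<bullet> v) * dV h"
proof -
  let ?E = "\<lambda>a. LINT y:cap K (fst a) (snd a)|lborel. u \<bullet> y - t"
  have "(?E has_derivative (\<lambda>h. u \<bullet> dY h - (t - u \<bullet> v) * dV h)) (at (u, t))"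
    unfolding cap_affine_integral[OF K, of _ _ u t v]
    by (intro has_derivative_diff has_derivative_inner_right has_derivative_mult_right dV dY)
  moreover have "?E a \<le> ?E (u, t)" for a
    unfolding set_lebesgue_integral_def real_scaleR_def
    by (intro integral_mono cap_affine_integrable K) (auto simp: cap_def indicator_def)
  ultimately have "(\<lambda>h. u \<bullet> dY h - (t - u \<bullet> v) * dV h) = (\<lambda>h. 0)"
    using differential_zero_maxmin[of "(u, t)" UNIV ?E] by blast
  then show ?thesis by (metis eq_iff_diff_eq_0)
qed

text \<open>Moving the cap from \<open>(u, t)\<close> to \<open>(u + \<tau> w, t + \<tau> s)\<close> increases the integral of
  \<open>w \<bullet> y - s\<close> at least by the contribution of a slab of thickness proportional to \<open>\<tau>\<close>.\<close>

lemma cap_derivative_positive: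
  fixes K :: "'a::euclidean_space set"
  assumes K: "compact K" and u: "u \<noteq> 0" and y0: "y0 \<in> interior K" "u \<bullet> y0 = t" and pos: "s < w \<bullet> y0"
    and dV: "((\<lambda>a. measure lebesgue (cap K (fst a) (snd a))) has_derivative dV) (at (u, t))"
    and dY: "((\<lambda>a. LINT y:cap K (fst a) (snd a)|lborel. y - v) has_derivative dY) (at (u, t))"
  shows "(s - w \<bullet> v) * dV (w, s) < w \<bullet> dY (w, s)"
proof -
  let ?E = "\<lambda>a. LINT y:cap K (fst a) (snd a)|lborel. w \<bullet> y - s"
  let ?D = "\<lambda>h. w \<bullet> dY h - (s - w \<bullet> v) * dV h"
  let ?e = "\<lambda>\<tau>. ?E ((u, t) + \<tau> *\<^sub>R (w, s))"
  have dE: "(?E has_derivative ?D) (at (u, t))"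
    unfolding cap_affine_integral[OF K, of _ _ w s v]
    by (intro has_derivative_diff has_derivative_inner_right has_derivative_mult_right dV dY)
  define \<eta> where "\<eta> = (w \<bullet> y0 - s) / 2"
  have \<eta>: "\<eta> > 0" using pos by (simp add: \<eta>_def)
  have "open (interior K \<inter> {y. s + \<eta> < w \<bullet> y})"
    by (intro open_Int open_interior open_halfspace_gt)
  moreover have "y0 \<in> interior K \<inter> {y. s + \<eta> < w \<bullet> y}"
    using y0 pos by (auto simp: \<eta>_def field_simps)
  ultimately obtain r where r: "r > 0" "ball y0 r \<subseteq> interior K \<inter> {y. s + \<eta> < w \<bullet> y}"
    by (meson openE)
  have rK: "y \<in> K" "s + \<eta> < w \<bullet> y" if "y \<in> ball y0 r" for y
    using subsetD[OF r(2) that] subsetD[OF interior_subset, of y K] by auto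
  obtain c H where c: "c > 0" and H: "H > 0"
    and slab: "\<And>N::nat. N > 0 \<Longrightarrow> c / N \<le> measure lebesgue {y \<in> ball y0 r. t - H / N \<le> u \<bullet> y \<and> u \<bullet> y < t}"
    using slab_volume[OF u r(1) y0(2)] by blast
  \<comment> \<open>Chosen so that \<tau> n * \<eta> = H / (n + 1): the slab estimate is available
    only for H / N with N a positive integer, and one sequence tending to 0 determines the
    derivative.\<close>
  define \<tau> where "\<tau> = (\<lambda>n::nat. H / \<eta> * inverse (real (Suc n)))"
  have \<tau>: "\<tau> n > 0" for n using H \<eta> by (simp add: \<tau>_def)
  have lower: "\<eta>\<^sup>2 * c / H \<le> (?e (\<tau> n) - ?e 0) / \<tau> n" for n
  proof -
    let ?S = "{y \<in> ball y0 r. t - H / Suc n \<le> u \<bullet> y \<and> u \<bullet> y < t}"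
    let ?c0 = "cap K u t" and ?c1 = "cap K (u + \<tau> n *\<^sub>R w) (t + \<tau> n * s)"
    have \<tau>\<eta>: "\<tau> n * \<eta> = H / Suc n" using \<eta> by (simp add: \<tau>_def field_simps del: of_nat_Suc)
    have S_eq: "?S = ball y0 r \<inter> ({y. t - H / Suc n \<le> u \<bullet> y} \<inter> {y. u \<bullet> y < t})" by auto
    have Sb: "?S \<in> sets borel"
      unfolding S_eq by (intro sets.Int borel_closed borel_open closed_halfspace_ge open_halfspace_lt open_ball)
    have Sfin: "emeasure lborel ?S < \<infinity>"
      by (rule emeasure_bounded_finite) (rule bounded_subset[OF bounded_ball[of y0 r]], auto)
    have iS: "integrable lborel (\<lambda>y. \<eta> * indicator ?S y)"
      using Sb Sfin by (intro integrable_mult_right integrable_real_indicator) auto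
    have "\<eta> * (c / Suc n) \<le> \<eta> * measure lebesgue ?S"
      using \<eta> slab[of "Suc n"] by (intro mult_left_mono) auto
    also have "\<dots> = (\<integral>y. \<eta> * indicator ?S y \<partial>lborel)"
      using Sb by (simp only: integral_mult_right_zero Bochner_Integration.integral_indicator
          measure_completion sets_lborel space_lborel space_borel Int_UNIV_right)
    also have "\<dots> \<le> (\<integral>y. indicator ?c1 y * (w \<bullet> y - s) - indicator ?c0 y * (w \<bullet> y - s) \<partial>lborel)"
    proof (intro integral_mono iS Bochner_Integration.integrable_diff cap_affine_integrable K)
      fix y :: 'a
      have mem1: "y \<in> ?c1 \<longleftrightarrow> y \<in> K \<and> 0 \<le> (u \<bullet> y - t) + \<tau> n * (w \<bullet> y - s)"
        by (simp add: cap_def inner_add_left algebra_simps)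
      have mem0: "y \<in> ?c0 \<longleftrightarrow> y \<in> K \<and> 0 \<le> u \<bullet> y - t" by (simp add: cap_def)
      \<comment> \<open>Points entering the cap have w . y > s and points leaving it have w . y < s,
        so no exchange lowers the integral; slab points enter with w . y - s > \<eta>.\<close>
      show "\<eta> * indicator ?S y \<le> indicator ?c1 y * (w \<bullet> y - s) - indicator ?c0 y * (w \<bullet> y - s)"
      proof (cases "y \<in> ?S")
        case True
        then have y: "y \<in> K" "s + \<eta> < w \<bullet> y" "t - \<tau> n * \<eta> \<le> u \<bullet> y" "u \<bullet> y < t"
          using rK[of y] \<tau>\<eta> by auto
        have "\<tau> n * \<eta> \<le> \<tau> n * (w \<bullet> y - s)" using \<tau>[of n] y(2) by (intro mult_left_mono) auto
        then have "y \<in> ?c1" "y \<notin> ?c0" unfolding mem1 mem0 using y by auto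
        then show ?thesis using True y(2) by simp
      next
        case False
        have "0 < w \<bullet> y - s" if "y \<in> ?c1" "y \<notin> ?c0"
          using that \<tau>[of n] unfolding mem1 mem0 by (smt (verit, best) zero_less_mult_pos)
        moreover have "w \<bullet> y - s < 0" if "y \<notin> ?c1" "y \<in> ?c0"
          using that \<tau>[of n] unfolding mem1 mem0 by (smt (verit, best) mult_nonneg_nonneg)
        ultimately show ?thesis using False by (cases "y \<in> ?c1"; cases "y \<in> ?c0") auto
      qed
    qed
    also have "\<dots> = ?e (\<tau> n) - ?e 0"
      unfolding set_lebesgue_integral_def
      using Bochner_Integration.integral_diff[OF cap_affine_integrable[OF K, of "u + \<tau> n *\<^sub>R w" "t + \<tau> n * s" w s] cap_affine_integrable[OF K, of u t w s]]
      by simp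
    finally have "\<eta> * (c / Suc n) / \<tau> n \<le> (?e (\<tau> n) - ?e 0) / \<tau> n"
      using \<tau>[of n] by (intro divide_right_mono) auto
    moreover have "\<eta> * (c / Suc n) / \<tau> n = \<eta>\<^sup>2 * c / H"
      using \<eta> H by (simp add: \<tau>_def field_simps power2_eq_square del: of_nat_Suc)
    ultimately show ?thesis by simp
  qed
  have "(?e has_derivative (\<lambda>\<tau>. ?D (\<tau> *\<^sub>R (w, s)))) (at 0)"
    by (rule has_derivative_compose[where f = "\<lambda>\<tau>. (u, t) + \<tau> *\<^sub>R (w, s)" and g = ?E])
       (use dE in \<open>auto intro!: derivative_eq_intros\<close>)
  moreover have "?D (\<tau> *\<^sub>R (w, s)) = \<tau> * ?D (w, s)" for \<tau>
    using linear_scale[OF has_derivative_linear[OF dE], of \<tau> "(w, s)"] by (simp only: real_scaleR_def)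
  ultimately have "(?e has_real_derivative ?D (w, s)) (at 0)"
    by (simp add: has_field_derivative_def mult_commute_abs)
  then have "((\<lambda>\<tau>. (?e \<tau> - ?e 0) / \<tau>) \<longlongrightarrow> ?D (w, s)) (at 0)"
    by (simp add: DERIV_def)
  moreover have "filterlim \<tau> (at 0) sequentially"
  proof -
    have "\<tau> \<longlonglongrightarrow> H / \<eta> * 0" unfolding \<tau>_def by (intro tendsto_intros LIMSEQ_inverse_real_of_nat)
    then show ?thesis using \<tau> by (auto simp: filterlim_at intro!: always_eventually less_imp_neq[THEN not_sym])
  qed
  ultimately have lim: "(\<lambda>n. (?e (\<tau> n) - ?e 0) / \<tau> n) \<longlonglongrightarrow> ?D (w, s)"
    by (rule filterlim_compose)
  have "\<eta>\<^sup>2 * c / H \<le> ?D (w, s)"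
    by (rule LIMSEQ_le_const[OF lim]) (use lower in blast)
  moreover have "\<eta>\<^sup>2 * c / H > 0" using \<eta> c H by simp
  ultimately show ?thesis by linarith
qed

text \<open>Positivity for (w, s) and for (- w, - s) forces w . y = s at all interior points of K on
  the hyperplane. This is a relatively open piece of it, so (w, s) is proportional to (u, t): the
  kernel consists of rescalings only.\<close>

lemma cap_derivative_kernel:
  fixes K :: "'a::euclidean_space set"
  assumes K: "compact K" and u: "u \<noteq> 0" and p: "p \<in> interior K" "u \<bullet> p = t"
    and dV: "((\<lambda>a. measure lebesgue (cap K (fst a) (snd a))) has_derivative dV) (at (u, t))"
    and dY: "((\<lambda>a. LINT y:cap K (fst a) (snd a)|lborel. y - v) has_derivative dY) (at (u, t))"
    and zero: "dV (w, s) = 0" "dY (w, s) = 0"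
  shows "\<exists>c. w = c *\<^sub>R u \<and> s = c * t"
proof -
  have eq: "w \<bullet> y = s" if y: "y \<in> interior K" "u \<bullet> y = t" for y
  proof -
    have "\<not> s < w \<bullet> y"
    proof
      assume "s < w \<bullet> y"
      from cap_derivative_positive[OF K u y this dV dY] zero show False by simp
    qed
    moreover have "\<not> - s < (- w) \<bullet> y"
    proof
      have "dV (- w, - s) = 0" "dY (- w, - s) = 0"
        using linear_neg[OF has_derivative_linear[OF dV], of "(w, s)"]
          linear_neg[OF has_derivative_linear[OF dY], of "(w, s)"] zero by auto
      moreover assume "- s < (- w) \<bullet> y"
      note cap_derivative_positive[OF K u y this dV dY]
      ultimately show False by simp
    qed
    ultimately show ?thesis by simp
  qed
  define c where "c = (w \<bullet> u) / (u \<bullet> u)"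
  define z where "z = w - c *\<^sub>R u"
  have uz: "u \<bullet> z = 0" using u by (simp add: z_def c_def inner_diff_right inner_commute)
  obtain r where r: "r > 0" "ball p r \<subseteq> interior K" using p(1) open_interior by (meson openE)
  define \<epsilon> where "\<epsilon> = r / (2 * (norm z + 1))"
  have nz: "norm z + 1 > 0" using norm_ge_zero[of z] by linarith
  have \<epsilon>: "\<epsilon> > 0" using r nz by (simp add: \<epsilon>_def)
  have "norm (\<epsilon> *\<^sub>R z) < r"
  proof -
    have "\<epsilon> * norm z \<le> \<epsilon> * (norm z + 1)" using \<epsilon> by simp
    also have "\<dots> = r / 2" using nz by (simp add: \<epsilon>_def field_simps)
    also have "\<dots> < r" using r(1) by simp
    finally show ?thesis using \<epsilon> by simp
  qed
  then have "p + \<epsilon> *\<^sub>R z \<in> interior K" by (intro subsetD[OF r(2)]) (simp add: dist_norm)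
  then have "w \<bullet> (p + \<epsilon> *\<^sub>R z) = s" using p uz by (intro eq) (auto simp: inner_add_right)
  then have "w \<bullet> z = 0" using eq[OF p] \<epsilon> by (simp add: inner_add_right)
  then have "z \<bullet> z = 0" using uz by (simp add: z_def inner_diff_left inner_diff_right inner_commute)
  then have w: "w = c *\<^sub>R u" by (simp add: z_def)
  with eq[OF p] p(2) show ?thesis by (intro exI[of _ c]) auto
qed

subsection \<open>Smoothness of the Ulam floating body\<close>

context floating_body
begin

lemma set_integral_cap_centroid:
  assumes vol: "measure lebesgue (cap K u t) = \<delta>"
  shows "(LINT y:cap K u t|lborel. y - v) = \<delta> *\<^sub>R (centroid (indicator (cap K u t)) - v)"
proof -
  let ?C = "cap K u t"
  have "(LINT y|\<mu>. indicator ?C y *\<^sub>R y) = (LINT y|lebesgue. indicator K y *\<^sub>R (indicator ?C y *\<^sub>R y))"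
    by (rule integral_restrict_space) simp
  also have "\<dots> = (LINT y|lebesgue. indicator ?C y *\<^sub>R y)"
    using cap_subset[of K u t] by (intro Bochner_Integration.integral_cong) (auto simp: indicator_def)
  also have "\<dots> = (LINT y:?C|lborel. y)"
    unfolding set_lebesgue_integral_def by (rule integral_completion) measurable
  finally have "centroid (indicator ?C) = (1 / \<delta>) *\<^sub>R (LINT y:?C|lborel. y)" by (simp add: centroid_def)
  moreover have "(LINT y:?C|lborel. y - v) = \<delta> *\<^sub>R (0 - v) + (LINT y:?C|lborel. y - 0)"
    using set_integral_cap_shift[OF compact_K, of u t v 0] vol by simp
  ultimately show ?thesis using \<delta>_pos by (simp add: scaleR_diff_right)
qed

text \<open>Both functionals support the body at the same point, which is therefore the centroid of
  the caps in both directions. The directions are then proportional, and the common value 1 fixes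
  the factor.\<close>

lemma polar_normal_unique:
  assumes v: "v \<in> interior (ulam_floating_body \<delta> K)" and x: "x \<noteq> 0"
    and w: "w \<in> centered_polar (ulam_floating_body \<delta> K) v" "radial_function (ulam_floating_body \<delta> K) v x * (x \<bullet> w) = 1"
    and w': "w' \<in> centered_polar (ulam_floating_body \<delta> K) v" "radial_function (ulam_floating_body \<delta> K) v x * (x \<bullet> w') = 1"
  shows "w' = w"
proof -
  let ?M = "ulam_floating_body \<delta> K" let ?z = "v + radial_function ?M v x *\<^sub>R x"
  have zM: "?z \<in> ?M" by (rule radial_function_props(2)[OF compact_ulam v x])
  have cap_z: "w \<noteq> 0 \<and> (\<forall>t. measure lebesgue (cap K w t) = \<delta> \<longrightarrow> ?z = centroid (indicator (cap K w t)))"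
    if "w \<in> centered_polar ?M v" "radial_function ?M v x * (x \<bullet> w) = 1" for w
  proof (intro conjI allI impI)
    show w0: "w \<noteq> 0" using that(2) by auto
    fix t assume t: "measure lebesgue (cap K w t) = \<delta>"
    have "w \<bullet> y \<le> w \<bullet> ?z" if "y \<in> ?M" for y
    proof -
      have "(y - v) \<bullet> w \<le> 1" using \<open>w \<in> centered_polar ?M v\<close> that by (auto simp: centered_polar_def)
      also have "1 = (?z - v) \<bullet> w" using \<open>radial_function ?M v x * (x \<bullet> w) = 1\<close> by simp
      finally show ?thesis by (simp add: inner_diff_right inner_add_right inner_commute[of _ w])
    qed
    then show "?z = centroid (indicator (cap K w t))"
      using zM closure_subset w0 by (intro ulam_supporting_point[OF _ w0 _ t]) auto
  qed
  obtain t t' where t: "measure lebesgue (cap K w t) = \<delta>" "measure lebesgue (cap K w' t') = \<delta>"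
    using cap_volume_exists[OF conjunct1[OF cap_z[OF w]]] cap_volume_exists[OF conjunct1[OF cap_z[OF w']]]
    by (elim exE)
  have "centroid (indicator (cap K w t)) = centroid (indicator (cap K w' t'))"
    using mp[OF spec[OF conjunct2[OF cap_z[OF w]]] t(1)] mp[OF spec[OF conjunct2[OF cap_z[OF w']]] t(2)]
    by (rule trans[OF sym])
  then obtain c where c: "w' = c *\<^sub>R w"
    using cap_normal_unique[OF _ _ t] cap_z[OF w] cap_z[OF w'] by auto
  have "c * (radial_function ?M v x * (x \<bullet> w)) = 1" using w'(2) by (simp add: c mult_ac)
  with w(2) c show ?thesis by simp
qed

text \<open>The normal at a boundary point is found by inverting
  \<open>(u, t) \<mapsto> ((u \<bullet> u\<^sub>1) \<cdot> moment of the cap, volume of the cap)\<close>; the factor \<open>u \<bullet> u\<^sub>1\<close> uses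
  the freedom of rescaling \<open>(u, t)\<close> to match the lengths of the two sides.\<close>

lemma Ck_on_open_polar_normal:
  assumes R: "Ck_on_open (Suc k) (\<lambda>q. radial_function K (fst q) (snd q)) (interior K \<times> (- {0}))"
    and v: "v \<in> interior (ulam_floating_body \<delta> K)"
    and \<nu>: "\<And>x. x \<noteq> 0 \<Longrightarrow> \<nu> x \<in> centered_polar (ulam_floating_body \<delta> K) v"
      "\<And>x. x \<noteq> 0 \<Longrightarrow> radial_function (ulam_floating_body \<delta> K) v x * (x \<bullet> \<nu> x) = 1"
  shows "Ck_on_open (Suc k) \<nu> (- {0})"
proof (rule Ck_on_open_local)
  fix x0 :: 'a assume "x0 \<in> - {0}"
  then have x0: "x0 \<noteq> 0" by simp
  let ?M = "ulam_floating_body \<delta> K"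
  let ?V = "\<lambda>a :: 'a \<times> real. measure lebesgue (cap K (fst a) (snd a))"
  let ?Y = "\<lambda>a :: 'a \<times> real. LINT y:cap K (fst a) (snd a)|lborel. y - v"
  let ?\<rho> = "radial_function ?M v"
  define u0 where "u0 = \<nu> x0"
  note radial = radial_function_props[OF compact_ulam v]
  have \<rho>0: "?\<rho> x0 > 0" by (rule radial(1)[OF x0])
  have u0: "u0 \<noteq> 0" using \<nu>(2)[OF x0] by (auto simp: u0_def)
  obtain t0 where t0: "measure lebesgue (cap K u0 t0) = \<delta>" using cap_volume_exists[OF u0] by blast
  obtain p0 where p0: "p0 \<in> interior K" "u0 \<bullet> p0 = t0" using cap_hyperplane_interior[OF u0 t0] by blast
  have z0: "v + ?\<rho> x0 *\<^sub>R x0 = centroid (indicator (cap K u0 t0))"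
  proof (rule ulam_supporting_point[OF _ u0 _ t0])
    show "v + ?\<rho> x0 *\<^sub>R x0 \<in> closure ?M" using radial(2)[OF x0] closure_subset by blast
    fix y assume "y \<in> ?M"
    then have "(y - v) \<bullet> u0 \<le> 1" using \<nu>(1)[OF x0] by (auto simp: u0_def centered_polar_def)
    also have "1 = ?\<rho> x0 * (x0 \<bullet> u0)" using \<nu>(2)[OF x0] by (simp add: u0_def)
    finally show "u0 \<bullet> y \<le> u0 \<bullet> (v + ?\<rho> x0 *\<^sub>R x0)"
      by (simp add: inner_diff_right inner_add_right inner_commute[of _ u0])
  qed
  have Y0: "?Y (u0, t0) = (\<delta> * ?\<rho> x0) *\<^sub>R x0"
    using set_integral_cap_centroid[OF t0, of v] z0[symmetric] by simp
  \<comment> \<open>Normalized so that u0 . u1 cancels the factor \<delta> \<rho>(x0) of the moment,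
    giving \<Psi> (u0, t0) = (x0, \<delta>).\<close>
  define u1 where "u1 = (1 / (\<delta> * ?\<rho> x0 * (u0 \<bullet> u0))) *\<^sub>R u0"
  have u01: "u0 \<bullet> u1 = 1 / (\<delta> * ?\<rho> x0)" using u0 by (simp add: u1_def)
  obtain A where A: "open A" "(u0, t0) \<in> A" and cV: "Ck_on_open (Suc k) ?V A" and cY: "Ck_on_open (Suc k) ?Y A"
    and A': "\<forall>a\<in>A. fst a \<noteq> 0 \<and> (\<exists>p\<in>interior K. fst a \<bullet> p = snd a)"
    using Ck_on_open_cap_integrals[OF compact_K convex_K R u0 p0, of v] by (elim exE conjE)
  have Anz: "fst a \<noteq> 0" and Ap: "\<exists>p\<in>interior K. fst a \<bullet> p = snd a" if "a \<in> A" for a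
    using bspec[OF A' that] by auto
  have cu: "Ck_on_open (Suc k) (\<lambda>a :: 'a \<times> real. fst a) A"
    by (intro Ck_on_open_fst Ck_on_open_ident A(1))
  have cuu: "Ck_on_open (Suc k) (\<lambda>a :: 'a \<times> real. fst a \<bullet> u1) A"
    by (rule Ck_on_open_inner[OF A(1) cu Ck_on_open_const])
  have cuY: "Ck_on_open (Suc k) (\<lambda>a. fst a \<bullet> ?Y a) A"
    by (rule Ck_on_open_inner[OF A(1) cu cY])
  define W where "W = (A \<inter> (\<lambda>a. fst a \<bullet> u1) -` {0<..}) \<inter> (A \<inter> (\<lambda>a. fst a \<bullet> ?Y a) -` {0<..})"
  have W: "open W" unfolding W_def
    by (intro open_Int continuous_open_preimage[OF Ck_on_open_imp_continuous_on[OF cuu] A(1)]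
        continuous_open_preimage[OF Ck_on_open_imp_continuous_on[OF cuY] A(1)]) auto
  have WA: "W \<subseteq> A" by (auto simp: W_def)
  have Wpos: "fst a \<bullet> u1 > 0" "fst a \<bullet> ?Y a > 0" if "a \<in> W" for a using that by (auto simp: W_def)
  have "u0 \<bullet> ?Y (u0, t0) = \<delta> * (?\<rho> x0 * (x0 \<bullet> u0))"
    unfolding Y0 by (simp add: inner_commute[of u0])
  also have "\<dots> = \<delta>" using \<nu>(2)[OF x0] by (simp add: u0_def)
  finally have a0W: "(u0, t0) \<in> W"
    using A(2) u01 \<delta>_pos \<rho>0 by (simp add: W_def)
  define \<Psi> where "\<Psi> = (\<lambda>a. ((fst a \<bullet> u1) *\<^sub>R ?Y a, ?V a))"
  have \<Psi>: "Ck_on_open (Suc k) \<Psi> W"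
    unfolding \<Psi>_def
    by (rule Ck_on_open_subset[OF Ck_on_open_Pair[OF A(1) Ck_on_open_scaleR[OF A(1) cuu cY] cV] WA])
  have inj: "inj (frechet_derivative \<Psi> (at a))" if a: "a \<in> W" for a
  proof -
    obtain u t where ut: "a = (u, t)" by (cases a)
    have aA: "a \<in> A" using a WA by blast
    let ?dV = "frechet_derivative ?V (at a)" and ?dY = "frechet_derivative ?Y (at a)"
    have dV: "(?V has_derivative ?dV) (at (u, t))" and dY: "(?Y has_derivative ?dY) (at (u, t))"
      using Ck_on_open_Suc_derivative[OF cV aA] Ck_on_open_Suc_derivative[OF cY aA] by (simp_all add: ut)
    have "((\<lambda>a. fst a \<bullet> u1) has_derivative (\<lambda>h. fst h \<bullet> u1)) (at (u, t))"
      by (auto intro!: derivative_eq_intros)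
    from has_derivative_Pair[OF has_derivative_scaleR[OF this dY] dV]
    have D: "(\<Psi> has_derivative (\<lambda>h. ((u \<bullet> u1) *\<^sub>R ?dY h + (fst h \<bullet> u1) *\<^sub>R ?Y a, ?dV h))) (at a)"
      unfolding \<Psi>_def ut by simp
    \<comment> \<open>Taking the inner product with u removes dY by orthogonality and leaves w . u1
      = 0. Then dY vanishes too, so h is a multiple of (u, t), and u . u1 > 0 excludes nonzero
      multiples.\<close>
    have "h = 0" if hz: "(u \<bullet> u1) *\<^sub>R ?dY h + (fst h \<bullet> u1) *\<^sub>R ?Y a = 0" "?dV h = 0" for h
    proof -
      obtain w s where h: "h = (w, s)" by (cases h)
      have pos: "u \<bullet> u1 > 0" "u \<bullet> ?Y a > 0" using Wpos[OF a] by (simp_all add: ut)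
      have "u \<bullet> ?dY h = 0"
        using cap_derivative_orthogonal[OF compact_K dV dY, of h] hz(2) by simp
      then have "(w \<bullet> u1) * (u \<bullet> ?Y a) = 0"
        using arg_cong[OF hz(1), of "\<lambda>y. u \<bullet> y"] by (simp add: inner_add_right h)
      then have w1: "w \<bullet> u1 = 0" using pos by simp
      then have dY0: "?dY (w, s) = 0" using hz(1) pos by (simp add: h)
      obtain p where p: "p \<in> interior K" "u \<bullet> p = t" using Ap[OF aA] by (auto simp: ut)
      obtain c where c: "w = c *\<^sub>R u" "s = c * t"
        using cap_derivative_kernel[OF compact_K _ p dV dY _ dY0] Anz[OF aA] hz(2) by (auto simp: ut h)
      have "c = 0" using w1 pos by (simp add: c)
      then show ?thesis by (simp add: h c zero_prod_def)
    qed
    then show ?thesis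
      unfolding frechet_derivative_at[OF D, symmetric]
      using has_derivative_linear[OF D] by (auto simp: linear_injective_0 zero_prod_def)
  qed
  obtain U' G \<psi> where U': "open U'" "U' \<subseteq> W" "(u0, t0) \<in> U'" and G: "open G"
    and hom: "homeomorphism U' G \<Psi> \<psi>" and \<psi>: "Ck_on_open (Suc k) \<psi> G"
    using Ck_on_open_inverse_function[OF W \<Psi> inj a0W] by metis
  define N where "N = (\<lambda>x. (x, \<delta>)) -` G"
  have N: "open N" unfolding N_def by (intro open_vimage G continuous_intros)
  have "\<Psi> (u0, t0) \<in> G" using hom U'(3) by (auto simp: homeomorphism_def)
  moreover have "\<Psi> (u0, t0) = (x0, \<delta>)"
  proof -
    have "(u0 \<bullet> u1) *\<^sub>R ?Y (u0, t0) = x0" unfolding Y0 u01 using \<delta>_pos \<rho>0 by simp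
    then show ?thesis using t0 by (simp add: \<Psi>_def)
  qed
  ultimately have x0N: "x0 \<in> N" by (simp add: N_def)
  let ?a = "\<lambda>x. \<psi> (x, \<delta>)"
  have ain: "?a x \<in> U'" and eq: "\<Psi> (?a x) = (x, \<delta>)" if "x \<in> N" for x
    using hom that by (auto simp: N_def homeomorphism_def)
  have aW: "?a x \<in> W" if "x \<in> N" for x using ain[OF that] U'(2) by auto
  have ca: "Ck_on_open (Suc k) ?a N"
    by (rule Ck_on_open_compose[OF N G _ \<psi> Ck_on_open_Pair[OF N Ck_on_open_ident[OF N] Ck_on_open_const]])
       (auto simp: N_def)
  have cN: "Ck_on_open (Suc k) (\<lambda>x. (\<delta> / (fst (?a x) \<bullet> ?Y (?a x))) *\<^sub>R fst (?a x)) N"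
  proof (rule Ck_on_open_scaleR[OF N Ck_on_open_divide[OF N Ck_on_open_const] Ck_on_open_fst[OF N ca]])
    have "?a \<in> N \<rightarrow> A" using aW WA by auto
    from Ck_on_open_compose[OF N A(1) this cuY ca]
    show "Ck_on_open (Suc k) (\<lambda>x. fst (?a x) \<bullet> ?Y (?a x)) N" .
    show "fst (?a x) \<bullet> ?Y (?a x) \<noteq> 0" if "x \<in> N" for x using Wpos(2)[OF aW[OF that]] by simp
  qed
  \<comment> \<open>On the slice of volume \<delta>, the local inverse gives a cap whose centroid b
    lies on the ray from v through v + x. Since the moment is \<delta> (b - v), the factor rescales
    u to take the value 1 on b - v.\<close>
  have \<nu>_eq: "\<nu> x = (\<delta> / (fst (?a x) \<bullet> ?Y (?a x))) *\<^sub>R fst (?a x)" if x: "x \<in> N" for x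
  proof -
    obtain u t where ut: "?a x = (u, t)" by (cases "?a x")
    have vol: "measure lebesgue (cap K u t) = \<delta>" and xY: "(u \<bullet> u1) *\<^sub>R ?Y (u, t) = x"
      using eq[OF x] by (simp_all add: \<Psi>_def ut)
    define b where "b = centroid (indicator (cap K u t))"
    have Y: "?Y (u, t) = \<delta> *\<^sub>R (b - v)" using set_integral_cap_centroid[OF vol] by (simp add: b_def)
    have pos: "u \<bullet> u1 > 0" "u \<bullet> ?Y (u, t) > 0" using Wpos[OF aW[OF x]] by (simp_all add: ut)
    have "\<delta> * (u \<bullet> (b - v)) > 0" using pos(2) unfolding Y by simp
    then have ubv: "u \<bullet> (b - v) > 0" using \<delta>_pos by (simp only: zero_less_mult_pos)
    define c where "c = (u \<bullet> u1) * \<delta>"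
    have c: "c > 0" using pos \<delta>_pos by (simp add: c_def)
    have xc: "x = c *\<^sub>R (b - v)" using xY unfolding Y by (simp add: c_def)
    have xnz: "x \<noteq> 0" using c ubv by (auto simp: xc)
    define w where "w = (1 / (u \<bullet> (b - v))) *\<^sub>R u"
    have w_eq: "(\<delta> / (u \<bullet> ?Y (u, t))) *\<^sub>R u = w" unfolding Y w_def using \<delta>_pos by simp
    have w: "w \<in> centered_polar ?M v"
      unfolding centered_polar_def
    proof (intro CollectI ballI)
      fix y assume "y \<in> ?M"
      then obtain f where "y = centroid f" "admissible f" by (auto simp: ulam_floating_body_eq)
      then have "u \<bullet> y \<le> u \<bullet> b" using centroid_le_cap[OF _ vol] by (simp add: b_def)
      then have "(y - v) \<bullet> u \<le> u \<bullet> (b - v)" by (simp add: inner_diff_left inner_diff_right inner_commute)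
      then show "(y - v) \<bullet> w \<le> 1" using ubv by (simp add: w_def)
    qed
    have xw: "x \<bullet> w = c" using ubv by (simp add: xc w_def inner_commute)
    \<comment> \<open>The polar inequality bounds the radial function from above; the point b = v +
      x / c of the body bounds it from below.\<close>
    have "?\<rho> x * c \<le> 1" using centered_polar_radial_le[OF compact_ulam v xnz w] by (simp add: xw)
    moreover have "1 / c \<le> ?\<rho> x"
      using c centroid_cap_mem[OF vol] by (intro radial(3)[OF xnz]) (auto simp: xc b_def)
    then have "1 \<le> ?\<rho> x * c" using c by (simp add: pos_divide_le_eq)
    ultimately have "?\<rho> x * (x \<bullet> w) = 1" by (simp add: xw)
    from polar_normal_unique[OF v xnz w this \<nu>(1)[OF xnz] \<nu>(2)[OF xnz]]
    show ?thesis using w_eq by (simp add: ut)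
  qed
  have "Ck_on_open (Suc k) \<nu> N" by (rule iffD2[OF Ck_on_open_cong[OF N \<nu>_eq] cN])
  with N x0N show "\<exists>N. open N \<and> x0 \<in> N \<and> Ck_on_open (Suc k) \<nu> N" by blast
qed

theorem Ck_boundary_ulam:
  assumes "Ck_boundary k K"
  shows "Ck_boundary (Suc k) (ulam_floating_body \<delta> K)"
proof -
  let ?M = "ulam_floating_body \<delta> K"
  obtain v where v: "v \<in> interior ?M" using interior_ulam by blast
  obtain q where q: "q \<in> interior K" "Ck_on k (radial_function K q) (sphere 0 1)"
    using assms by (auto simp: Ck_boundary_def)
  have ex: "\<exists>w. w \<in> centered_polar ?M v \<and> radial_function ?M v x * (x \<bullet> w) = 1" if "x \<noteq> 0" for x
    using centered_polar_normal_exists[OF compact_ulam convex_ulam v that] by blast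
  define \<nu> where "\<nu> = (\<lambda>x. SOME w. w \<in> centered_polar ?M v \<and> radial_function ?M v x * (x \<bullet> w) = 1)"
  have \<nu>: "\<nu> x \<in> centered_polar ?M v" "radial_function ?M v x * (x \<bullet> \<nu> x) = 1" if "x \<noteq> 0" for x
    using someI_ex[OF ex[OF that]] by (auto simp: \<nu>_def)
  \<comment> \<open>A positive order gives K a C^1 gauge, to which the inverse function theorem can
    be applied; order 0 is settled by the uniqueness of normals.\<close>
  have "Ck_on_open k \<nu> (- {0})" if "k > 0"
  proof -
    obtain j where k: "k = Suc j" using \<open>k > 0\<close> gr0_implies_Suc by blast
    have "Ck_on_open k (radial_function K q) (- {0})"
      by (rule Ck_on_sphere_radial_function[OF compact_K convex_K q])
    then have "Ck_on_open (Suc j) (\<lambda>q. radial_function K (fst q) (snd q)) (interior K \<times> (- {0}))"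
      unfolding k by (rule Ck_on_open_radial_function_moving[OF compact_K convex_K q(1)])
    from Ck_on_open_polar_normal[OF this v \<nu>] show ?thesis by (simp add: k)
  qed
  then have C: "Ck_on_open (Suc k) (radial_function ?M v) (- {0})"
    using polar_normal_unique[OF v] \<nu>
    by (intro Ck_on_open_radial_function[OF compact_ulam convex_ulam v, of \<nu>]) auto
  have "Ck_on (Suc k) (radial_function ?M v) (sphere 0 1)"
    unfolding Ck_on_def
  proof
    fix x :: 'a assume "x \<in> sphere 0 1"
    then show "\<exists>U g. open U \<and> x \<in> U \<and> Ck_on_open (Suc k) g U \<and> (\<forall>y\<in>sphere 0 1 \<inter> U. g y = radial_function ?M v y)"
      using C by (intro exI[of _ "- {0}"] exI[of _ "radial_function ?M v"]) auto
  qed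
  with v show ?thesis by (auto simp: Ck_boundary_def)
qed

end

theorem theorem1p2:
  fixes K :: "(real ^ 'n) set" and k :: nat and \<delta> :: real
  assumes "convex_body K"
    and "Ck_boundary k K"
    and "0 < \<delta>" and "\<delta> < measure lebesgue K"
  shows "Ck_boundary (k + 1) (ulam_floating_body \<delta> K)"
proof -
  interpret floating_body K \<delta>
    using assms by unfold_locales (auto simp: convex_body_def)
  show ?thesis using Ck_boundary_ulam[OF assms(2)] by simp
qed

end
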